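(* Let $X$ be a regular linear diffusion on the open interval $E=(l,r)\subseteq\mathbb{R}$, let $q>0$, let $g,c:E\to[0,\infty)$ be continuous, put $C_t=\int_0^t c(X_s)e^{-qs}\,ds$ for $t\in[0,\infty]$, and fix $x\in E$. Assume that $\delta(y)=\mathbb{E}_y[C_\infty]$ is finite for all $y\in E$. Then $$\sup_{T\in\Sigma_\infty^X}\mathbb{E}_x\big[e^{-qT}g(X_T)-C_T\big]=\sup_{B\in\mathcal{O}}\mathbb{E}_x^{h^B}\!\left[\frac{g(X_{T_B})+\delta(X_{T_B})}{h^B(X_{T_B})}\right]-\delta(x),$$ so that solving the optimal stopping problem on the left amounts to solving the optimal stopping problem $\sup_{B\in\mathcal{O}}\mathbb{E}_x^{h^B}\big[(g+\delta)(X_{T_B})/h^B(X_{T_B})\big]$. Moreover, suppose there exists $B^*\in\mathcal{O}$ such that for every $u^*\in\partial B^*$ one has $$\frac{g(u^* )+\delta(u^* )}{h^{B^*}(u^* )}=\sup_{B\in\mathcal{O},\ u\in\partial B}\frac{g(u)+\delta(u)}{h^{B}(u)}.$$ Then, for $u^*\in\partial B^*$, $$\sup_{B\in\mathcal{O}}\mathbb{E}_x^{h^B}\!\left[\frac{g(X_{T_B})+\delta(X_{T_B})}{h^B(X_{T_B})}\right]=\frac{g(u^* )+\delta(u^* )}{h^{B^*}(u^* )},$$ and the supremum on the left is attained at $B=B^*$, i.e. the optimal stopping time is $T_{B^*}$.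
   Context: Setting. $(\Omega,\mathcal{F},(\mathcal{F}_t)_{t\ge0},\mathbb{P})$ is a filtered probability space. $X=(X_t)_{t\ge0}$ is a linear diffusion with state space $E=(l,r)$, $-\infty\le l<r\le\infty$, solving $dX_t=b(X_t)\,dt+\sigma(X_t)\,dW_t$, where $W$ is a one-dimensional Brownian motion and $b,\sigma$ are continuous on $E$ with $\sigma>0$. $\mathbb{P}_x$ denotes the law with $\mathbb{P}_x(X_0=x)=1$ and $\mathbb{E}_x$ its expectation. $X$ is regular: $\mathbb{P}_x(T_y<\infty)>0$ for all $x,y\in E$, where $T_y=\inf\{t>0: X_t=y\}$. The transition semigroup maps bounded continuous functions on $E$ to bounded continuous functions, so $X$ is a Feller process. $\Sigma_\infty^X$ is the set of all $(\mathcal{F}_t)$-stopping times (values in $[0,\infty]$); terms of the form $e^{-qT}f(X_T)$ are taken to be $0$ on $\{T=\infty\}$. Exit times. $\mathcal{O}$ is the set of open intervals $B=(a,b)$, $l\le a<b\le r$, containing $x$, with $B\neq E$. $\partial B$ denotes the set of endpoints of $B$ that lie in $E$ (in particular they are finite). $T_B=\inf\{t>0:X_t\notin B\}$, with $\inf\emptyset=\infty$. $h$-transform. For $B\in\mathcal{O}$ and $y\in E$ put $\phi^B(y)=\mathbb{E}_y[e^{-qT_B}]$ and $h^B(y)=\phi^B(y)/\phi^B(x)$. The probability measure $\mathbb{P}_x^{h^B}$ is defined on $\mathcal{F}_{T_B+}$ by $d\mathbb{P}_x^{h^B}=e^{-qT_B}h^B(X_{T_B})\,d\mathbb{P}_x$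 (density equal to $0$ on $\{T_B=\infty\}$), and $\mathbb{E}_x^{h^B}$ is its expectation. *)

theory Defs
  imports "HOL-Probability.Probability"
begin

text \<open>
  Filtrations are indexed by \<open>ennreal\<close>, so that stopping times with values in \<open>[0,\<infinity>]\<close> are those
  of \<^theory>\<open>HOL-Probability.Stopping_Time\<close>. The member \<open>F \<top>\<close> is any sigma-algebra
  containing all \<open>F t\<close>, \<open>t < \<top>\<close>; it does not restrict stopping times because \<open>T \<le> \<top>\<close> always holds.
  No completeness or right-continuity is assumed. Processes are indexed by \<open>real\<close>, with only
  the indices \<open>t \<ge> 0\<close> relevant.
\<close>

section \<open>Brownian motion and the stochastic integral\<close>

definition brownian_motion ::
  "'a measure \<Rightarrow> (ennreal \<Rightarrow> 'a measure) \<Rightarrow> (real \<Rightarrow> 'a \<Rightarrow> real) \<Rightarrow> bool" where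
  "brownian_motion N F W \<longleftrightarrow>
     (\<forall>t\<ge>0. W t \<in> borel_measurable (F (ennreal t))) \<and>
     (AE \<omega> in N. W 0 \<omega> = 0) \<and>
     (AE \<omega> in N. continuous_on {0..} (\<lambda>t. W t \<omega>)) \<and>
     (\<forall>s t. 0 \<le> s \<and> s < t \<longrightarrow>
        distributed N lborel (\<lambda>\<omega>. W t \<omega> - W s \<omega>)
          (\<lambda>y. ennreal (normal_density 0 (sqrt (t - s)) y)) \<and>
        prob_space.indep_set N (sets (F (ennreal s)))
          {(\<lambda>\<omega>. W t \<omega> - W s \<omega>) -` A \<inter> space N | A. A \<in> sets borel})"

text \<open>
  \<open>I\<close> is the Ito integral of \<open>H\<close> with respect to \<open>W\<close> over \<open>[0,t]\<close>, for adapted integrands \<open>H\<close> with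
  continuous paths: the limit in probability of the left-endpoint Riemann sums as the mesh of the
  partition \<open>0 = p 0 \<le> \<dots> \<le> p n = t\<close> tends to 0. This determines \<open>I\<close> up to null sets.
\<close>

definition has_ito_integral ::
  "'a measure \<Rightarrow> (real \<Rightarrow> 'a \<Rightarrow> real) \<Rightarrow> (real \<Rightarrow> 'a \<Rightarrow> real) \<Rightarrow> real \<Rightarrow> ('a \<Rightarrow> real) \<Rightarrow> bool" where
  "has_ito_integral N H W t I \<longleftrightarrow>
     I \<in> borel_measurable N \<and>
     (\<forall>\<epsilon>>0. \<exists>d>0. \<forall>(n::nat) p.
        p 0 = 0 \<and> p n = t \<and> (\<forall>i<n. p i \<le> p (Suc i) \<and> p (Suc i) - p i < d) \<longrightarrow>
        measure N {\<omega> \<in> space N.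
          \<bar>(\<Sum>i<n. H (p i) \<omega> * (W (p (Suc i)) \<omega> - W (p i) \<omega>)) - I \<omega>\<bar> > \<epsilon>} < \<epsilon>)"


section \<open>Regular linear diffusions\<close>

definition hitting_time :: "(real \<Rightarrow> 'a \<Rightarrow> real) \<Rightarrow> real \<Rightarrow> 'a \<Rightarrow> ennreal" where
  "hitting_time X y \<omega> = Inf {ennreal t | t. 0 < t \<and> X t \<omega> = y}"

definition exit_time :: "(real \<Rightarrow> 'a \<Rightarrow> real) \<Rightarrow> real set \<Rightarrow> 'a \<Rightarrow> ennreal" where
  "exit_time X B \<omega> = Inf {ennreal t | t. 0 < t \<and> X t \<omega> \<notin> B}"

definition transition ::
  "(real \<Rightarrow> 'a measure) \<Rightarrow> (real \<Rightarrow> 'a \<Rightarrow> real) \<Rightarrow> real \<Rightarrow> (real \<Rightarrow> real) \<Rightarrow> real \<Rightarrow> real" where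
  "transition P X t f y = (\<integral>\<omega>. f (X t \<omega>) \<partial>P y)"

definition state_space :: "ereal \<Rightarrow> ereal \<Rightarrow> real set" where
  "state_space l r = {y. l < ereal y \<and> ereal y < r}"

text \<open>
  \<open>M\<close> only supplies the measurable space of scenarios; \<open>P y\<close> is the law under which \<open>X\<close> starts
  at \<open>y\<close>, relevant for \<open>y\<close> in the state space only. The stochastic differential equation is
  understood in the weak sense: the driving Brownian motion may depend on the starting point.
\<close>

locale regular_linear_diffusion = filtration "space M" F
  for M :: "'a measure" and F :: "ennreal \<Rightarrow> 'a measure" +
  fixes P :: "real \<Rightarrow> 'a measure"
    and X :: "real \<Rightarrow> 'a \<Rightarrow> real"
    and l r :: ereal
    and b \<sigma> :: "real \<Rightarrow> real"
  assumes sets_F_subset: "sets (F t) \<subseteq> sets M"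
    and prob_space_P: "y \<in> state_space l r \<Longrightarrow> prob_space (P y)"
    and sets_P: "y \<in> state_space l r \<Longrightarrow> sets (P y) = sets M"
    and endpoints: "l < r"
    and adapted: "0 \<le> t \<Longrightarrow> X t \<in> borel_measurable (F (ennreal t))"
    and in_state_space: "\<omega> \<in> space M \<Longrightarrow> 0 \<le> t \<Longrightarrow> X t \<omega> \<in> state_space l r"
    and continuous_paths: "\<omega> \<in> space M \<Longrightarrow> continuous_on {0..} (\<lambda>t. X t \<omega>)"
    and start: "y \<in> state_space l r \<Longrightarrow> AE \<omega> in P y. X 0 \<omega> = y"
    and drift_continuous: "continuous_on (state_space l r) b"
    and dispersion_continuous: "continuous_on (state_space l r) \<sigma>"
    and dispersion_pos: "y \<in> state_space l r \<Longrightarrow> \<sigma> y > 0"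
    and sde: "y \<in> state_space l r \<Longrightarrow>
      \<exists>W. brownian_motion (P y) F W \<and>
        (\<forall>t\<ge>0. has_ito_integral (P y) (\<lambda>s \<omega>. \<sigma> (X s \<omega>)) W t
          (\<lambda>\<omega>. X t \<omega> - X 0 \<omega> - integral {0..t} (\<lambda>s. b (X s \<omega>))))"
    and markov: "y \<in> state_space l r \<Longrightarrow> 0 \<le> s \<Longrightarrow> 0 \<le> t \<Longrightarrow>
      f \<in> borel_measurable borel \<Longrightarrow> bounded (range f) \<Longrightarrow>
      AE \<omega> in P y. real_cond_exp (P y) (F (ennreal s)) (\<lambda>\<omega>'. f (X (s + t) \<omega>')) \<omega>
        = transition P X t f (X s \<omega>)"
    and feller: "0 \<le> t \<Longrightarrow> continuous_on (state_space l r) f \<Longrightarrow> bounded (f ` state_space l r) \<Longrightarrow>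
      continuous_on (state_space l r) (transition P X t f)"
    and regular: "y \<in> state_space l r \<Longrightarrow> z \<in> state_space l r \<Longrightarrow>
      measure (P y) {\<omega> \<in> space (P y). hitting_time X z \<omega> < \<top>} > 0"


section \<open>The stopping problem\<close>

text \<open>
  Expectation of an extended real random variable, defined whenever the positive or the negative
  part has finite expectation.
\<close>

definition ext_expectation :: "'a measure \<Rightarrow> ('a \<Rightarrow> ereal) \<Rightarrow> ereal" where
  "ext_expectation N f =
     enn2ereal (\<integral>\<^sup>+ \<omega>. e2ennreal (f \<omega>) \<partial>N) - enn2ereal (\<integral>\<^sup>+ \<omega>. e2ennreal (- f \<omega>) \<partial>N)"

text \<open>The value 0 at \<open>\<top>\<close> implements the convention that \<open>exp (-q T) f(X_T)\<close> vanishes on \<open>{T = \<infinity>}\<close>.\<close>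

definition discount :: "real \<Rightarrow> ennreal \<Rightarrow> real" where
  "discount q t = (if t = \<top> then 0 else exp (- q * enn2real t))"

text \<open>Meaningful only on \<open>{T < \<top>}\<close>; every use below is weighted by a factor vanishing on \<open>{T = \<top>}\<close>.\<close>

definition stopped :: "(real \<Rightarrow> 'a \<Rightarrow> real) \<Rightarrow> ('a \<Rightarrow> ennreal) \<Rightarrow> 'a \<Rightarrow> real" where
  "stopped X T \<omega> = X (enn2real (T \<omega>)) \<omega>"

definition running_cost ::
  "(real \<Rightarrow> 'a \<Rightarrow> real) \<Rightarrow> real \<Rightarrow> (real \<Rightarrow> real) \<Rightarrow> ennreal \<Rightarrow> 'a \<Rightarrow> ennreal" where
  "running_cost X q c t \<omega> =
     (\<integral>\<^sup>+ s. ennreal (c (X s \<omega>) * exp (- q * s)) * indicator {s. 0 \<le> s \<and> ennreal s \<le> t} s \<partial>lborel)"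

definition stopping_value ::
  "'a measure \<Rightarrow> (real \<Rightarrow> 'a \<Rightarrow> real) \<Rightarrow> real \<Rightarrow> (real \<Rightarrow> real) \<Rightarrow> (real \<Rightarrow> real) \<Rightarrow> ('a \<Rightarrow> ennreal) \<Rightarrow> ereal"
  where
  "stopping_value N X q g c T = ext_expectation N
     (\<lambda>\<omega>. ereal (discount q (T \<omega>) * g (stopped X T \<omega>)) - enn2ereal (running_cost X q c (T \<omega>) \<omega>))"

text \<open>
  \<open>T\<close> is optimal for maximising \<open>J\<close> over all stopping times. An almost sure version of \<open>T\<close> is required
  to be a stopping time: an infimum over \<open>t > 0\<close> such as \<open>exit_time X B\<close> is in general only a
  stopping time of the right-continuous enlargement of \<open>F\<close>, but under the law started inside
  the open set \<open>B\<close> it a.s. equals the infimum over \<open>t \<ge> 0\<close>.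
\<close>

definition optimal_stopping_time ::
  "'a measure \<Rightarrow> (ennreal \<Rightarrow> 'a measure) \<Rightarrow> (('a \<Rightarrow> ennreal) \<Rightarrow> ereal) \<Rightarrow> ('a \<Rightarrow> ennreal) \<Rightarrow> bool" where
  "optimal_stopping_time N F J T \<longleftrightarrow>
     (\<exists>S. stopping_time F S \<and> (AE \<omega> in N. S \<omega> = T \<omega>)) \<and>
     J T = (SUP S\<in>{S. stopping_time F S}. J S)"

definition total_cost :: "(real \<Rightarrow> 'a measure) \<Rightarrow> (real \<Rightarrow> 'a \<Rightarrow> real) \<Rightarrow> real \<Rightarrow> (real \<Rightarrow> real) \<Rightarrow> real \<Rightarrow> ennreal"
  where
  "total_cost P X q c y = (\<integral>\<^sup>+ \<omega>. running_cost X q c \<top> \<omega> \<partial>P y)"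

definition delta :: "(real \<Rightarrow> 'a measure) \<Rightarrow> (real \<Rightarrow> 'a \<Rightarrow> real) \<Rightarrow> real \<Rightarrow> (real \<Rightarrow> real) \<Rightarrow> real \<Rightarrow> real"
  where
  "delta P X q c y = enn2real (total_cost P X q c y)"


section \<open>Exit intervals and the h-transform\<close>

definition intervals :: "ereal \<Rightarrow> ereal \<Rightarrow> real \<Rightarrow> real set set" where
  "intervals l r x = {B. \<exists>\<alpha> \<beta>. l \<le> \<alpha> \<and> \<alpha> < \<beta> \<and> \<beta> \<le> r \<and> B = state_space \<alpha> \<beta>
     \<and> x \<in> B \<and> B \<noteq> state_space l r}"

definition bdry :: "ereal \<Rightarrow> ereal \<Rightarrow> real set \<Rightarrow> real set" where
  "bdry l r B = frontier B \<inter> state_space l r"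

definition phi :: "(real \<Rightarrow> 'a measure) \<Rightarrow> (real \<Rightarrow> 'a \<Rightarrow> real) \<Rightarrow> real \<Rightarrow> real set \<Rightarrow> real \<Rightarrow> real" where
  "phi P X q B y = (\<integral>\<omega>. discount q (exit_time X B \<omega>) \<partial>P y)"

definition h_fun ::
  "(real \<Rightarrow> 'a measure) \<Rightarrow> (real \<Rightarrow> 'a \<Rightarrow> real) \<Rightarrow> real \<Rightarrow> real \<Rightarrow> real set \<Rightarrow> real \<Rightarrow> real" where
  "h_fun P X q x B y = phi P X q B y / phi P X q B x"

text \<open>The sigma-algebra \<open>F_{T+}\<close> of a time \<open>T\<close> with \<open>{T < t} \<in> F t\<close> for all \<open>t\<close>.\<close>

definition pre_sigma_plus :: "'a measure \<Rightarrow> (ennreal \<Rightarrow> 'a measure) \<Rightarrow> ('a \<Rightarrow> ennreal) \<Rightarrow> 'a measure" where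
  "pre_sigma_plus M F T =
     sigma (space M) {A \<in> sets M. \<forall>t<\<top>. A \<inter> {\<omega> \<in> space M. T \<omega> < t} \<in> sets (F t)}"

definition h_transform ::
  "(real \<Rightarrow> 'a measure) \<Rightarrow> (ennreal \<Rightarrow> 'a measure) \<Rightarrow> (real \<Rightarrow> 'a \<Rightarrow> real) \<Rightarrow> real \<Rightarrow> real \<Rightarrow> real set \<Rightarrow> 'a measure"
  where
  "h_transform P F X q x B =
     density (restr_to_subalg (P x) (pre_sigma_plus (P x) F (exit_time X B)))
       (\<lambda>\<omega>. ennreal (discount q (exit_time X B \<omega>) * h_fun P X q x B (stopped X (exit_time X B) \<omega>)))"

definition ratio ::
  "(real \<Rightarrow> 'a measure) \<Rightarrow> (real \<Rightarrow> 'a \<Rightarrow> real) \<Rightarrow> real \<Rightarrow> (real \<Rightarrow> real) \<Rightarrow> (real \<Rightarrow> real) \<Rightarrow> real \<Rightarrow> real set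
    \<Rightarrow> real \<Rightarrow> real" where
  "ratio P X q g c x B u = (g u + delta P X q c u) / h_fun P X q x B u"

definition h_value ::
  "(real \<Rightarrow> 'a measure) \<Rightarrow> (ennreal \<Rightarrow> 'a measure) \<Rightarrow> (real \<Rightarrow> 'a \<Rightarrow> real) \<Rightarrow> real \<Rightarrow> (real \<Rightarrow> real)
    \<Rightarrow> (real \<Rightarrow> real) \<Rightarrow> real \<Rightarrow> real set \<Rightarrow> ereal" where
  "h_value P F X q g c x B = ext_expectation (h_transform P F X q x B)
     (\<lambda>\<omega>. ereal (ratio P X q g c x B (stopped X (exit_time X B) \<omega>)))"

end

theory Submission
  imports Defs
begin

text \<open>
  Everything is expressed through the \<open>q\<close>-potentials \<open>U f y = E_y (\<integral> exp (-q t) f (X_t) dt)\<close>, so that no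
  shift operators and no strong Markov property for path functionals are needed: the simple Markov
  property and the Feller property give \<open>U f y = E_y (\<integral>_0^T exp (-q t) f (X_t) dt) + E_y (exp (-q T) U f (X_T))\<close>
  for every optional time \<open>T\<close>. With \<open>f = c\<close> this removes the running cost and turns the problem into
  maximising \<open>E_x (exp (-q T) G (X_T))\<close>, \<open>G = g + \<delta>\<close>; with \<open>f\<close> supported to the right (left) of a point it
  provides an increasing (decreasing) positive function \<open>\<psi>\<close> (\<open>\<phi>\<close>) that is \<open>q\<close>-harmonic on the other side
  of that point and \<open>q\<close>-excessive everywhere.

  Let \<open>\<psi> x = \<phi> x = 1\<close> and let \<open>V\<close> be the supremum of the values of exit times of intervals. The exit
  times of \<open>(y1, y2)\<close>, \<open>(l, y2)\<close> and \<open>(y1, r)\<close> yield exactly the inequalities which say that the constraints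
  \<open>G \<le> a \<psi> + (V - a) \<phi>\<close> at \<open>y1 < x\<close> and at \<open>y2 > x\<close> are compatible with each other and with \<open>0 \<le> a \<le> V\<close>.
  Hence one \<open>a\<close> satisfies all of them, and the excessive majorant \<open>a \<psi> + (V - a) \<phi>\<close> of \<open>G\<close> has value \<open>V\<close>
  at \<open>x\<close>, which bounds the value of every stopping time.

  Points outside an exit interval are regular for its complement, so \<open>h^B\<close> is constant on the boundary
  and the ratios there are multiples of \<open>G\<close>.
\<close>

section \<open>Preliminaries\<close>

text \<open>The constraint at y reads a (\<psi> y - \<phi> y) \<ge> G y - V \<phi> y. The difference
  \<psi> - \<phi> is positive to the right of x and negative to the left, so points on the right
  bound a from below and points on the left bound it from above. Closed half lines and [0, V] have a
  common point once they meet pairwise, which is why intervals with one or two endpoints in E are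
  enough. At y = x the unknown a drops out and G x \<le> V remains; exit times from intervals around
  x are a.s. positive, so this constraint needs a limit y \<longrightarrow> x. Two obstacles shape
  the rest. The filtration is raw, so exit times are only optional, and time is discretised by grid
  points strictly larger than T. An unbounded cost need not have a continuous potential, so it is
  truncated, and \<delta> enters only as a supremum of continuous functions. For a similar reason
  \<psi> and \<phi> are put together from potentials of bounded ramps that start further and further
  out.\<close>

lemma borel_measurable_continuous_fst:
  fixes Y :: "real \<Rightarrow> 'b \<Rightarrow> real"
  assumes meas: "\<And>t. 0 \<le> t \<Longrightarrow> Y t \<in> borel_measurable N"
    and cont: "\<And>\<omega>. \<omega> \<in> space N \<Longrightarrow> continuous_on {0..} (\<lambda>t. Y t \<omega>)"
  shows "(\<lambda>p. Y (max 0 (fst p)) (snd p)) \<in> borel_measurable (borel \<Otimes>\<^sub>M N)"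
proof (rule borel_measurable_LIMSEQ_real)
  \<comment> \<open>Time rounded down to the mesh 1/(n+1) takes countably many values, so the
    rounded process is jointly measurable; continuity of the paths gives the limit.\<close>
  let ?a = "\<lambda>(n::nat) t::real. of_int \<lfloor>real (Suc n) * t\<rfloor> / real (Suc n)"
  show "(\<lambda>p. Y (max 0 (?a n (fst p))) (snd p)) \<in> borel_measurable (borel \<Otimes>\<^sub>M N)" for n
  proof -
    have "(\<lambda>p. Y (max 0 (real_of_int k / real (Suc n))) (snd p)) \<in> borel_measurable (borel \<Otimes>\<^sub>M N)" for k :: int
      using measurable_compose[OF measurable_snd meas[of "max 0 (real_of_int k / real (Suc n))"]] by simp
    moreover have "(\<lambda>p. \<lfloor>real (Suc n) * fst p\<rfloor>) \<in> measurable (borel \<Otimes>\<^sub>M N) (count_space UNIV)"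
      by measurable
    ultimately show ?thesis
      by (rule measurable_compose_countable)
  qed
  fix p :: "real \<times> 'b" assume "p \<in> space (borel \<Otimes>\<^sub>M N)"
  then have \<omega>: "snd p \<in> space N" by (auto simp: space_pair_measure)
  have "(\<lambda>n. ?a n (fst p)) \<longlonglongrightarrow> fst p"
  proof (rule tendsto_sandwich)
    have "fst p - 1 / real (Suc n) \<le> ?a n (fst p)" for n
    proof -
      have "real (Suc n) * fst p - 1 \<le> of_int \<lfloor>real (Suc n) * fst p\<rfloor>" by linarith
      then have "(real (Suc n) * fst p - 1) / real (Suc n) \<le> ?a n (fst p)"
        by (intro divide_right_mono) auto
      moreover have "(real (Suc n) * fst p - 1) / real (Suc n) = fst p - 1 / real (Suc n)"
        by (simp add: diff_divide_distrib)
      ultimately show ?thesis by simp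
    qed
    then show "\<forall>\<^sub>F n in sequentially. fst p - 1 / real (Suc n) \<le> ?a n (fst p)" by simp
    have "?a n (fst p) \<le> fst p" for n
    proof -
      have "of_int \<lfloor>real (Suc n) * fst p\<rfloor> / real (Suc n) \<le> (real (Suc n) * fst p) / real (Suc n)"
        by (intro divide_right_mono) auto
      then show ?thesis by simp
    qed
    then show "\<forall>\<^sub>F n in sequentially. ?a n (fst p) \<le> fst p" by simp
    have "(\<lambda>n. fst p - 1 / real (Suc n)) \<longlonglongrightarrow> fst p - 0"
      using LIMSEQ_inverse_real_of_nat by (intro tendsto_intros) (simp add: inverse_eq_divide)
    then show "(\<lambda>n. fst p - 1 / real (Suc n)) \<longlonglongrightarrow> fst p" by simp
  qed simp
  then have "(\<lambda>n. max 0 (?a n (fst p))) \<longlonglongrightarrow> max 0 (fst p)"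
    by (intro tendsto_intros)
  then show "(\<lambda>n. Y (max 0 (?a n (fst p))) (snd p)) \<longlonglongrightarrow> Y (max 0 (fst p)) (snd p)"
    using cont[OF \<omega>] by (intro continuous_on_tendsto_compose[where f="\<lambda>t. Y t (snd p)" and s="{0..}"]) auto
qed

lemma state_space_eq: "state_space l r = ereal -` {l<..<r}"
  by (auto simp: state_space_def)

lemma open_state_space: "open (state_space l r)"
  unfolding state_space_eq by (intro open_vimage continuous_intros)

lemma borel_state_space[measurable]: "state_space l r \<in> sets borel"
  using open_state_space by auto

lemma frontier_state_space_subset:
  "frontier (state_space \<alpha> \<beta>) \<subseteq> {z. ereal z = \<alpha> \<or> ereal z = \<beta>}"
proof
  fix z assume z: "z \<in> frontier (state_space \<alpha> \<beta>)"
  have "closed (ereal -` {\<alpha>..\<beta>})"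
    by (intro closed_vimage continuous_intros)
  then have "closure (state_space \<alpha> \<beta>) \<subseteq> ereal -` {\<alpha>..\<beta>}"
    by (intro closure_minimal) (auto simp: state_space_def)
  then have "\<alpha> \<le> ereal z" "ereal z \<le> \<beta>"
    using z by (auto simp: frontier_def)
  moreover have "z \<notin> state_space \<alpha> \<beta>"
    using z by (simp add: frontier_def interior_open open_state_space)
  ultimately show "z \<in> {z. ereal z = \<alpha> \<or> ereal z = \<beta>}"
    by (auto simp: state_space_def)
qed

lemma borel_measurable_on_open:
  fixes f :: "real \<Rightarrow> real"
  assumes "continuous_on E f" "open E"
  shows "(\<lambda>y. if y \<in> E then f y else 0) \<in> borel_measurable borel"
  using assms by (intro borel_measurable_continuous_on_if) auto

lemma discount_nonneg[simp]: "0 \<le> discount q t"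
  by (simp add: discount_def)

lemma discount_le_1: "0 \<le> q \<Longrightarrow> discount q t \<le> 1"
  by (simp add: discount_def)

lemma discount_top[simp]: "discount q \<top> = 0"
  by (simp add: discount_def)

lemma discount_pos_iff[simp]: "0 < discount q t \<longleftrightarrow> t \<noteq> \<top>"
  by (simp add: discount_def)

lemma measurable_discount[measurable]: "discount q \<in> borel_measurable borel"
  unfolding discount_def by measurable

lemma discount_antimono: "0 \<le> q \<Longrightarrow> s \<le> t \<Longrightarrow> discount q t \<le> discount q s"
  by (cases s; cases t) (auto simp: discount_def top_unique mult_left_mono)

text \<open>The rounding goes strictly upwards, even when t lies on the grid: an optional time is
  known to have occurred only strictly after its value.\<close>

lemma grid_tendsto:
  fixes t :: real
  shows "(\<lambda>n. (of_int \<lfloor>real (Suc n) * t\<rfloor> + 1) / real (Suc n)) \<longlonglongrightarrow> t"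
proof (rule tendsto_sandwich)
  have "t \<le> (of_int \<lfloor>real (Suc n) * t\<rfloor> + 1) / real (Suc n)" for n
  proof -
    have "real (Suc n) * t \<le> of_int \<lfloor>real (Suc n) * t\<rfloor> + 1" by linarith
    then show ?thesis by (subst pos_le_divide_eq) (simp_all only: of_nat_0_less_iff zero_less_Suc mult.commute)
  qed
  then show "\<forall>\<^sub>F n in sequentially. t \<le> (of_int \<lfloor>real (Suc n) * t\<rfloor> + 1) / real (Suc n)" by simp
  have "(of_int \<lfloor>real (Suc n) * t\<rfloor> + 1) / real (Suc n) \<le> t + 1 / real (Suc n)" for n
  proof -
    have "(of_int \<lfloor>real (Suc n) * t\<rfloor> + 1) / real (Suc n) \<le> (real (Suc n) * t + 1) / real (Suc n)"
      by (intro divide_right_mono) auto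
    then show ?thesis by (simp add: add_divide_distrib)
  qed
  then show "\<forall>\<^sub>F n in sequentially. (of_int \<lfloor>real (Suc n) * t\<rfloor> + 1) / real (Suc n) \<le> t + 1 / real (Suc n)" by simp
  have "(\<lambda>n. t + 1 / real (Suc n)) \<longlonglongrightarrow> t + 0"
    using LIMSEQ_inverse_real_of_nat by (intro tendsto_intros) (simp add: inverse_eq_divide)
  then show "(\<lambda>n. t + 1 / real (Suc n)) \<longlonglongrightarrow> t" by simp
qed simp

lemma Inf_ennreal_image:
  assumes "K \<noteq> {}" "K \<subseteq> {0..}"
  shows "Inf (ennreal ` K) = ennreal (Inf K)"
proof (rule continuous_at_Inf_mono[symmetric])
  show "mono ennreal" by (auto intro!: monoI ennreal_leI)
  show "continuous (at_right (Inf K)) ennreal"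
    unfolding continuous_within by (intro tendsto_ennrealI tendsto_ident_at)
  show "bdd_below K" using assms by (intro bdd_belowI[of _ 0]) auto
qed fact

section \<open>Optional times and exit times\<close>

context regular_linear_diffusion
begin

abbreviation E where "E \<equiv> state_space l r"

lemma space_P: "y \<in> E \<Longrightarrow> space (P y) = space M"
  using sets_P sets_eq_imp_space_eq by blast

lemma measurable_P: "y \<in> E \<Longrightarrow> measurable (P y) N = measurable M N"
  using sets_P by (intro measurable_cong_sets) auto

lemma X_measurable: "0 \<le> t \<Longrightarrow> X t \<in> borel_measurable M"
  using adapted[of t] sets_F_subset[of t] space_F[of "ennreal t"]
  by (auto simp: measurable_def)

lemma X_measurable_F: "0 \<le> s \<Longrightarrow> ennreal s \<le> t \<Longrightarrow> X s \<in> borel_measurable (F t)"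
  using adapted[of s] sets_F_mono[of "ennreal s" t] space_F
  by (auto simp: measurable_def)

lemma X_jointly_measurable:
  "(\<lambda>p. X (max 0 (fst p)) (snd p)) \<in> borel_measurable (borel \<Otimes>\<^sub>M M)"
  by (rule borel_measurable_continuous_fst[OF X_measurable continuous_paths])

text \<open>The strict inequality is what an infimum over t > 0 satisfies in a filtration that need
  not be right-continuous. It suffices for approximation from the right.\<close>

definition optional_time :: "('a \<Rightarrow> ennreal) \<Rightarrow> bool" where
  "optional_time T \<longleftrightarrow> (\<forall>t<\<top>. {\<omega> \<in> space M. T \<omega> < t} \<in> sets (F t))"

lemma stopping_time_imp_optional: "stopping_time F T \<Longrightarrow> optional_time T"
  using stopping_time_less_const[of T] by (auto simp: optional_time_def pred_def space_F)

lemma measurable_if_less: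
  fixes T :: "'a \<Rightarrow> ennreal"
  assumes "\<And>t. t < \<top> \<Longrightarrow> {\<omega> \<in> space N. T \<omega> < t} \<in> sets N"
  shows "T \<in> borel_measurable N"
proof (rule borel_measurableI_less)
  fix y :: ennreal
  show "{x \<in> space N. T x < y} \<in> sets N"
  proof (cases "y = \<top>")
    case True
    have "T x < \<top> \<longleftrightarrow> (\<exists>n. T x < of_nat n)" for x
      using ennreal_Ex_less_of_nat[of "T x"] by (auto intro: less_trans simp: of_nat_less_top)
    then have "{x \<in> space N. T x < y} = (\<Union>n. {x \<in> space N. T x < of_nat n})"
      using True by auto
    then show ?thesis using assms[OF of_nat_less_top] by auto
  qed (use assms[of y] in \<open>auto simp: less_top\<close>)
qed

text \<open>In the locale the index of \<open>sets_F_subset\<close> is a real number: nothing is known about \<open>F \<top>\<close>, which is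
  why optional times are only tested at \<open>t < \<top>\<close>.\<close>

lemma sets_F_finite: "t < \<top> \<Longrightarrow> sets (F t) \<subseteq> sets M"
  using sets_F_subset[of "enn2real t"] by simp

lemma optional_measurable: "optional_time T \<Longrightarrow> T \<in> borel_measurable M"
  by (intro measurable_if_less) (use sets_F_finite in \<open>auto simp: optional_time_def\<close>)

lemma stopped_measurable:
  assumes "optional_time T"
  shows "stopped X T \<in> borel_measurable M"
proof -
  have "(\<lambda>\<omega>. (enn2real (T \<omega>), \<omega>)) \<in> measurable M (borel \<Otimes>\<^sub>M M)"
    using optional_measurable[OF assms] by measurable
  from measurable_compose[OF this X_jointly_measurable] show ?thesis
    by (simp add: stopped_def[abs_def] max_def)
qed

lemma stopped_in_E: "\<omega> \<in> space M \<Longrightarrow> stopped X T \<omega> \<in> E"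
  by (simp add: stopped_def in_state_space)

lemma optional_less_F:
  assumes "optional_time T" "s < \<top>" "s \<le> t"
  shows "{\<omega> \<in> space M. T \<omega> < s} \<in> sets (F t)"
  using assms sets_F_mono[of s t] by (auto simp: optional_time_def)

lemma optional_min_measurable:
  assumes "optional_time T" "t < \<top>"
  shows "(\<lambda>\<omega>. min (T \<omega>) t) \<in> borel_measurable (F t)"
proof (rule measurable_if_less)
  fix s :: ennreal assume s: "s < \<top>"
  show "{\<omega> \<in> space (F t). min (T \<omega>) t < s} \<in> sets (F t)"
  proof (cases "t < s")
    case True
    then have "{\<omega> \<in> space (F t). min (T \<omega>) t < s} = space (F t)" by (auto simp: min_less_iff_disj)
    then show ?thesis by simp
  next
    case False
    then have "{\<omega> \<in> space (F t). min (T \<omega>) t < s} = {\<omega> \<in> space M. T \<omega> < s}"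
      by (auto simp: min_less_iff_disj space_F)
    then show ?thesis using False optional_less_F[OF assms(1) s, of t] by auto
  qed
qed

text \<open>Freezing the path at t makes all its values \<open>F t\<close>-measurable, so joint
  measurability holds over \<open>F t\<close>. On {T < t} the variable is the position at T, which
  later yields measurability with respect to the sigma-algebra of T+.\<close>

lemma stopped_min_measurable:
  assumes "optional_time T" "t < \<top>"
  shows "(\<lambda>\<omega>. X (enn2real (min (T \<omega>) t)) \<omega>) \<in> borel_measurable (F t)"
proof -
  have *: "(\<lambda>p. X (min (max 0 (fst p)) (enn2real t)) (snd p)) \<in> borel_measurable (borel \<Otimes>\<^sub>M F t)"
  proof (rule borel_measurable_continuous_fst)
    show "X (min s (enn2real t)) \<in> borel_measurable (F t)" if "0 \<le> s" for s
    proof (rule X_measurable_F)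
      have "ennreal (min s (enn2real t)) \<le> ennreal (enn2real t)" by (intro ennreal_leI) simp
      also have "\<dots> = t" using assms by simp
      finally show "ennreal (min s (enn2real t)) \<le> t" .
    qed (use that in simp)
    show "continuous_on {0..} (\<lambda>s. X (min s (enn2real t)) \<omega>)" if "\<omega> \<in> space (F t)" for \<omega>
      using that by (intro continuous_on_compose2[OF continuous_paths] continuous_intros) (auto simp: space_F)
  qed
  have "(\<lambda>\<omega>. (enn2real (min (T \<omega>) t), \<omega>)) \<in> measurable (F t) (borel \<Otimes>\<^sub>M F t)"
    using optional_min_measurable[OF assms] by measurable
  from measurable_compose[OF this *] have
    "(\<lambda>\<omega>. X (min (enn2real (min (T \<omega>) t)) (enn2real t)) \<omega>) \<in> borel_measurable (F t)" by simp
  moreover have "min (enn2real (min (T \<omega>) t)) (enn2real t) = enn2real (min (T \<omega>) t)" for \<omega>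
    using assms(2) by (intro min_absorb1 enn2real_mono) auto
  ultimately show ?thesis by simp
qed

section \<open>Position at the exit time, and measurability of exit times\<close>

lemma exit_time_eq:
  "exit_time X B \<omega> = (if {t. 0 < t \<and> X t \<omega> \<notin> B} = {} then \<top> else ennreal (Inf {t. 0 < t \<and> X t \<omega> \<notin> B}))"
proof -
  have "exit_time X B \<omega> = Inf (ennreal ` {t. 0 < t \<and> X t \<omega> \<notin> B})"
    unfolding exit_time_def by (rule arg_cong[of _ _ Inf]) auto
  then show ?thesis by (auto simp: Inf_ennreal_image[of "{t. 0 < t \<and> X t \<omega> \<notin> B}"] subset_eq less_imp_le)
qed

lemma closed_outside:
  assumes "\<omega> \<in> space M" "open B"
  shows "closed {t. 0 \<le> t \<and> X t \<omega> \<notin> B}"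
proof -
  have "closed ({0..} \<inter> (\<lambda>t. X t \<omega>) -` (- B))"
    using assms by (intro continuous_closed_preimage continuous_paths) auto
  moreover have "{0..} \<inter> (\<lambda>t. X t \<omega>) -` (- B) = {t. 0 \<le> t \<and> X t \<omega> \<notin> B}" by auto
  ultimately show ?thesis by simp
qed

lemma stopped_exit_outside:
  assumes \<omega>: "\<omega> \<in> space M" "open B" and fin: "exit_time X B \<omega> \<noteq> \<top>"
  shows "stopped X (exit_time X B) \<omega> \<notin> B"
proof -
  let ?K = "{t. 0 < t \<and> X t \<omega> \<notin> B}"
  have ne: "?K \<noteq> {}" using fin by (auto simp: exit_time_eq split: if_splits)
  have bdd: "bdd_below ?K" by (intro bdd_belowI[of _ 0]) auto
  have "Inf ?K \<in> closure ?K" by (rule closure_contains_Inf[OF ne bdd])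
  also have "\<dots> \<subseteq> {t. 0 \<le> t \<and> X t \<omega> \<notin> B}"
    by (intro closure_minimal closed_outside[OF \<omega>]) auto
  finally show ?thesis using ne by (auto simp: stopped_def exit_time_eq)
qed

lemma inside_before_exit:
  assumes "0 < t" "ennreal t < exit_time X B \<omega>"
  shows "X t \<omega> \<in> B"
proof (rule ccontr)
  assume "X t \<omega> \<notin> B"
  then have "exit_time X B \<omega> \<le> ennreal t"
    unfolding exit_time_def using assms(1) by (intro Inf_lower) auto
  with assms(2) show False by simp
qed

text \<open>The position is outside B because the complement is closed, and in the closure of B as a
  left limit of points of B. The start in B makes the time positive, so that there is a left
  limit.\<close>

lemma stopped_exit_frontier:
  assumes \<omega>: "\<omega> \<in> space M" "open B" "X 0 \<omega> \<in> B" and fin: "exit_time X B \<omega> \<noteq> \<top>"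
  shows "stopped X (exit_time X B) \<omega> \<in> frontier B"
proof -
  obtain T where T: "0 \<le> T" "exit_time X B \<omega> = ennreal T"
    using fin by (cases "exit_time X B \<omega>") auto
  have out: "X T \<omega> \<notin> B" using stopped_exit_outside[OF \<omega>(1,2) fin] T by (simp add: stopped_def)
  then have "0 < T" using \<omega>(3) T(1) by (metis less_eq_real_def)
  have "X T \<omega> \<in> closure B"
  proof (rule Lim_in_closed_set[OF closed_closure])
    show "((\<lambda>t. X t \<omega>) \<longlongrightarrow> X T \<omega>) (at_left T)"
    proof -
      have "((\<lambda>t. X t \<omega>) \<longlongrightarrow> X T \<omega>) (at T within {0..})"
        using continuous_paths[OF \<omega>(1)] T(1) by (simp add: continuous_on_def)
      moreover have "at T within {0..} = at T"
        using \<open>0 < T\<close> by (intro at_within_interior) (simp add: interior_real_atLeast)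
      ultimately show ?thesis by (simp add: filterlim_at_split)
    qed
    have "X t \<omega> \<in> closure B" if "0 < t" "t < T" for t
    proof -
      have "ennreal t < exit_time X B \<omega>" using that T by (simp add: ennreal_less_iff)
      from inside_before_exit[OF that(1) this] show ?thesis using closure_subset by blast
    qed
    then show "\<forall>\<^sub>F t in at_left T. X t \<omega> \<in> closure B"
      using eventually_at_left_real[OF \<open>0 < T\<close>] by (auto elim: eventually_mono)
  qed simp
  then show ?thesis using out T \<omega>(2) by (simp add: frontier_def interior_open stopped_def)
qed

text \<open>A continuous path meets the closed complement during the compact time interval iff its
  distance to the complement becomes arbitrarily small on a countable dense set of times: density
  gives one direction, the attained minimum the other.\<close>

lemma exit_before_event:
  assumes B: "open B" "- B \<noteq> {}" and a: "0 \<le> a"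
  shows "{\<omega> \<in> space M. \<exists>s\<in>{a..t}. X s \<omega> \<notin> B} \<in> sets (F (ennreal t))"
proof (cases "a \<le> t")
  case True
  \<comment> \<open>The point \<open>a\<close> is added because the interval may reduce to a single
    irrational time.\<close>
  let ?D = "insert a (\<rat> \<inter> {a..t})"
  let ?k = "\<lambda>y. infdist y (- B)"
  have out_iff: "y \<notin> B \<longleftrightarrow> ?k y = 0" for y
    using in_closed_iff_infdist_zero[of "- B" y] B by auto
  have "(\<exists>s\<in>{a..t}. X s \<omega> \<notin> B) \<longleftrightarrow> (\<forall>n. \<exists>s\<in>?D. ?k (X s \<omega>) < 1 / real (Suc n))" if \<omega>: "\<omega> \<in> space M" for \<omega>
  proof
    assume "\<exists>s\<in>{a..t}. X s \<omega> \<notin> B"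
    then obtain s where s: "a \<le> s" "s \<le> t" "?k (X s \<omega>) = 0" by (auto simp: out_iff)
    show "\<forall>n. \<exists>s\<in>?D. ?k (X s \<omega>) < 1 / real (Suc n)"
    proof (cases "a = t")
      case True
      with s show ?thesis by (auto intro!: bexI[of _ a])
    next
      case False
      have "s \<in> closure (\<rat> \<inter> {a<..<t})"
      proof -
        have "closure ({a<..<t} \<inter> \<rat>) = closure {a<..<t}"
          by (rule closure_open_Int_superset) (auto simp: Rats_closure_real)
        then show ?thesis using s False True by (simp add: Int_commute closure_greaterThanLessThan)
      qed
      then obtain u where u: "\<And>n. u n \<in> \<rat> \<inter> {a<..<t}" "u \<longlonglongrightarrow> s"
        by (auto simp: closure_sequential)
      have "(\<lambda>n. X (u n) \<omega>) \<longlonglongrightarrow> X s \<omega>"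
        using u a s by (intro continuous_on_tendsto_compose[OF continuous_paths[OF \<omega>] u(2)])
          (auto intro!: eventuallyI intro: order_trans less_imp_le)
      then have "(\<lambda>n. ?k (X (u n) \<omega>)) \<longlonglongrightarrow> 0"
        using tendsto_infdist[of "\<lambda>n. X (u n) \<omega>" "X s \<omega>" sequentially "- B"] s(3) by simp
      then have "\<forall>\<^sub>F m in sequentially. ?k (X (u m) \<omega>) < 1 / real (Suc n)" for n
        by (rule order_tendstoD(2)) simp
      then have "\<exists>m. ?k (X (u m) \<omega>) < 1 / real (Suc n)" for n
        using eventually_happens by fastforce
      with u(1) show ?thesis by (meson IntD1 IntD2 IntI greaterThanLessThan_iff atLeastAtMost_iff insertI2 less_imp_le)
    qed
  next
    assume *: "\<forall>n. \<exists>s\<in>?D. ?k (X s \<omega>) < 1 / real (Suc n)"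
    have "continuous_on {a..t} (\<lambda>s. ?k (X s \<omega>))"
      using a by (intro continuous_on_infdist continuous_on_subset[OF continuous_paths[OF \<omega>]]) auto
    then obtain m where m: "m \<in> {a..t}" "\<And>s. s \<in> {a..t} \<Longrightarrow> ?k (X m \<omega>) \<le> ?k (X s \<omega>)"
      using continuous_attains_inf[of "{a..t}" "\<lambda>s. ?k (X s \<omega>)"] True by auto
    have "?k (X m \<omega>) = 0"
    proof (rule ccontr)
      assume "?k (X m \<omega>) \<noteq> 0"
      then have "0 < ?k (X m \<omega>)" using infdist_nonneg[of "X m \<omega>" "- B"] by linarith
      then obtain n where "inverse (real (Suc n)) < ?k (X m \<omega>)" using reals_Archimedean by blast
      moreover obtain s where "s \<in> ?D" "?k (X s \<omega>) < 1 / real (Suc n)" using * by blast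
      moreover have "s \<in> {a..t}" using \<open>s \<in> ?D\<close> True by auto
      ultimately show False using m(2)[of s] by (simp add: inverse_eq_divide)
    qed
    then show "\<exists>s\<in>{a..t}. X s \<omega> \<notin> B" using m(1) out_iff by blast
  qed
  then have "{\<omega> \<in> space M. \<exists>s\<in>{a..t}. X s \<omega> \<notin> B} = {\<omega> \<in> space M. \<forall>n. \<exists>s\<in>?D. ?k (X s \<omega>) < 1 / real (Suc n)}"
    by (intro Collect_cong conj_cong refl)
  also have "\<dots> = (\<Inter>n. \<Union>s\<in>?D. {\<omega> \<in> space (F (ennreal t)). ?k (X s \<omega>) < 1 / real (Suc n)})"
    unfolding space_F by blast
  finally have eq: "{\<omega> \<in> space M. \<exists>s\<in>{a..t}. X s \<omega> \<notin> B} =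
      (\<Inter>n. \<Union>s\<in>?D. {\<omega> \<in> space (F (ennreal t)). ?k (X s \<omega>) < 1 / real (Suc n)})" .
  have "{\<omega> \<in> space (F (ennreal t)). ?k (X s \<omega>) < 1 / real (Suc n)} \<in> sets (F (ennreal t))" if "s \<in> ?D" for s n
  proof -
    have "0 \<le> s" "s \<le> t" using that a True by auto
    then have [measurable]: "X s \<in> borel_measurable (F (ennreal t))"
      by (intro X_measurable_F ennreal_leI)
    have [measurable]: "?k \<in> borel_measurable borel"
      by (intro borel_measurable_continuous_onI continuous_intros)
    show ?thesis by measurable
  qed
  moreover have "countable ?D" by (intro countable_insert countable_Int1 countable_rat)
  ultimately have "(\<Union>s\<in>?D. {\<omega> \<in> space (F (ennreal t)). ?k (X s \<omega>) < 1 / real (Suc n)}) \<in> sets (F (ennreal t))" for n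
    by (intro sets.countable_UN' image_subsetI)
  then show ?thesis unfolding eq by (intro sets.countable_INT image_subsetI UNIV_not_empty)
qed simp

lemma optional_exit_time:
  assumes B: "open B" "- B \<noteq> {}"
  shows "optional_time (exit_time X B)"
  unfolding optional_time_def
proof (intro allI impI)
  fix t :: ennreal assume "t < \<top>"
  then obtain u where u: "0 \<le> u" "t = ennreal u" by (cases t) auto
  \<comment> \<open>The infimum is below t iff the path is outside B at some time of the open
    interval (0, u), which is exhausted by compact intervals.\<close>
  have iff: "exit_time X B \<omega> < t \<longleftrightarrow> (\<exists>n. \<exists>s\<in>{1 / real (Suc n)..u - 1 / real (Suc n)}. X s \<omega> \<notin> B)" for \<omega>
  proof -
    have "exit_time X B \<omega> < t \<longleftrightarrow> (\<exists>s. 0 < s \<and> s < u \<and> X s \<omega> \<notin> B)"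
      unfolding exit_time_def Inf_less_iff u using u(1) by (auto simp: ennreal_less_iff)
    also have "\<dots> \<longleftrightarrow> (\<exists>n. \<exists>s\<in>{1 / real (Suc n)..u - 1 / real (Suc n)}. X s \<omega> \<notin> B)"
    proof safe
      fix s assume s: "0 < s" "s < u" "X s \<omega> \<notin> B"
      then have "0 < min s (u - s)" by simp
      then obtain n where "inverse (real (Suc n)) < min s (u - s)" using reals_Archimedean by blast
      then show "\<exists>n. \<exists>s\<in>{1 / real (Suc n)..u - 1 / real (Suc n)}. X s \<omega> \<notin> B"
        using s by (intro exI[of _ n] bexI[of _ s]) (auto simp: inverse_eq_divide)
    next
      fix n s assume s: "s \<in> {1 / real (Suc n)..u - 1 / real (Suc n)}" "X s \<omega> \<notin> B"
      have "0 < 1 / real (Suc n)" by simp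
      with s(1) have "0 < s" "s < u" by (simp_all only: atLeastAtMost_iff) linarith+
      with s(2) show "\<exists>s>0. s < u \<and> X s \<omega> \<notin> B" by blast
    qed
    finally show ?thesis .
  qed
  have "{\<omega> \<in> space M. \<exists>s\<in>{1 / real (Suc n)..u - 1 / real (Suc n)}. X s \<omega> \<notin> B} \<in> sets (F t)" for n
    using exit_before_event[OF B, of "1 / real (Suc n)" "u - 1 / real (Suc n)"] u
      sets_F_mono[of "ennreal (u - 1 / real (Suc n))" t]
    by (auto intro!: ennreal_leI)
  moreover have "{\<omega> \<in> space M. exit_time X B \<omega> < t} =
      (\<Union>n. {\<omega> \<in> space M. \<exists>s\<in>{1 / real (Suc n)..u - 1 / real (Suc n)}. X s \<omega> \<notin> B})"
    unfolding iff by auto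
  ultimately show "{\<omega> \<in> space M. exit_time X B \<omega> < t} \<in> sets (F t)" by auto
qed

text \<open>Including \<open>t = 0\<close> makes this a stopping time of the raw filtration; it agrees with the exit time on
  paths started in \<open>B\<close>.\<close>

definition entrance_time :: "real set \<Rightarrow> 'a \<Rightarrow> ennreal" where
  "entrance_time B \<omega> = Inf (ennreal ` {t. 0 \<le> t \<and> X t \<omega> \<notin> B})"

lemma entrance_time_eq_exit_time: "X 0 \<omega> \<in> B \<Longrightarrow> entrance_time B \<omega> = exit_time X B \<omega>"
  unfolding entrance_time_def exit_time_def
  by (rule arg_cong[of _ _ Inf]) (auto simp: image_def le_less)

text \<open>With t = 0 included the set of times outside B is closed, so its infimum is attained,
  and being at most u is an event on the compact interval \<open>{0..u}\<close>.\<close>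

lemma stopping_time_entrance:
  assumes B: "open B" "- B \<noteq> {}"
  shows "stopping_time F (entrance_time B)"
proof
  fix t :: ennreal
  show "Measurable.pred (F t) (\<lambda>\<omega>. entrance_time B \<omega> \<le> t)"
  proof (cases t)
    case (real u)
    have "entrance_time B \<omega> \<le> t \<longleftrightarrow> (\<exists>s\<in>{0..u}. X s \<omega> \<notin> B)" if \<omega>: "\<omega> \<in> space M" for \<omega>
    proof
      let ?K = "{t. 0 \<le> t \<and> X t \<omega> \<notin> B}"
      assume le: "entrance_time B \<omega> \<le> t"
      have "?K \<noteq> {}"
      proof
        assume "?K = {}"
        then show False using le real by (simp only: entrance_time_def) (simp add: top_unique)
      qed
      moreover have "bdd_below ?K" by (intro bdd_belowI[of _ 0]) auto
      ultimately have "Inf ?K \<in> ?K" by (intro closed_contains_Inf closed_outside[OF \<omega> B(1)])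
      moreover have "Inf ?K \<le> u"
        using le real \<open>?K \<noteq> {}\<close> Inf_ennreal_image[of ?K]
        by (auto simp: entrance_time_def subset_eq)
      ultimately show "\<exists>s\<in>{0..u}. X s \<omega> \<notin> B" by auto
    next
      assume "\<exists>s\<in>{0..u}. X s \<omega> \<notin> B"
      then obtain s where s: "0 \<le> s" "s \<le> u" "X s \<omega> \<notin> B" by auto
      then have "entrance_time B \<omega> \<le> ennreal s"
        unfolding entrance_time_def by (intro Inf_lower) auto
      also have "\<dots> \<le> t" using s real by (simp add: ennreal_leI)
      finally show "entrance_time B \<omega> \<le> t" .
    qed
    then have "{\<omega> \<in> space (F t). entrance_time B \<omega> \<le> t} = {\<omega> \<in> space M. \<exists>s\<in>{0..u}. X s \<omega> \<notin> B}"
      by (auto simp: space_F)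
    then show ?thesis
      using exit_before_event[OF B, of 0 u] real by (simp add: pred_def)
  qed simp
qed

section \<open>Exit intervals and the exit positions of the diffusion\<close>

lemma E_between: "u \<in> E \<Longrightarrow> w \<in> E \<Longrightarrow> u \<le> z \<Longrightarrow> z \<le> w \<Longrightarrow> z \<in> E"
  using less_le_trans[of l "ereal u" "ereal z"] le_less_trans[of "ereal z" "ereal w" r]
  by (auto simp: state_space_def)

lemma intervalsE:
  assumes "B \<in> intervals l r y"
  obtains \<alpha> \<beta> z where "B = state_space \<alpha> \<beta>" "B \<subseteq> E" "y \<in> B" "y \<in> E" "open B" "- B \<noteq> {}" "z \<in> E" "z \<notin> B"
proof -
  obtain \<alpha> \<beta> where *: "l \<le> \<alpha>" "\<beta> \<le> r" "B = state_space \<alpha> \<beta>" "y \<in> B" "B \<noteq> E"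
    using assms by (auto simp: intervals_def)
  then have "B \<subseteq> E" by (auto simp: state_space_def intro: le_less_trans less_le_trans)
  then obtain z where "z \<in> E" "z \<notin> B" using * by blast
  with * \<open>B \<subseteq> E\<close> show ?thesis using that[of \<alpha> \<beta> z] open_state_space[of \<alpha> \<beta>] by auto
qed

lemma AE_start:
  assumes "y \<in> E"
  shows "AE \<omega> in P y. \<omega> \<in> space M \<and> X 0 \<omega> = y"
  using start[OF assms] AE_space[of "P y"] by eventually_elim (simp add: space_P assms)

lemma AE_exit_frontier:
  assumes "B \<in> intervals l r y"
  shows "AE \<omega> in P y. exit_time X B \<omega> \<noteq> \<top> \<longrightarrow> stopped X (exit_time X B) \<omega> \<in> frontier B \<inter> E - B"
proof -
  obtain \<alpha> \<beta> z where B: "B = state_space \<alpha> \<beta>" "y \<in> B" "y \<in> E" "open B"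
    using intervalsE[OF assms] by metis
  show ?thesis
    using AE_start[OF B(3)]
  proof eventually_elim
    case (elim \<omega>)
    then show ?case
      using stopped_exit_frontier[of \<omega> B] stopped_exit_outside[of \<omega> B] stopped_in_E[of \<omega>] B by auto
  qed
qed

text \<open>An exit at time 0 would put the starting point itself outside B.\<close>

lemma AE_exit_pos:
  assumes "B \<in> intervals l r y"
  shows "AE \<omega> in P y. 0 < exit_time X B \<omega>"
proof -
  obtain \<alpha> \<beta> z where B: "B = state_space \<alpha> \<beta>" "y \<in> B" "y \<in> E" "open B"
    using intervalsE[OF assms] by metis
  show ?thesis
    using AE_start[OF B(3)]
  proof eventually_elim
    case (elim \<omega>)
    show ?case
    proof (rule ccontr)
      assume "\<not> 0 < exit_time X B \<omega>"
      then have "exit_time X B \<omega> = 0" by simp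
      then show False using stopped_exit_outside[of \<omega> B] elim B by (simp add: stopped_def)
    qed
  qed
qed

text \<open>The sign \<open>s\<close> (either 1 or -1) treats the intervals \<open>(l, z)\<close> and \<open>(z, r)\<close> simultaneously; likewise in
  \<open>ramp\<close> and \<open>harm\<close>.\<close>

definition half_line :: "real \<Rightarrow> real \<Rightarrow> real set" where
  "half_line s z = {y \<in> E. s * y < s * z}"

lemma half_line_eq:
  assumes "z \<in> E" "s = 1 \<or> s = - 1"
  shows "half_line s z = (if s = 1 then state_space l (ereal z) else state_space (ereal z) r)"
  using assms by (auto simp: half_line_def state_space_def intro: less_trans[of _ "ereal z"])

lemma half_line_interval:
  assumes "z \<in> E" "s = 1 \<or> s = - 1" "y \<in> half_line s z"
  shows "half_line s z \<in> intervals l r y"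
proof -
  have "half_line s z \<noteq> E" using assms(1) by (auto simp: half_line_def)
  moreover have "l < ereal z" "ereal z < r" using assms by (auto simp: state_space_def)
  moreover have "\<exists>\<alpha> \<beta>. l \<le> \<alpha> \<and> \<alpha> < \<beta> \<and> \<beta> \<le> r \<and> half_line s z = state_space \<alpha> \<beta>"
  proof (cases "s = 1")
    case True
    then show ?thesis using half_line_eq[OF assms(1,2)] \<open>l < ereal z\<close> \<open>ereal z < r\<close>
      by (intro exI[of _ l] exI[of _ "ereal z"]) auto
  next
    case False
    then show ?thesis using half_line_eq[OF assms(1,2)] \<open>l < ereal z\<close> \<open>ereal z < r\<close>
      by (intro exI[of _ "ereal z"] exI[of _ r]) auto
  qed
  ultimately show ?thesis using assms(3) by (auto simp: intervals_def)
qed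

text \<open>The frontier has only one point in E, the other end being \<open>l\<close> or
  \<open>r\<close>.\<close>

lemma AE_exit_half_line:
  assumes z: "z \<in> E" and s: "s = 1 \<or> s = - 1" and y: "y \<in> half_line s z"
  shows "AE \<omega> in P y. exit_time X (half_line s z) \<omega> \<noteq> \<top> \<longrightarrow> stopped X (exit_time X (half_line s z)) \<omega> = z"
  using AE_exit_frontier[OF half_line_interval[OF assms]]
proof eventually_elim
  case (elim \<omega>)
  show ?case
  proof
    assume "exit_time X (half_line s z) \<omega> \<noteq> \<top>"
    with elim have *: "stopped X (exit_time X (half_line s z)) \<omega> \<in> frontier (half_line s z) \<inter> E" by blast
    then show "stopped X (exit_time X (half_line s z)) \<omega> = z"
      using frontier_state_space_subset[of l "ereal z"] frontier_state_space_subset[of "ereal z" r]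
      by (auto simp: half_line_eq[OF z s] state_space_def split: if_splits)
  qed
qed

lemma AE_exit_bounded:
  assumes y: "x \<in> E" "y1 \<in> E" "y2 \<in> E" "y1 < x" "x < y2"
  defines "B \<equiv> state_space (ereal y1) (ereal y2)"
  shows "B \<in> intervals l r x"
    "AE \<omega> in P x. exit_time X B \<omega> \<noteq> \<top> \<longrightarrow> stopped X (exit_time X B) \<omega> = y1 \<or> stopped X (exit_time X B) \<omega> = y2"
proof -
  have "y1 \<notin> B" by (simp add: B_def state_space_def)
  then have "B \<noteq> E" using y by blast
  then show *: "B \<in> intervals l r x"
    using y unfolding intervals_def B_def
    by (intro CollectI exI[of _ "ereal y1"] exI[of _ "ereal y2"]) (auto simp: state_space_def)
  show "AE \<omega> in P x. exit_time X B \<omega> \<noteq> \<top> \<longrightarrow> stopped X (exit_time X B) \<omega> = y1 \<or> stopped X (exit_time X B) \<omega> = y2"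
    using AE_exit_frontier[OF *] by eventually_elim (use frontier_state_space_subset[of "ereal y1" "ereal y2"] in \<open>auto simp: B_def\<close>)
qed

end

section \<open>Potentials and the strong Markov property\<close>

locale discounted_diffusion = regular_linear_diffusion M F P X l r b \<sigma>
  for M :: "'a measure" and F P X l r b \<sigma> +
  fixes q :: real
  assumes q_pos: "0 < q"
begin

abbreviation U where "U f y \<equiv> total_cost P X q f y"

text \<open>Borel measurability on the whole line serves \<open>markov\<close>, continuity on E
  serves \<open>feller\<close>, and the sign keeps \<open>ennreal\<close> from truncating
  values.\<close>

definition admissible :: "(real \<Rightarrow> real) \<Rightarrow> bool" where
  "admissible f \<longleftrightarrow> f \<in> borel_measurable borel \<and> continuous_on E f \<and> (\<forall>y. 0 \<le> f y)"

text \<open>The strict inequality complements the one in \<open>running_cost\<close> exactly, also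
  at t = \<infinity>, where nothing remains. Discounting is from time 0, not from t.\<close>

definition remaining_cost :: "(real \<Rightarrow> real) \<Rightarrow> ennreal \<Rightarrow> 'a \<Rightarrow> ennreal" where
  "remaining_cost f t \<omega> = (\<integral>\<^sup>+ s. ennreal (f (X s \<omega>) * exp (- q * s)) *
      indicator {s. 0 \<le> s \<and> t < ennreal s} s \<partial>lborel)"

lemma path_measurable:
  assumes [measurable]: "f \<in> borel_measurable borel"
    and Q[measurable]: "Measurable.pred (borel \<Otimes>\<^sub>M M) Q"
  shows "(\<lambda>p. ennreal (f (X (fst p) (snd p)) * exp (- q * fst p)) * indicator {s. 0 \<le> s \<and> Q (s, snd p)} (fst p))
    \<in> borel_measurable (borel \<Otimes>\<^sub>M M)"
proof -
  note X_jointly_measurable[measurable]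
  have "(\<lambda>p. ennreal (f (X (max 0 (fst p)) (snd p)) * exp (- q * fst p)) *
      (if 0 \<le> fst p \<and> Q p then 1 else 0)) \<in> borel_measurable (borel \<Otimes>\<^sub>M M)"
    by measurable
  then show ?thesis
    by (rule measurable_cong[THEN iffD1, rotated]) (auto simp: indicator_def max_def)
qed

lemma path_measurable_at:
  assumes "f \<in> borel_measurable borel" and \<omega>: "\<omega> \<in> space M"
    and "Measurable.pred borel Q"
  shows "(\<lambda>s. ennreal (f (X s \<omega>) * exp (- q * s)) * indicator {s. 0 \<le> s \<and> Q s} s) \<in> borel_measurable borel"
proof -
  have "Measurable.pred (borel \<Otimes>\<^sub>M M) (\<lambda>p. Q (fst p))"
    by (rule measurable_compose[OF measurable_fst assms(3)])
  from path_measurable[OF assms(1) this] have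
    *: "(\<lambda>p. ennreal (f (X (fst p) (snd p)) * exp (- q * fst p)) * indicator {s. 0 \<le> s \<and> Q s} (fst p))
      \<in> borel_measurable (borel \<Otimes>\<^sub>M M)" by simp
  have "(\<lambda>s. (s, \<omega>)) \<in> measurable borel (borel \<Otimes>\<^sub>M M)" using \<omega> by measurable
  from measurable_compose[OF this *] show ?thesis by simp
qed

lemma running_cost_measurable:
  assumes f: "f \<in> borel_measurable borel" and T[measurable]: "T \<in> borel_measurable M"
  shows "(\<lambda>\<omega>. running_cost X q f (T \<omega>) \<omega>) \<in> borel_measurable M"
proof -
  have "Measurable.pred (borel \<Otimes>\<^sub>M M) (\<lambda>p. ennreal (fst p) \<le> T (snd p))" by measurable
  from path_measurable[OF f this]
  have "(\<lambda>(\<omega>, s). ennreal (f (X s \<omega>) * exp (- q * s)) * indicator {s. 0 \<le> s \<and> ennreal s \<le> T \<omega>} s)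
      \<in> borel_measurable (M \<Otimes>\<^sub>M lborel)"
    by (subst measurable_pair_swap_iff) (simp add: split_beta' cong: measurable_cong_sets)
  from lborel.borel_measurable_nn_integral[OF this] show ?thesis
    by (simp add: running_cost_def[abs_def])
qed

lemma remaining_cost_measurable:
  assumes f: "f \<in> borel_measurable borel" and T[measurable]: "T \<in> borel_measurable M"
  shows "(\<lambda>\<omega>. remaining_cost f (T \<omega>) \<omega>) \<in> borel_measurable M"
proof -
  have "Measurable.pred (borel \<Otimes>\<^sub>M M) (\<lambda>p. T (snd p) < ennreal (fst p))" by measurable
  from path_measurable[OF f this]
  have "(\<lambda>(\<omega>, s). ennreal (f (X s \<omega>) * exp (- q * s)) * indicator {s. 0 \<le> s \<and> T \<omega> < ennreal s} s)
      \<in> borel_measurable (M \<Otimes>\<^sub>M lborel)"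
    by (subst measurable_pair_swap_iff) (simp add: split_beta' cong: measurable_cong_sets)
  from lborel.borel_measurable_nn_integral[OF this] show ?thesis
    by (simp add: remaining_cost_def[abs_def])
qed

lemma running_plus_remaining_cost:
  assumes f: "f \<in> borel_measurable borel" and \<omega>: "\<omega> \<in> space M"
  shows "running_cost X q f \<top> \<omega> = running_cost X q f t \<omega> + remaining_cost f t \<omega>"
proof -
  have m1: "(\<lambda>s. ennreal (f (X s \<omega>) * exp (- q * s)) * indicator {s. 0 \<le> s \<and> ennreal s \<le> t} s) \<in> borel_measurable borel"
    by (rule path_measurable_at[OF f \<omega>]) measurable
  have m2: "(\<lambda>s. ennreal (f (X s \<omega>) * exp (- q * s)) * indicator {s. 0 \<le> s \<and> t < ennreal s} s) \<in> borel_measurable borel"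
    by (rule path_measurable_at[OF f \<omega>]) measurable
  have "running_cost X q f t \<omega> + remaining_cost f t \<omega> =
    (\<integral>\<^sup>+ s. ennreal (f (X s \<omega>) * exp (- q * s)) * indicator {s. 0 \<le> s \<and> ennreal s \<le> t} s +
        ennreal (f (X s \<omega>) * exp (- q * s)) * indicator {s. 0 \<le> s \<and> t < ennreal s} s \<partial>lborel)"
    unfolding running_cost_def remaining_cost_def
    by (rule nn_integral_add[symmetric]) (unfold measurable_lborel2, rule m1, rule m2)
  also have "\<dots> = running_cost X q f \<top> \<omega>"
    unfolding running_cost_def by (intro nn_integral_cong) (auto simp: indicator_def)
  finally show ?thesis by simp
qed

lemma remaining_cost_le: "remaining_cost f t \<omega> \<le> running_cost X q f \<top> \<omega>"
  unfolding remaining_cost_def running_cost_def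
  by (intro nn_integral_mono) (auto simp: indicator_def)

lemma nn_integral_exp: "(\<integral>\<^sup>+ s. ennreal (exp (- q * s)) * indicator {0..} s \<partial>lborel) = ennreal (1 / q)"
proof -
  interpret prob_space "density lborel (exponential_density q)"
    by (rule prob_space_exponential_density[OF q_pos])
  have "1 = (\<integral>\<^sup>+ s. ennreal (exponential_density q s) \<partial>lborel)"
    using emeasure_space_1 by (simp add: emeasure_density)
  also have "\<dots> = (\<integral>\<^sup>+ s. ennreal q * (ennreal (exp (- q * s)) * indicator {0..} s) \<partial>lborel)"
    using q_pos by (intro nn_integral_cong) (auto simp: exponential_density_def indicator_def ennreal_mult[symmetric] mult.commute)
  also have "\<dots> = ennreal q * (\<integral>\<^sup>+ s. ennreal (exp (- q * s)) * indicator {0..} s \<partial>lborel)"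
    by (intro nn_integral_cmult) auto
  finally have *: "1 = ennreal q * (\<integral>\<^sup>+ s. ennreal (exp (- q * s)) * indicator {0..} s \<partial>lborel)" .
  have "(\<integral>\<^sup>+ s. ennreal (exp (- q * s)) * indicator {0..} s \<partial>lborel) =
      ennreal (1 / q) * (ennreal q * (\<integral>\<^sup>+ s. ennreal (exp (- q * s)) * indicator {0..} s \<partial>lborel))"
    using q_pos by (subst mult.assoc[symmetric], subst ennreal_mult[symmetric]) auto
  also have "\<dots> = ennreal (1 / q)"
    by (simp only: *[symmetric] mult_1_right)
  finally show ?thesis .
qed

lemma running_cost_bounded:
  assumes "\<And>y. f y \<le> K" "0 \<le> K"
  shows "running_cost X q f t \<omega> \<le> ennreal (K / q)"
proof -
  have "running_cost X q f t \<omega> \<le> (\<integral>\<^sup>+ s. ennreal K * (ennreal (exp (- q * s)) * indicator {0..} s) \<partial>lborel)"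
    unfolding running_cost_def using assms
    by (intro nn_integral_mono) (auto simp: indicator_def ennreal_mult[symmetric] intro!: ennreal_leI mult_right_mono)
  also have "\<dots> = ennreal K * ennreal (1 / q)"
    unfolding nn_integral_exp[symmetric] by (rule nn_integral_cmult) simp
  finally show ?thesis using assms(2) q_pos by (simp add: ennreal_mult[symmetric])
qed

lemma U_bounded:
  assumes y: "y \<in> E" and "\<And>y. f y \<le> K" "0 \<le> K"
  shows "U f y \<le> ennreal (K / q)"
proof -
  interpret prob_space "P y" by (rule prob_space_P[OF y])
  have "U f y \<le> (\<integral>\<^sup>+ \<omega>. ennreal (K / q) \<partial>P y)"
    unfolding total_cost_def by (intro nn_integral_mono running_cost_bounded assms)
  then show ?thesis by (simp add: emeasure_space_1)
qed

lemma bounded_admissibleD: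
  assumes "admissible f" "bounded (range f)"
  obtains K where "0 \<le> K" "\<And>y. f y \<le> K" "\<And>y. norm (f y) \<le> K"
proof -
  obtain K where "\<And>y. norm (f y) \<le> K" using assms(2) by (auto simp: bounded_iff)
  moreover from this have "f y \<le> K" for y by (metis abs_le_D1 real_norm_def)
  ultimately show ?thesis using that[of K] norm_ge_zero order_trans by blast
qed

lemma U_finite: "y \<in> E \<Longrightarrow> admissible f \<Longrightarrow> bounded (range f) \<Longrightarrow> U f y < \<top>"
  by (metis bounded_admissibleD U_bounded ennreal_less_top le_less_trans)

section \<open>The potential of a bounded function as resolvent of the semigroup\<close>

lemma transition_nonneg: "admissible f \<Longrightarrow> 0 \<le> transition P X t f y"
  by (simp add: transition_def admissible_def)

lemma integrable_X:
  assumes y: "y \<in> E" and "0 \<le> t" "admissible f" "bounded (range f)"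
  shows "integrable (P y) (\<lambda>\<omega>. f (X t \<omega>))"
proof -
  interpret prob_space "P y" by (rule prob_space_P[OF y])
  obtain K where K: "\<And>y. norm (f y) \<le> K" using assms bounded_admissibleD by metis
  have "(\<lambda>\<omega>. f (X t \<omega>)) \<in> borel_measurable (P y)"
    using assms X_measurable[of t] by (auto simp: measurable_P admissible_def intro: measurable_compose)
  then show ?thesis using K by (intro integrable_const_bound[of _ K]) auto
qed

lemma transition_eq_nn_integral:
  assumes y: "y \<in> E" and "0 \<le> t" "admissible f" "bounded (range f)"
  shows "ennreal (transition P X t f y) = (\<integral>\<^sup>+ \<omega>. ennreal (f (X t \<omega>)) \<partial>P y)"
  unfolding transition_def using assms(3)
  by (intro nn_integral_eq_integral[symmetric] integrable_X[OF assms]) (auto simp: admissible_def)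

lemma continuous_X:
  assumes "admissible f" "\<omega> \<in> space M" "0 \<le> s"
  shows "continuous_on {0..} (\<lambda>t. f (X (s + t) \<omega>))"
proof -
  have "continuous_on {0..} (\<lambda>t. X (s + t) \<omega>)"
  proof (rule continuous_on_compose2[OF continuous_paths[OF assms(2)]])
    show "continuous_on {0..} (\<lambda>t. s + t)" by (intro continuous_intros)
    show "(\<lambda>t. s + t) ` {0..} \<subseteq> {0..}" using assms(3) by auto
  qed
  with assms show ?thesis
    by (auto intro!: continuous_on_compose2[of E f _ "\<lambda>t. X (s + t) \<omega>"] simp: admissible_def in_state_space)
qed

text \<open>Dominated convergence along continuous paths. This supplies the measurability in time
  needed for the integrals over t.\<close>

lemma transition_continuous_in_time:
  assumes y: "y \<in> E" and f: "admissible f" "bounded (range f)"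
  shows "continuous_on {0..} (\<lambda>t. transition P X t f y)"
  unfolding continuous_on_sequentially
proof safe
  fix s :: "nat \<Rightarrow> real" and t :: real assume t: "0 \<le> t" "\<forall>n. s n \<in> {0..}" "s \<longlonglongrightarrow> t"
  interpret prob_space "P y" by (rule prob_space_P[OF y])
  obtain K where K: "\<And>y. norm (f y) \<le> K" using f bounded_admissibleD by metis
  show "((\<lambda>t. transition P X t f y) \<circ> s) \<longlonglongrightarrow> transition P X t f y"
    unfolding transition_def comp_def
  proof (rule integral_dominated_convergence[where w="\<lambda>_. K"])
    show "AE \<omega> in P y. (\<lambda>i. f (X (s i) \<omega>)) \<longlonglongrightarrow> f (X t \<omega>)"
    proof (rule AE_I2)
      fix \<omega> assume "\<omega> \<in> space (P y)"
      then have "continuous_on {0..} (\<lambda>t. f (X t \<omega>))"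
        using continuous_X[OF f(1), of \<omega> 0] by (simp add: space_P[OF y])
      then show "(\<lambda>i. f (X (s i) \<omega>)) \<longlonglongrightarrow> f (X t \<omega>)"
        using t by (intro continuous_on_tendsto_compose[where f="\<lambda>t. f (X t \<omega>)"]) auto
    qed
  qed (use t f K integrable_X[OF y _ f] in auto)
qed

text \<open>Fubini turns the expected total cost into the resolvent at q, the form in which Feller
  continuity and the simple Markov property carry over to \<open>U\<close>.\<close>

lemma U_eq_transition:
  assumes y: "y \<in> E" and f: "admissible f" "bounded (range f)"
  shows "U f y = (\<integral>\<^sup>+ t. ennreal (transition P X t f y) * (ennreal (exp (- q * t)) * indicator {0..} t) \<partial>lborel)"
proof -
  interpret P: prob_space "P y" by (rule prob_space_P[OF y])
  interpret pair_sigma_finite lborel "P y" ..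
  have fb: "f \<in> borel_measurable borel" using f by (simp add: admissible_def)
  have "(\<lambda>p. ennreal (f (X (fst p) (snd p)) * exp (- q * fst p)) * indicator {s. 0 \<le> s \<and> True} (fst p))
    \<in> borel_measurable (lborel \<Otimes>\<^sub>M P y)"
    using path_measurable[OF fb, of "\<lambda>_. True"] sets_P[OF y]
    by (simp cong: measurable_cong_sets sets_pair_measure_cong)
  from Fubini[OF this]
  have "U f y = (\<integral>\<^sup>+ t. \<integral>\<^sup>+ \<omega>. ennreal (f (X t \<omega>) * exp (- q * t)) * indicator {s. 0 \<le> s} t \<partial>P y \<partial>lborel)"
    by (simp add: total_cost_def running_cost_def)
  also have "\<dots> = (\<integral>\<^sup>+ t. ennreal (transition P X t f y) * (ennreal (exp (- q * t)) * indicator {0..} t) \<partial>lborel)"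
  proof (rule nn_integral_cong)
    fix t :: real
    show "(\<integral>\<^sup>+ \<omega>. ennreal (f (X t \<omega>) * exp (- q * t)) * indicator {s. 0 \<le> s} t \<partial>P y) =
        ennreal (transition P X t f y) * (ennreal (exp (- q * t)) * indicator {0..} t)"
    proof (cases "0 \<le> t")
      case True
      have "(\<lambda>\<omega>. ennreal (f (X t \<omega>))) \<in> borel_measurable (P y)"
        using fb X_measurable[OF True] by (auto simp: measurable_P[OF y])
      then have "(\<integral>\<^sup>+ \<omega>. ennreal (f (X t \<omega>)) * ennreal (exp (- q * t)) \<partial>P y) =
          (\<integral>\<^sup>+ \<omega>. ennreal (f (X t \<omega>)) \<partial>P y) * ennreal (exp (- q * t))"
        by (rule nn_integral_multc)
      then show ?thesis
        using True f(1) by (simp add: transition_eq_nn_integral[OF y True f] ennreal_mult admissible_def)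
    qed simp
  qed
  finally show ?thesis .
qed

lemma transition_measurable_in_time:
  assumes y: "y \<in> E" and f: "admissible f" "bounded (range f)"
  shows "(\<lambda>t. ennreal (transition P X t f y) * (ennreal (exp (- q * t)) * indicator {0..} t)) \<in> borel_measurable borel"
proof -
  have "(\<lambda>t. if t \<in> {0..} then transition P X t f y else 0) \<in> borel_measurable borel"
    by (intro borel_measurable_continuous_on_if transition_continuous_in_time y f) auto
  then have "(\<lambda>t. ennreal (if t \<in> {0..} then transition P X t f y else 0) * (ennreal (exp (- q * t)) * indicator {0..} t)) \<in> borel_measurable borel"
    by measurable
  then show ?thesis
    by (rule measurable_cong[THEN iffD1, rotated]) (auto simp: indicator_def)
qed

text \<open>Feller continuity at each t passes through the time integral by the dominating function
  K exp(-q t).\<close>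

lemma U_continuous:
  assumes f: "admissible f" "bounded (range f)"
  shows "continuous_on E (U f)"
  unfolding continuous_on_sequentially
proof safe
  fix z :: "nat \<Rightarrow> real" and y :: real assume y: "y \<in> E" and z: "\<forall>n. z n \<in> E" "z \<longlonglongrightarrow> y"
  obtain K where K: "0 \<le> K" "\<And>y. norm (f y) \<le> K" using f bounded_admissibleD by metis
  have tr: "transition P X t f y \<le> K" if y: "y \<in> E" and "0 \<le> t" for t y
  proof -
    interpret prob_space "P y" by (rule prob_space_P[OF y])
    show ?thesis unfolding transition_def
      by (intro integral_le_const integrable_X[OF that f]) (use K in \<open>auto simp: abs_le_iff\<close>)
  qed
  have "(\<lambda>n. \<integral>\<^sup>+ t. ennreal (transition P X t f (z n)) * (ennreal (exp (- q * t)) * indicator {0..} t) \<partial>lborel)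
      \<longlonglongrightarrow> (\<integral>\<^sup>+ t. ennreal (transition P X t f y) * (ennreal (exp (- q * t)) * indicator {0..} t) \<partial>lborel)"
  proof (rule nn_integral_dominated_convergence[where w="\<lambda>t. ennreal K * (ennreal (exp (- q * t)) * indicator {0..} t)"])
    show "AE t in lborel. ennreal (transition P X t f (z j)) * (ennreal (exp (- q * t)) * indicator {0..} t)
        \<le> ennreal K * (ennreal (exp (- q * t)) * indicator {0..} t)" for j
      using z tr by (intro AE_I2) (auto simp: indicator_def intro!: mult_right_mono ennreal_leI)
    show "(\<integral>\<^sup>+ t. ennreal K * (ennreal (exp (- q * t)) * indicator {0..} t) \<partial>lborel) < \<infinity>"
      using nn_integral_cmult[of "\<lambda>t. ennreal (exp (- q * t)) * indicator {0..} t" lborel "ennreal K"]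
      unfolding nn_integral_exp by (simp add: ennreal_mult_less_top)
    show "AE t in lborel. (\<lambda>n. ennreal (transition P X t f (z n)) * (ennreal (exp (- q * t)) * indicator {0..} t))
        \<longlonglongrightarrow> ennreal (transition P X t f y) * (ennreal (exp (- q * t)) * indicator {0..} t)"
    proof (rule AE_I2)
      fix t :: real
      show "(\<lambda>n. ennreal (transition P X t f (z n)) * (ennreal (exp (- q * t)) * indicator {0..} t))
        \<longlonglongrightarrow> ennreal (transition P X t f y) * (ennreal (exp (- q * t)) * indicator {0..} t)"
      proof (cases "0 \<le> t")
        case True
        have "bounded (f ` E)" using f(2) by (rule bounded_subset) auto
        then have "continuous_on E (transition P X t f)"
          using feller[OF True] f by (auto simp: admissible_def)
        then have "(\<lambda>n. transition P X t f (z n)) \<longlonglongrightarrow> transition P X t f y"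
          using y z by (intro continuous_on_tendsto_compose[where f="transition P X t f"]) auto
        then have "(\<lambda>n. ennreal (transition P X t f (z n) * (exp (- q * t) * indicator {0..} t)))
          \<longlonglongrightarrow> ennreal (transition P X t f y * (exp (- q * t) * indicator {0..} t))"
          by (intro tendsto_ennrealI tendsto_intros)
        then show ?thesis using True by (simp add: ennreal_mult transition_nonneg[OF f(1)])
      qed simp
    qed
  qed (use y z transition_measurable_in_time[OF _ f] in auto)
  then show "((U f) \<circ> z) \<longlonglongrightarrow> U f y"
    using y z by (simp add: comp_def U_eq_transition[OF _ f])
qed

section \<open>The Markov property for the remaining cost at a fixed time\<close>

lemma markov_nn_integral:
  assumes y: "y \<in> E" and f: "admissible f" "bounded (range f)" and st: "0 \<le> s" "0 \<le> t"
    and A: "A \<in> sets (F (ennreal s))"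
  shows "(\<integral>\<^sup>+ \<omega>. indicator A \<omega> * ennreal (f (X (s + t) \<omega>)) \<partial>P y) =
    (\<integral>\<^sup>+ \<omega>. indicator A \<omega> * ennreal (transition P X t f (X s \<omega>)) \<partial>P y)"
proof -
  interpret P: prob_space "P y" by (rule prob_space_P[OF y])
  interpret finite_measure_subalgebra "P y" "F (ennreal s)"
    by unfold_locales (use sets_F_subset[of s] in \<open>auto simp: subalgebra_def space_F space_P[OF y] sets_P[OF y]\<close>)
  let ?f = "\<lambda>\<omega>. f (X (s + t) \<omega>)"
  let ?e = "real_cond_exp (P y) (F (ennreal s)) ?f"
  have A': "A \<in> sets (P y)" using A sets_F_subset[of s] by (auto simp: sets_P[OF y])
  have int: "integrable (P y) ?f" using st by (intro integrable_X y f) auto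
  have mk: "AE \<omega> in P y. ?e \<omega> = transition P X t f (X s \<omega>)"
    using markov[OF y st _ f(2)] f(1) by (simp add: admissible_def)
  have nonneg: "AE \<omega> in P y. 0 \<le> ?e \<omega>"
    using mk by eventually_elim (simp add: transition_nonneg[OF f(1)])
  have "(\<integral>\<^sup>+ \<omega>. indicator A \<omega> * ennreal (?f \<omega>) \<partial>P y) = (\<integral>\<^sup>+ \<omega>. ennreal (indicator A \<omega> *\<^sub>R ?f \<omega>) \<partial>P y)"
    by (intro nn_integral_cong) (auto simp: indicator_def)
  also have "\<dots> = ennreal (\<integral>\<omega>\<in>A. ?f \<omega> \<partial>P y)"
    unfolding set_lebesgue_integral_def using f(1)
    by (intro nn_integral_eq_integral integrable_mult_indicator A' int) (auto simp: admissible_def)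
  also have "\<dots> = ennreal (\<integral>\<omega>\<in>A. ?e \<omega> \<partial>P y)"
    using real_cond_exp_intA[OF int A] by simp
  also have "\<dots> = (\<integral>\<^sup>+ \<omega>. ennreal (indicator A \<omega> *\<^sub>R ?e \<omega>) \<partial>P y)"
    unfolding set_lebesgue_integral_def
    by (intro nn_integral_eq_integral[symmetric] integrable_mult_indicator A' real_cond_exp_int(1)[OF int])
       (use nonneg in eventually_elim, simp)
  also have "\<dots> = (\<integral>\<^sup>+ \<omega>. indicator A \<omega> * ennreal (transition P X t f (X s \<omega>)) \<partial>P y)"
    by (intro nn_integral_cong_AE) (use mk in eventually_elim, auto simp: indicator_def)
  finally show ?thesis .
qed

text \<open>\<open>Y\<close> is general because Fubini is applied twice: to f(X(s + t)), and to the
  transition operator applied at X(s) that replaces it.\<close>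

lemma shift_jointly_measurable:
  assumes y: "y \<in> E" and Y: "\<And>t. 0 \<le> t \<Longrightarrow> Y t \<in> borel_measurable M"
    "\<And>\<omega>. \<omega> \<in> space M \<Longrightarrow> continuous_on {0..} (\<lambda>t. Y t \<omega>)"
    and A: "A \<in> sets M"
  shows "(\<lambda>(t, \<omega>). indicator A \<omega> * (ennreal (Y t \<omega>) * (ennreal (exp (- q * (s + t))) * indicator {0<..} t)))
    \<in> borel_measurable (lborel \<Otimes>\<^sub>M P y)"
proof -
  note borel_measurable_continuous_fst[OF Y, simplified, measurable]
  note A[measurable]
  have "(\<lambda>p. indicator A (snd p) * (ennreal (Y (max 0 (fst p)) (snd p)) * (ennreal (exp (- q * (s + fst p))) * indicator {0<..} (fst p))))
    \<in> borel_measurable (borel \<Otimes>\<^sub>M M)"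
    by measurable
  then have "(\<lambda>(t, \<omega>). indicator A \<omega> * (ennreal (Y t \<omega>) * (ennreal (exp (- q * (s + t))) * indicator {0<..} t)))
    \<in> borel_measurable (borel \<Otimes>\<^sub>M M)"
    by (rule measurable_cong[THEN iffD1, rotated]) (auto simp: indicator_def max_def)
  then show ?thesis
    using sets_P[OF y] by (simp cong: measurable_cong_sets sets_pair_measure_cong)
qed

lemma transition_X_measurable:
  assumes "0 \<le> s" "0 \<le> t" and f: "admissible f" "bounded (range f)"
  shows "(\<lambda>\<omega>. transition P X t f (X s \<omega>)) \<in> borel_measurable M"
proof -
  have "bounded (f ` E)" using f(2) by (rule bounded_subset) auto
  then have "continuous_on E (transition P X t f)"
    using feller f assms by (auto simp: admissible_def)
  from measurable_compose[OF X_measurable[OF assms(1)] borel_measurable_on_open[OF this open_state_space]]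
  show ?thesis
    by (rule measurable_cong[THEN iffD1, rotated]) (auto simp: in_state_space assms)
qed

lemma remaining_cost_shift:
  assumes \<omega>: "\<omega> \<in> space M" and s: "0 \<le> s" and f: "f \<in> borel_measurable borel" "\<And>y. 0 \<le> f y"
  shows "remaining_cost f (ennreal s) \<omega> =
    (\<integral>\<^sup>+ t. ennreal (f (X (s + t) \<omega>)) * (ennreal (exp (- q * (s + t))) * indicator {0<..} t) \<partial>lborel)"
proof -
  have "(\<lambda>t. ennreal (f (X t \<omega>) * exp (- q * t)) * indicator {t. 0 \<le> t \<and> ennreal s < ennreal t} t) \<in> borel_measurable borel"
    by (rule path_measurable_at[OF f(1) \<omega>]) measurable
  from nn_integral_real_affine[OF this, of 1 s]
  have "remaining_cost f (ennreal s) \<omega> = (\<integral>\<^sup>+ t. ennreal (f (X (s + t) \<omega>) * exp (- q * (s + t))) *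
      indicator {t. 0 \<le> t \<and> ennreal s < ennreal t} (s + t) \<partial>lborel)"
    by (simp add: remaining_cost_def)
  also have "\<dots> = (\<integral>\<^sup>+ t. ennreal (f (X (s + t) \<omega>)) * (ennreal (exp (- q * (s + t))) * indicator {0<..} t) \<partial>lborel)"
    using s f by (intro nn_integral_cong) (auto simp: indicator_def ennreal_mult ennreal_less_iff)
  finally show ?thesis .
qed

text \<open>The time integral is moved outside, the Markov property is applied for each t
  separately, and the time integral is moved back; there it is the resolvent at X(s), with the
  factor exp(-q s) split off.\<close>

lemma markov_remaining_cost:
  assumes y: "y \<in> E" and f: "admissible f" "bounded (range f)" and s: "0 \<le> s"
    and A: "A \<in> sets (F (ennreal s))"
  shows "(\<integral>\<^sup>+ \<omega>. indicator A \<omega> * remaining_cost f (ennreal s) \<omega> \<partial>P y) =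
    (\<integral>\<^sup>+ \<omega>. indicator A \<omega> * (ennreal (exp (- q * s)) * U f (X s \<omega>)) \<partial>P y)"
proof -
  interpret P: prob_space "P y" by (rule prob_space_P[OF y])
  interpret pair_sigma_finite lborel "P y" ..
  have fb: "f \<in> borel_measurable borel" "\<And>y. 0 \<le> f y" using f by (auto simp: admissible_def)
  have A': "A \<in> sets M" using A sets_F_subset[of s] by auto
  have Am[measurable]: "A \<in> sets (P y)" using A' by (simp add: sets_P[OF y])
  let ?k = "\<lambda>t. ennreal (exp (- q * (s + t))) * indicator {0<..} t"
  have meas1: "(\<lambda>t. ennreal (f (X (s + t) \<omega>)) * ?k t) \<in> borel_measurable lborel"
    and meas2: "(\<lambda>t. ennreal (transition P X t f (X s \<omega>)) * ?k t) \<in> borel_measurable lborel"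
    if \<omega>: "\<omega> \<in> space M" for \<omega>
  proof -
    have m: "(\<lambda>t. ennreal (Y t) * ?k t) \<in> borel_measurable lborel" if "continuous_on {0..} Y" for Y
    proof -
      have "(\<lambda>t. if t \<in> {0..} then Y t else 0) \<in> borel_measurable borel"
        by (intro borel_measurable_continuous_on_if that) auto
      then have "(\<lambda>t. ennreal (if t \<in> {0..} then Y t else 0) * ?k t) \<in> borel_measurable lborel"
        by measurable
      then show ?thesis
        by (rule measurable_cong[THEN iffD1, rotated]) (auto simp: indicator_def)
    qed
    show "(\<lambda>t. ennreal (f (X (s + t) \<omega>)) * ?k t) \<in> borel_measurable lborel"
      by (intro m continuous_X f \<omega> s)
    show "(\<lambda>t. ennreal (transition P X t f (X s \<omega>)) * ?k t) \<in> borel_measurable lborel"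
      by (intro m transition_continuous_in_time f in_state_space \<omega> s)
  qed
  have "(\<integral>\<^sup>+ \<omega>. indicator A \<omega> * remaining_cost f (ennreal s) \<omega> \<partial>P y) =
      (\<integral>\<^sup>+ \<omega>. \<integral>\<^sup>+ t. indicator A \<omega> * (ennreal (f (X (s + t) \<omega>)) * ?k t) \<partial>lborel \<partial>P y)"
    using meas1 by (intro nn_integral_cong) (simp add: space_P[OF y] remaining_cost_shift[OF _ s fb] nn_integral_cmult)
  also have "\<dots> = (\<integral>\<^sup>+ t. \<integral>\<^sup>+ \<omega>. indicator A \<omega> * (ennreal (f (X (s + t) \<omega>)) * ?k t) \<partial>P y \<partial>lborel)"
  proof (rule Fubini', rule shift_jointly_measurable[OF y _ _ A'])
    show "(\<lambda>\<omega>. f (X (s + t) \<omega>)) \<in> borel_measurable M" if "0 \<le> t" for t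
      using s that by (intro measurable_compose[OF X_measurable fb(1)]) auto
    show "continuous_on {0..} (\<lambda>t. f (X (s + t) \<omega>))" if "\<omega> \<in> space M" for \<omega>
      by (rule continuous_X[OF f(1) that s])
  qed
  also have "\<dots> = (\<integral>\<^sup>+ t. \<integral>\<^sup>+ \<omega>. indicator A \<omega> * (ennreal (transition P X t f (X s \<omega>)) * ?k t) \<partial>P y \<partial>lborel)"
  proof (rule nn_integral_cong)
    fix t :: real
    show "(\<integral>\<^sup>+ \<omega>. indicator A \<omega> * (ennreal (f (X (s + t) \<omega>)) * ?k t) \<partial>P y) =
        (\<integral>\<^sup>+ \<omega>. indicator A \<omega> * (ennreal (transition P X t f (X s \<omega>)) * ?k t) \<partial>P y)"
    proof (cases "0 < t")
      case True
      have "(\<lambda>\<omega>. f (X (s + t) \<omega>)) \<in> borel_measurable (P y)"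
        using s True by (intro measurable_compose[OF _ fb(1)]) (simp add: measurable_P[OF y] X_measurable)
      moreover have "(\<lambda>\<omega>. transition P X t f (X s \<omega>)) \<in> borel_measurable (P y)"
        using transition_X_measurable[OF s _ f] True by (simp add: measurable_P[OF y])
      ultimately show ?thesis
        using markov_nn_integral[OF y f s _ A, of t] True
        by (simp add: mult.assoc[symmetric] nn_integral_multc)
    qed simp
  qed
  also have "\<dots> = (\<integral>\<^sup>+ \<omega>. \<integral>\<^sup>+ t. indicator A \<omega> * (ennreal (transition P X t f (X s \<omega>)) * ?k t) \<partial>lborel \<partial>P y)"
  proof (rule Fubini'[symmetric], rule shift_jointly_measurable[OF y _ _ A'])
    show "(\<lambda>\<omega>. transition P X t f (X s \<omega>)) \<in> borel_measurable M" if "0 \<le> t" for t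
      by (rule transition_X_measurable[OF s that f])
    show "continuous_on {0..} (\<lambda>t. transition P X t f (X s \<omega>))" if "\<omega> \<in> space M" for \<omega>
      by (intro transition_continuous_in_time f in_state_space that s)
  qed
  also have "\<dots> = (\<integral>\<^sup>+ \<omega>. indicator A \<omega> * (ennreal (exp (- q * s)) * U f (X s \<omega>)) \<partial>P y)"
  proof (rule nn_integral_cong)
    fix \<omega> assume "\<omega> \<in> space (P y)"
    then have \<omega>: "\<omega> \<in> space M" "X s \<omega> \<in> E" using s by (auto simp: space_P[OF y] in_state_space)
    have "(\<integral>\<^sup>+ t. ennreal (transition P X t f (X s \<omega>)) * ?k t \<partial>lborel) =
        (\<integral>\<^sup>+ t. ennreal (exp (- q * s)) *
          (ennreal (transition P X t f (X s \<omega>)) * (ennreal (exp (- q * t)) * indicator {0..} t)) \<partial>lborel)"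
    \<comment> \<open>The remaining cost integrates over t > 0, the potential over t \<ge> 0; the
      point 0 is a null set.\<close>
    proof (rule nn_integral_cong_AE, rule AE_mp[OF AE_lborel_singleton[of 0]], rule AE_I2, rule impI)
      fix t :: real assume "t \<noteq> 0"
      have "exp (- q * (s + t)) = exp (- q * s) * exp (- q * t)"
        by (simp add: algebra_simps flip: exp_add)
      then have "ennreal (exp (- q * (s + t))) = ennreal (exp (- q * s)) * ennreal (exp (- q * t))"
        by (simp add: ennreal_mult)
      moreover have "indicator {0<..} t = (indicator {0..} t :: ennreal)"
        using \<open>t \<noteq> 0\<close> by (auto simp: indicator_def)
      ultimately show "ennreal (transition P X t f (X s \<omega>)) * ?k t =
        ennreal (exp (- q * s)) * (ennreal (transition P X t f (X s \<omega>)) * (ennreal (exp (- q * t)) * indicator {0..} t))"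
        by (simp only: ac_simps)
    qed
    also have "\<dots> = ennreal (exp (- q * s)) * U f (X s \<omega>)"
      unfolding U_eq_transition[OF \<omega>(2) f]
      using transition_measurable_in_time[OF \<omega>(2) f] by (intro nn_integral_cmult) (simp only: measurable_lborel2)
    finally have *: "(\<integral>\<^sup>+ t. ennreal (transition P X t f (X s \<omega>)) * ?k t \<partial>lborel) = ennreal (exp (- q * s)) * U f (X s \<omega>)" .
    show "(\<integral>\<^sup>+ t. indicator A \<omega> * (ennreal (transition P X t f (X s \<omega>)) * ?k t) \<partial>lborel) =
      indicator A \<omega> * (ennreal (exp (- q * s)) * U f (X s \<omega>))"
      unfolding *[symmetric] by (rule nn_integral_cmult[OF meas2[OF \<omega>(1)]])
  qed
  finally show ?thesis .
qed

section \<open>The strong Markov property for potentials by discretising time\<close>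

definition cell :: "('a \<Rightarrow> ennreal) \<Rightarrow> nat \<Rightarrow> nat \<Rightarrow> 'a set" where
  "cell T n k = {\<omega> \<in> space M. T \<omega> \<noteq> \<top> \<and> \<lfloor>real (Suc n) * enn2real (T \<omega>)\<rfloor> = int k}"

abbreviation grid :: "nat \<Rightarrow> nat \<Rightarrow> real" where
  "grid n k \<equiv> (real k + 1) / real (Suc n)"

text \<open>On a cell, T lies in an interval closed on the left and open on the right. The cell is
  therefore a difference of two events {T < s} and is decided at the right end
  \<open>grid n k\<close>.\<close>

lemma cell_sets:
  assumes T: "optional_time T"
  shows "cell T n k \<in> sets (F (ennreal (grid n k)))"
proof -
  have less: "ennreal t < ennreal (real j / real (Suc n)) \<longleftrightarrow> real (Suc n) * t < real j" if "0 \<le> t" for t and j :: nat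
    using that by (simp add: ennreal_less_iff pos_less_divide_eq mult.commute del: of_nat_Suc)
  have "T \<omega> < ennreal (grid n k) \<and> \<not> T \<omega> < ennreal (real k / real (Suc n)) \<longleftrightarrow>
      T \<omega> \<noteq> \<top> \<and> \<lfloor>real (Suc n) * enn2real (T \<omega>)\<rfloor> = int k" for \<omega>
  proof (cases "T \<omega>")
    case (real t)
    have "ennreal t < ennreal (grid n k) \<longleftrightarrow> real (Suc n) * t < real k + 1"
      using less[OF real(1), of "Suc k"] by (simp add: add.commute)
    with less[OF real(1), of k] show ?thesis
      using real by (simp del: of_nat_Suc add: floor_eq_iff not_less) linarith
  qed simp
  then have "cell T n k = {\<omega> \<in> space M. T \<omega> < ennreal (grid n k)} - {\<omega> \<in> space M. T \<omega> < ennreal (real k / real (Suc n))}"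
    by (auto simp: cell_def)
  moreover have "ennreal (real k / real (Suc n)) \<le> ennreal (grid n k)"
    by (intro ennreal_leI divide_right_mono) auto
  ultimately show ?thesis
    using optional_less_F[OF T] by auto
qed

lemma cell_sets_M: "optional_time T \<Longrightarrow> cell T n k \<in> sets M"
  using cell_sets[of T n k] sets_F_subset by blast

lemma suminf_cell:
  assumes \<omega>: "\<omega> \<in> space M"
  shows "(\<Sum>k. h k * indicator (cell T n k) \<omega>) =
    (if T \<omega> = \<top> then 0 else h (nat \<lfloor>real (Suc n) * enn2real (T \<omega>)\<rfloor>) :: ennreal)"
proof (cases "T \<omega> = \<top>")
  case True
  then show ?thesis by (simp add: cell_def)
next
  case False
  have "disjoint_family (cell T n)"
    by (auto simp: disjoint_family_on_def cell_def)
  moreover have "\<omega> \<in> cell T n (nat \<lfloor>real (Suc n) * enn2real (T \<omega>)\<rfloor>)"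
    using False \<omega> by (simp add: cell_def del: of_nat_Suc)
  ultimately show ?thesis
    using False by (simp add: suminf_cmult_indicator del: of_nat_Suc)
qed

text \<open>Approach from the right makes the indicators converge at every time, including t itself;
  boundedness of f makes the total cost an integrable dominating function.\<close>

lemma remaining_cost_tendsto:
  assumes \<omega>: "\<omega> \<in> space M" and f: "f \<in> borel_measurable borel" "\<And>y. f y \<le> K" "0 \<le> K"
    and t: "\<And>n. t \<le> s n" "s \<longlonglongrightarrow> t" "0 \<le> t"
  shows "(\<lambda>n. remaining_cost f (ennreal (s n)) \<omega>) \<longlonglongrightarrow> remaining_cost f (ennreal t) \<omega>"
  unfolding remaining_cost_def
proof (rule nn_integral_dominated_convergence[where
    w="\<lambda>s. ennreal (f (X s \<omega>) * exp (- q * s)) * indicator {s. 0 \<le> s \<and> ennreal s \<le> \<top>} s"])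
  show "(\<integral>\<^sup>+ s. ennreal (f (X s \<omega>) * exp (- q * s)) * indicator {s. 0 \<le> s \<and> ennreal s \<le> \<top>} s \<partial>lborel) < \<infinity>"
    using le_less_trans[OF running_cost_bounded[of f K \<top> \<omega>, OF f(2,3)] ennreal_less_top]
    by (simp add: running_cost_def)
  show "AE x in lborel. (\<lambda>i. ennreal (f (X x \<omega>) * exp (- q * x)) * indicator {sa. 0 \<le> sa \<and> ennreal (s i) < ennreal sa} x)
     \<longlonglongrightarrow> ennreal (f (X x \<omega>) * exp (- q * x)) * indicator {s. 0 \<le> s \<and> ennreal t < ennreal s} x"
  proof (rule AE_I2, rule tendsto_eventually)
    fix x :: real
    have "\<forall>\<^sub>F i in sequentially. (0 \<le> x \<and> ennreal (s i) < ennreal x) = (0 \<le> x \<and> ennreal t < ennreal x)"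
    proof (cases "t < x")
      case True
      then have "\<forall>\<^sub>F i in sequentially. s i < x" using order_tendstoD(2)[OF t(2)] by simp
      then show ?thesis
        by eventually_elim (use t True order_trans[OF t(3) t(1)] in \<open>auto simp: ennreal_less_iff\<close>)
    next
      case False
      then have "\<not> s i < x" for i using t(1)[of i] by linarith
      then show ?thesis using False t order_trans[OF t(3) t(1)] by (simp add: ennreal_less_iff)
    qed
    then show "\<forall>\<^sub>F i in sequentially. ennreal (f (X x \<omega>) * exp (- q * x)) * indicator {sa. 0 \<le> sa \<and> ennreal (s i) < ennreal sa} x =
      ennreal (f (X x \<omega>) * exp (- q * x)) * indicator {s. 0 \<le> s \<and> ennreal t < ennreal s} x"
      by eventually_elim (simp add: indicator_def)
  qed
  show "(\<lambda>x. ennreal (f (X x \<omega>) * exp (- q * x)) * indicator {sa. 0 \<le> sa \<and> ennreal (s i) < ennreal sa} x)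
      \<in> borel_measurable lborel" for i
    unfolding measurable_lborel2 by (rule path_measurable_at[OF f(1) \<omega>]) measurable
  show "(\<lambda>x. ennreal (f (X x \<omega>) * exp (- q * x)) * indicator {s. 0 \<le> s \<and> ennreal t < ennreal s} x)
      \<in> borel_measurable lborel"
    unfolding measurable_lborel2 by (rule path_measurable_at[OF f(1) \<omega>]) measurable
  show "(\<lambda>x. ennreal (f (X x \<omega>) * exp (- q * x)) * indicator {s. 0 \<le> s \<and> ennreal s \<le> \<top>} x)
      \<in> borel_measurable lborel"
    unfolding measurable_lborel2 by (rule path_measurable_at[OF f(1) \<omega>]) simp
qed (auto simp: indicator_def)

lemma U_measurable_bounded:
  assumes f: "admissible f" "bounded (range f)" and Y: "Y \<in> borel_measurable M" "\<And>\<omega>. \<omega> \<in> space M \<Longrightarrow> Y \<omega> \<in> E"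
  shows "(\<lambda>\<omega>. U f (Y \<omega>)) \<in> borel_measurable M"
proof -
  have "(\<lambda>y. if y \<in> E then U f y else 0) \<in> borel_measurable borel"
    using U_continuous[OF f] by (intro borel_measurable_continuous_on_if) auto
  from measurable_compose[OF Y(1) this] show ?thesis
    by (rule measurable_cong[THEN iffD1, rotated]) (simp add: Y(2))
qed

text \<open>T is rounded up to the grid and the fixed-time identity is applied on each cell. As the
  mesh shrinks, the left side converges by right-continuity of the remaining cost, the right side by
  continuity of \<open>U f\<close> along the path; K / q dominates both.\<close>

lemma strong_markov_bounded:
  assumes y: "y \<in> E" and f: "admissible f" "bounded (range f)" and T: "optional_time T"
  shows "(\<integral>\<^sup>+ \<omega>. remaining_cost f (T \<omega>) \<omega> \<partial>P y) =
    (\<integral>\<^sup>+ \<omega>. ennreal (discount q (T \<omega>)) * U f (stopped X T \<omega>) \<partial>P y)"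
proof -
  interpret P: prob_space "P y" by (rule prob_space_P[OF y])
  obtain K where K: "0 \<le> K" "\<And>y. f y \<le> K" using f bounded_admissibleD by metis
  have fb: "f \<in> borel_measurable borel" using f(1) by (simp add: admissible_def)
  note Tm[measurable] = optional_measurable[OF T]
  have cm[measurable]: "cell T n k \<in> sets M" for n k by (rule cell_sets_M[OF T])
  have rm[measurable]: "(\<lambda>\<omega>. remaining_cost f (ennreal s) \<omega>) \<in> borel_measurable M" for s
    by (rule remaining_cost_measurable[OF fb]) simp
  have Um[measurable]: "(\<lambda>\<omega>. U f (X (grid n k) \<omega>)) \<in> borel_measurable M" for n k
    by (rule U_measurable_bounded[OF f]) (auto intro!: X_measurable in_state_space)
  let ?L = "\<lambda>n \<omega>. \<Sum>k. remaining_cost f (ennreal (grid n k)) \<omega> * indicator (cell T n k) \<omega>"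
  let ?R = "\<lambda>n \<omega>. \<Sum>k. (ennreal (exp (- q * grid n k)) * U f (X (grid n k) \<omega>)) * indicator (cell T n k) \<omega>"
  have eq: "(\<integral>\<^sup>+ \<omega>. ?L n \<omega> \<partial>P y) = (\<integral>\<^sup>+ \<omega>. ?R n \<omega> \<partial>P y)" for n
  proof -
    have "(\<integral>\<^sup>+ \<omega>. ?L n \<omega> \<partial>P y) = (\<Sum>k. \<integral>\<^sup>+ \<omega>. remaining_cost f (ennreal (grid n k)) \<omega> * indicator (cell T n k) \<omega> \<partial>P y)"
      by (rule nn_integral_suminf) (simp add: measurable_P[OF y])
    also have "\<dots> = (\<Sum>k. \<integral>\<^sup>+ \<omega>. (ennreal (exp (- q * grid n k)) * U f (X (grid n k) \<omega>)) * indicator (cell T n k) \<omega> \<partial>P y)"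
    proof (rule suminf_cong)
      fix k
      have "0 \<le> grid n k" by simp
      from markov_remaining_cost[OF y f this cell_sets[OF T]]
      show "(\<integral>\<^sup>+ \<omega>. remaining_cost f (ennreal (grid n k)) \<omega> * indicator (cell T n k) \<omega> \<partial>P y) =
        (\<integral>\<^sup>+ \<omega>. (ennreal (exp (- q * grid n k)) * U f (X (grid n k) \<omega>)) * indicator (cell T n k) \<omega> \<partial>P y)"
        by (simp only: mult.commute[of _ "indicator _ _"])
    qed
    also have "\<dots> = (\<integral>\<^sup>+ \<omega>. ?R n \<omega> \<partial>P y)"
      by (rule nn_integral_suminf[symmetric]) (simp only: measurable_P[OF y], measurable)
    finally show ?thesis .
  qed
  have "(\<lambda>n. \<integral>\<^sup>+ \<omega>. ?L n \<omega> \<partial>P y) \<longlonglongrightarrow> (\<integral>\<^sup>+ \<omega>. remaining_cost f (T \<omega>) \<omega> \<partial>P y)"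
  proof (rule nn_integral_dominated_convergence[where w="\<lambda>_. ennreal (K / q)"])
    show "(\<lambda>\<omega>. remaining_cost f (T \<omega>) \<omega>) \<in> borel_measurable (P y)"
      using remaining_cost_measurable[OF fb Tm] by (simp add: measurable_P[OF y])
    show "AE \<omega> in P y. ?L n \<omega> \<le> ennreal (K / q)" for n
    proof (rule AE_I2)
      fix \<omega> assume "\<omega> \<in> space (P y)"
      then have "\<omega> \<in> space M" by (simp add: space_P[OF y])
      then show "?L n \<omega> \<le> ennreal (K / q)"
        using order_trans[OF remaining_cost_le running_cost_bounded[OF K(2,1)]]
        by (simp add: suminf_cell)
    qed
    show "AE \<omega> in P y. (\<lambda>n. ?L n \<omega>) \<longlonglongrightarrow> remaining_cost f (T \<omega>) \<omega>"
    proof (rule AE_I2)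
      fix \<omega> assume "\<omega> \<in> space (P y)"
      then have \<omega>: "\<omega> \<in> space M" by (simp add: space_P[OF y])
      show "(\<lambda>n. ?L n \<omega>) \<longlonglongrightarrow> remaining_cost f (T \<omega>) \<omega>"
      proof (cases "T \<omega>")
        case (real t)
        let ?t = "\<lambda>n. (of_int \<lfloor>real (Suc n) * t\<rfloor> + 1) / real (Suc n)"
        have "t \<le> ?t n" for n
          proof -
    have "real (Suc n) * t \<le> of_int \<lfloor>real (Suc n) * t\<rfloor> + 1" by linarith
    then show ?thesis by (subst pos_le_divide_eq) (simp_all only: of_nat_0_less_iff zero_less_Suc mult.commute)
  qed
        then have "(\<lambda>n. remaining_cost f (ennreal (?t n)) \<omega>) \<longlonglongrightarrow> remaining_cost f (ennreal t) \<omega>"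
          using real by (intro remaining_cost_tendsto[OF \<omega> fb K(2,1)] grid_tendsto)
        then show ?thesis using real by (simp add: suminf_cell[OF \<omega>] del: of_nat_Suc)
      qed (simp add: suminf_cell[OF \<omega>] remaining_cost_def)
    qed
  qed (auto simp: measurable_P[OF y] P.emeasure_space_1)
  moreover have "(\<lambda>n. \<integral>\<^sup>+ \<omega>. ?R n \<omega> \<partial>P y) \<longlonglongrightarrow> (\<integral>\<^sup>+ \<omega>. ennreal (discount q (T \<omega>)) * U f (stopped X T \<omega>) \<partial>P y)"
  proof (rule nn_integral_dominated_convergence[where w="\<lambda>_. ennreal (K / q)"])
    show "(\<lambda>\<omega>. ?R n \<omega>) \<in> borel_measurable (P y)" for n
      by (simp only: measurable_P[OF y], measurable)
    have "(\<lambda>\<omega>. U f (stopped X T \<omega>)) \<in> borel_measurable M"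
      by (intro U_measurable_bounded[OF f] stopped_measurable[OF T] stopped_in_E)
    then show "(\<lambda>\<omega>. ennreal (discount q (T \<omega>)) * U f (stopped X T \<omega>)) \<in> borel_measurable (P y)"
      by (simp add: measurable_P[OF y])
    show "AE \<omega> in P y. ?R n \<omega> \<le> ennreal (K / q)" for n
    proof (rule AE_I2)
      fix \<omega> assume "\<omega> \<in> space (P y)"
      then have \<omega>: "\<omega> \<in> space M" by (simp add: space_P[OF y])
      have "ennreal (exp (- q * s)) * U f (X s \<omega>) \<le> 1 * ennreal (K / q)" if "0 \<le> s" for s
        using q_pos that by (intro mult_mono U_bounded K in_state_space \<omega>) (auto simp: ennreal_le_1)
      from this[of "grid n (nat \<lfloor>real (Suc n) * enn2real (T \<omega>)\<rfloor>)"]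
      show "?R n \<omega> \<le> ennreal (K / q)"
        by (simp add: suminf_cell[OF \<omega>] del: of_nat_Suc)
    qed
    show "AE \<omega> in P y. (\<lambda>n. ?R n \<omega>) \<longlonglongrightarrow> ennreal (discount q (T \<omega>)) * U f (stopped X T \<omega>)"
    proof (rule AE_I2)
      fix \<omega> assume "\<omega> \<in> space (P y)"
      then have \<omega>: "\<omega> \<in> space M" by (simp add: space_P[OF y])
      show "(\<lambda>n. ?R n \<omega>) \<longlonglongrightarrow> ennreal (discount q (T \<omega>)) * U f (stopped X T \<omega>)"
      proof (cases "T \<omega>")
        case (real t)
        let ?t = "\<lambda>n. (of_int \<lfloor>real (Suc n) * t\<rfloor> + 1) / real (Suc n)"
        have t0: "0 \<le> ?t n" for n using real by (simp del: of_nat_Suc)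
        have "(\<lambda>n. X (?t n) \<omega>) \<longlonglongrightarrow> X t \<omega>"
          using t0 real by (intro continuous_on_tendsto_compose[OF continuous_paths[OF \<omega>] grid_tendsto]) auto
        then have "(\<lambda>n. U f (X (?t n) \<omega>)) \<longlonglongrightarrow> U f (X t \<omega>)"
          using t0 real by (intro continuous_on_tendsto_compose[OF U_continuous[OF f]])
               (simp_all add: in_state_space[OF \<omega>] del: of_nat_Suc)
        moreover have "(\<lambda>n. ennreal (exp (- q * ?t n))) \<longlonglongrightarrow> ennreal (exp (- q * t))"
          by (intro tendsto_intros tendsto_ennrealI grid_tendsto)
        ultimately have "(\<lambda>n. ennreal (exp (- q * ?t n)) * U f (X (?t n) \<omega>)) \<longlonglongrightarrow> ennreal (exp (- q * t)) * U f (X t \<omega>)"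
          using U_finite[OF in_state_space[OF \<omega> real(1)] f] by (intro tendsto_mult_ennreal) auto
        then show ?thesis using real
          by (simp add: suminf_cell[OF \<omega>] discount_def stopped_def del: of_nat_Suc)
      qed (simp add: suminf_cell[OF \<omega>])
    qed
  qed (auto simp: measurable_P[OF y] P.emeasure_space_1)
  ultimately show ?thesis
    unfolding eq by (rule LIMSEQ_unique)
qed

section \<open>Truncation: from bounded to arbitrary nonnegative functions\<close>

definition trunc :: "(real \<Rightarrow> real) \<Rightarrow> nat \<Rightarrow> real \<Rightarrow> real" where
  "trunc f n y = min (f y) (real n)"

lemma trunc_admissible:
  assumes f: "admissible f"
  shows "admissible (trunc f n)" "bounded (range (trunc f n))"
proof -
  show "admissible (trunc f n)"
    using f unfolding admissible_def trunc_def by (auto intro!: continuous_intros borel_measurable_min)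
  have "norm (trunc f n y) \<le> real n" for y
    using f by (auto simp: admissible_def trunc_def abs_le_iff min_def)
  then show "bounded (range (trunc f n))" by (auto simp: bounded_iff)
qed

lemma trunc_tendsto: "(\<lambda>n. trunc f n y) \<longlonglongrightarrow> f y"
proof (rule tendsto_eventually)
  obtain N where "f y \<le> real N" using real_arch_simple by blast
  then show "\<forall>\<^sub>F n in sequentially. trunc f n y = f y"
    by (intro eventually_sequentiallyI[of N]) (auto simp: trunc_def)
qed

lemma trunc_mono: "n \<le> m \<Longrightarrow> trunc f n y \<le> trunc f m y"
  by (auto simp: trunc_def)

lemma cost_integral_trunc:
  assumes f: "admissible f" and \<omega>: "\<omega> \<in> space M" and Q: "Measurable.pred borel Q"
  defines "I \<equiv> \<lambda>f. \<integral>\<^sup>+ s. ennreal (f (X s \<omega>) * exp (- q * s)) * indicator {s. 0 \<le> s \<and> Q s} s \<partial>lborel"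
  shows "(\<lambda>n. I (trunc f n)) \<longlonglongrightarrow> I f" "incseq (\<lambda>n. I (trunc f n))"
proof -
  have mono: "ennreal (trunc f n (X s \<omega>) * exp (- q * s)) * indicator {s. 0 \<le> s \<and> Q s} s
      \<le> ennreal (trunc f m (X s \<omega>) * exp (- q * s)) * indicator {s. 0 \<le> s \<and> Q s} s" if "n \<le> m" for n m s
    by (intro mult_right_mono ennreal_leI trunc_mono that) auto
  show "incseq (\<lambda>n. I (trunc f n))"
    unfolding I_def by (intro incseq_SucI nn_integral_mono mono) simp
  show "(\<lambda>n. I (trunc f n)) \<longlonglongrightarrow> I f"
    unfolding I_def
  proof (rule nn_integral_LIMSEQ)
    show "incseq (\<lambda>n s. ennreal (trunc f n (X s \<omega>) * exp (- q * s)) * indicator {s. 0 \<le> s \<and> Q s} s)"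
      by (intro incseq_SucI le_funI mono) simp
    show "(\<lambda>s. ennreal (trunc f n (X s \<omega>) * exp (- q * s)) * indicator {s. 0 \<le> s \<and> Q s} s) \<in> borel_measurable lborel" for n
      unfolding measurable_lborel2
      by (rule path_measurable_at[OF _ \<omega> Q]) (use trunc_admissible(1)[OF f] in \<open>simp add: admissible_def\<close>)
    fix s :: real
    have "(\<lambda>n. ennreal (trunc f n (X s \<omega>) * exp (- q * s))) \<longlonglongrightarrow> ennreal (f (X s \<omega>) * exp (- q * s))"
      by (intro tendsto_ennrealI tendsto_intros trunc_tendsto)
    then show "(\<lambda>n. ennreal (trunc f n (X s \<omega>) * exp (- q * s)) * indicator {s. 0 \<le> s \<and> Q s} s) \<longlonglongrightarrow>
        ennreal (f (X s \<omega>) * exp (- q * s)) * indicator {s. 0 \<le> s \<and> Q s} s"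
      by (auto simp: indicator_def)
  qed
qed

lemma U_trunc:
  assumes f: "admissible f" and y: "y \<in> E"
  shows "(\<lambda>n. U (trunc f n) y) \<longlonglongrightarrow> U f y" "incseq (\<lambda>n. U (trunc f n) y)"
proof -
  have tr: "(\<lambda>n. running_cost X q (trunc f n) \<top> \<omega>) \<longlonglongrightarrow> running_cost X q f \<top> \<omega>"
    "incseq (\<lambda>n. running_cost X q (trunc f n) \<top> \<omega>)" if "\<omega> \<in> space M" for \<omega>
    unfolding running_cost_def by (rule cost_integral_trunc[OF f that]; measurable)+
  have "U (trunc f n) y \<le> U (trunc f (Suc n)) y" for n
    unfolding total_cost_def by (intro nn_integral_mono incseq_SucD[OF tr(2)]) (simp add: space_P[OF y])
  then show "incseq (\<lambda>n. U (trunc f n) y)" by (rule incseq_SucI)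
  \<comment> \<open>The monotone convergence theorem asks for convergence at every point, and the
    paths are controlled only on \<open>space M\<close>; hence the indicator.\<close>
  have "(\<lambda>n. \<integral>\<^sup>+ \<omega>. running_cost X q (trunc f n) \<top> \<omega> * indicator (space M) \<omega> \<partial>P y) \<longlonglongrightarrow>
      (\<integral>\<^sup>+ \<omega>. running_cost X q f \<top> \<omega> * indicator (space M) \<omega> \<partial>P y)"
  proof (rule nn_integral_LIMSEQ)
    show "incseq (\<lambda>n \<omega>. running_cost X q (trunc f n) \<top> \<omega> * indicator (space M) \<omega>)"
      by (intro incseq_SucI le_funI) (auto simp: indicator_def intro: incseq_SucD[OF tr(2)])
    show "(\<lambda>\<omega>. running_cost X q (trunc f n) \<top> \<omega> * indicator (space M) \<omega>) \<in> borel_measurable (P y)" for n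
      using running_cost_measurable[of "trunc f n" "\<lambda>_. \<top>"] trunc_admissible(1)[OF f, of n]
      by (simp add: measurable_P[OF y] admissible_def)
  qed (auto simp: indicator_def intro: tr)
  moreover have "(\<integral>\<^sup>+ \<omega>. running_cost X q f \<top> \<omega> * indicator (space M) \<omega> \<partial>P y) = U f y" for f
    unfolding total_cost_def by (intro nn_integral_cong) (simp add: space_P[OF y])
  ultimately show "(\<lambda>n. U (trunc f n) y) \<longlonglongrightarrow> U f y" by simp
qed

text \<open>An unbounded f has \<open>U f\<close> as an increasing limit of continuous potentials,
  which preserves measurability.\<close>

lemma U_measurable:
  assumes f: "admissible f" and Y: "Y \<in> borel_measurable M" "\<And>\<omega>. \<omega> \<in> space M \<Longrightarrow> Y \<omega> \<in> E"
  shows "(\<lambda>\<omega>. U f (Y \<omega>)) \<in> borel_measurable M"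
proof -
  have "(\<lambda>\<omega>. SUP n. U (trunc f n) (Y \<omega>)) \<in> borel_measurable M"
    by (intro borel_measurable_SUP U_measurable_bounded trunc_admissible f Y) auto
  then show ?thesis
  proof (rule measurable_cong[THEN iffD1, rotated])
    fix \<omega> assume "\<omega> \<in> space M"
    then show "(SUP n. U (trunc f n) (Y \<omega>)) = U f (Y \<omega>)"
      using LIMSEQ_unique[OF LIMSEQ_SUP[OF U_trunc(2)] U_trunc(1)] f Y(2) by blast
  qed
qed

text \<open>Both sides increase along the truncations, so the bounded case passes to the
  limit.\<close>

lemma strong_markov:
  assumes y: "y \<in> E" and f: "admissible f" and T: "optional_time T"
  shows "(\<integral>\<^sup>+ \<omega>. remaining_cost f (T \<omega>) \<omega> \<partial>P y) =
    (\<integral>\<^sup>+ \<omega>. ennreal (discount q (T \<omega>)) * U f (stopped X T \<omega>) \<partial>P y)"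
proof (rule LIMSEQ_unique)
  note Tm[measurable] = optional_measurable[OF T]
  have tr: "(\<lambda>n. remaining_cost (trunc f n) t \<omega>) \<longlonglongrightarrow> remaining_cost f t \<omega>"
    "incseq (\<lambda>n. remaining_cost (trunc f n) t \<omega>)" if "\<omega> \<in> space M" for \<omega> t
    unfolding remaining_cost_def by (rule cost_integral_trunc[OF f that]; measurable)+
  have eq: "(\<integral>\<^sup>+ \<omega>. k \<omega> * indicator (space M) \<omega> \<partial>P y) = (\<integral>\<^sup>+ \<omega>. k \<omega> \<partial>P y)" for k
    by (intro nn_integral_cong) (simp add: space_P[OF y])
  have "(\<lambda>n. \<integral>\<^sup>+ \<omega>. remaining_cost (trunc f n) (T \<omega>) \<omega> * indicator (space M) \<omega> \<partial>P y) \<longlonglongrightarrow>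
      (\<integral>\<^sup>+ \<omega>. remaining_cost f (T \<omega>) \<omega> * indicator (space M) \<omega> \<partial>P y)"
  proof (rule nn_integral_LIMSEQ)
    show "incseq (\<lambda>n \<omega>. remaining_cost (trunc f n) (T \<omega>) \<omega> * indicator (space M) \<omega>)"
      by (intro incseq_SucI le_funI) (auto simp: indicator_def intro: incseq_SucD[OF tr(2)])
    show "(\<lambda>\<omega>. remaining_cost (trunc f n) (T \<omega>) \<omega> * indicator (space M) \<omega>) \<in> borel_measurable (P y)" for n
      using remaining_cost_measurable[OF _ Tm, of "trunc f n"] trunc_admissible(1)[OF f, of n]
      by (simp add: measurable_P[OF y] admissible_def)
  qed (auto simp: indicator_def intro: tr)
  then show "(\<lambda>n. \<integral>\<^sup>+ \<omega>. remaining_cost (trunc f n) (T \<omega>) \<omega> \<partial>P y) \<longlonglongrightarrow>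
      (\<integral>\<^sup>+ \<omega>. remaining_cost f (T \<omega>) \<omega> \<partial>P y)"
    by (simp only: eq)
  have "(\<lambda>n. \<integral>\<^sup>+ \<omega>. ennreal (discount q (T \<omega>)) * U (trunc f n) (stopped X T \<omega>) * indicator (space M) \<omega> \<partial>P y) \<longlonglongrightarrow>
      (\<integral>\<^sup>+ \<omega>. ennreal (discount q (T \<omega>)) * U f (stopped X T \<omega>) * indicator (space M) \<omega> \<partial>P y)"
  proof (rule nn_integral_LIMSEQ)
    show "incseq (\<lambda>n \<omega>. ennreal (discount q (T \<omega>)) * U (trunc f n) (stopped X T \<omega>) * indicator (space M) \<omega>)"
      by (intro incseq_SucI le_funI) (auto simp: indicator_def intro!: mult_left_mono incseq_SucD[OF U_trunc(2)] f stopped_in_E)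
    have "(\<lambda>\<omega>. U (trunc f n) (stopped X T \<omega>)) \<in> borel_measurable M" for n
      by (intro U_measurable trunc_admissible f stopped_measurable T stopped_in_E)
    then show "(\<lambda>\<omega>. ennreal (discount q (T \<omega>)) * U (trunc f n) (stopped X T \<omega>) * indicator (space M) \<omega>) \<in> borel_measurable (P y)" for n
      by (simp add: measurable_P[OF y])
    show "(\<lambda>n. ennreal (discount q (T \<omega>)) * U (trunc f n) (stopped X T \<omega>) * indicator (space M) \<omega>) \<longlonglongrightarrow>
        ennreal (discount q (T \<omega>)) * U f (stopped X T \<omega>) * indicator (space M) \<omega>" for \<omega>
      by (auto simp: indicator_def intro!: ennreal_tendsto_cmult U_trunc(1) f stopped_in_E)
  qed
  then have "(\<lambda>n. \<integral>\<^sup>+ \<omega>. ennreal (discount q (T \<omega>)) * U (trunc f n) (stopped X T \<omega>) \<partial>P y) \<longlonglongrightarrow>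
      (\<integral>\<^sup>+ \<omega>. ennreal (discount q (T \<omega>)) * U f (stopped X T \<omega>) \<partial>P y)"
    by (simp only: eq)
  then show "(\<lambda>n. \<integral>\<^sup>+ \<omega>. remaining_cost (trunc f n) (T \<omega>) \<omega> \<partial>P y) \<longlonglongrightarrow>
      (\<integral>\<^sup>+ \<omega>. ennreal (discount q (T \<omega>)) * U f (stopped X T \<omega>) \<partial>P y)"
    by (simp only: strong_markov_bounded[OF y trunc_admissible[OF f] T])
qed

lemma dynkin:
  assumes y: "y \<in> E" and f: "admissible f" and T: "optional_time T"
  shows "U f y = (\<integral>\<^sup>+ \<omega>. running_cost X q f (T \<omega>) \<omega> \<partial>P y) +
    (\<integral>\<^sup>+ \<omega>. ennreal (discount q (T \<omega>)) * U f (stopped X T \<omega>) \<partial>P y)"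
proof -
  have fb: "f \<in> borel_measurable borel" using f by (simp add: admissible_def)
  have "U f y = (\<integral>\<^sup>+ \<omega>. running_cost X q f (T \<omega>) \<omega> + remaining_cost f (T \<omega>) \<omega> \<partial>P y)"
    unfolding total_cost_def
    by (intro nn_integral_cong running_plus_remaining_cost fb) (simp add: space_P[OF y])
  also have "\<dots> = (\<integral>\<^sup>+ \<omega>. running_cost X q f (T \<omega>) \<omega> \<partial>P y) + (\<integral>\<^sup>+ \<omega>. remaining_cost f (T \<omega>) \<omega> \<partial>P y)"
    using running_cost_measurable[OF fb optional_measurable[OF T]] remaining_cost_measurable[OF fb optional_measurable[OF T]]
    by (intro nn_integral_add) (simp_all add: measurable_P[OF y])
  finally show ?thesis by (simp add: strong_markov[OF y f T])
qed

lemma U_excessive: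
  assumes "y \<in> E" "admissible f" "optional_time T"
  shows "(\<integral>\<^sup>+ \<omega>. ennreal (discount q (T \<omega>)) * U f (stopped X T \<omega>) \<partial>P y) \<le> U f y"
  unfolding dynkin[OF assms] by simp

section \<open>Monotone harmonic functions\<close>

lemma optional_exit_interval:
  assumes "B \<in> intervals l r y"
  shows "optional_time (exit_time X B)"
  by (rule intervalsE[OF assms]) (rule optional_exit_time)

lemma exit_measurable[measurable]:
  assumes "B \<in> intervals l r y"
  shows "exit_time X B \<in> borel_measurable M"
  by (rule optional_measurable[OF optional_exit_interval[OF assms]])

lemma integrable_discount:
  assumes y: "y \<in> E" and T[measurable]: "T \<in> borel_measurable M"
  shows "integrable (P y) (\<lambda>\<omega>. discount q (T \<omega>))"
proof -
  interpret prob_space "P y" by (rule prob_space_P[OF y])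
  show ?thesis
    using q_pos by (intro integrable_const_bound[of _ 1]) (simp_all add: measurable_P[OF y] discount_le_1)
qed

lemma phi_eq_nn_integral:
  assumes y: "y \<in> E" and T[measurable]: "exit_time X B \<in> borel_measurable M"
  shows "ennreal (phi P X q B y) = (\<integral>\<^sup>+ \<omega>. ennreal (discount q (exit_time X B \<omega>)) \<partial>P y)"
  unfolding phi_def by (intro nn_integral_eq_integral[symmetric] integrable_discount y) auto

lemma phi_nonneg: "0 \<le> phi P X q B y"
  by (simp add: phi_def)

lemma phi_le_1:
  assumes y: "y \<in> E"
  shows "phi P X q B y \<le> 1"
proof -
  interpret prob_space "P y" by (rule prob_space_P[OF y])
  show ?thesis
  proof (cases "integrable (P y) (\<lambda>\<omega>. discount q (exit_time X B \<omega>))")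
    case True
    then show ?thesis unfolding phi_def using q_pos by (intro integral_le_const) (simp_all add: discount_le_1)
  qed (simp add: phi_def not_integrable_integral_eq)
qed

text \<open>Strictness comes from the exit time being positive. It later separates the two harmonic
  functions on either side of x.\<close>

lemma phi_less_1:
  assumes B: "B \<in> intervals l r y"
  shows "phi P X q B y < 1"
proof -
  have y: "y \<in> E" using intervalsE[OF B] by metis
  interpret prob_space "P y" by (rule prob_space_P[OF y])
  show ?thesis unfolding phi_def
  proof (rule expectation_less)
    show "AE \<omega> in P y. discount q (exit_time X B \<omega>) < 1"
      using AE_exit_pos[OF B]
    proof eventually_elim
      case (elim \<omega>)
      then show ?case using q_pos
        by (cases "exit_time X B \<omega>") (auto simp: discount_def zero_less_iff_neq_zero)
    qed
  qed (rule integrable_discount[OF y exit_measurable[OF B]])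
qed

text \<open>No cost accumulates before the exit because f vanishes on B, so the first term of
  \<open>dynkin\<close> is zero: \<open>U f\<close> is q-harmonic in B.\<close>

lemma exit_identity:
  assumes B: "B \<in> intervals l r y" and f: "admissible f" and zero: "\<And>z. z \<in> B \<Longrightarrow> f z = 0"
  shows "U f y = (\<integral>\<^sup>+ \<omega>. ennreal (discount q (exit_time X B \<omega>)) * U f (stopped X (exit_time X B) \<omega>) \<partial>P y)"
proof -
  have "running_cost X q f (exit_time X B \<omega>) \<omega> = 0" for \<omega>
  proof -
    \<comment> \<open>\<open>inside_before_exit\<close> covers only times strictly between 0 and the
      exit; the two end times form a null set.\<close>
    have "AE t in lborel. ennreal (f (X t \<omega>) * exp (- q * t)) * indicator {t. 0 \<le> t \<and> ennreal t \<le> exit_time X B \<omega>} t = 0"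
      using AE_lborel_singleton[of 0] AE_lborel_singleton[of "enn2real (exit_time X B \<omega>)"]
    proof eventually_elim
      case (elim t)
      show ?case
      proof (cases "0 < t \<and> ennreal t < exit_time X B \<omega>")
        case True
        then have "f (X t \<omega>) = 0" by (intro zero inside_before_exit) auto
        then show ?thesis by simp
      next
        case False
        then have "\<not> (0 \<le> t \<and> ennreal t \<le> exit_time X B \<omega>)"
          using elim by (auto simp: le_less) (metis enn2real_ennreal less_imp_le)
        then show ?thesis by simp
      qed
    qed
    then show ?thesis
      unfolding running_cost_def by (subst nn_integral_cong_AE) auto
  qed
  moreover have "y \<in> E" using intervalsE[OF B] by metis
  ultimately show ?thesis
    using dynkin[OF _ f optional_exit_interval[OF B], of y] by simp
qed

text \<open>Zero up to c in direction s and positive beyond, so its potential is harmonic before c.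
  A continuous substitute for an indicator, as \<open>feller\<close> requires, and capped at 1 so
  that the potential is finite.\<close>

definition ramp :: "real \<Rightarrow> real \<Rightarrow> real \<Rightarrow> real" where
  "ramp s c y = min 1 (max 0 (s * (y - c)))"

lemma ramp_admissible: "admissible (ramp s c)" "bounded (range (ramp s c))"
proof -
  have "continuous_on A (ramp s c)" for A
    unfolding ramp_def by (intro continuous_intros)
  then show "admissible (ramp s c)"
    by (auto simp: admissible_def ramp_def intro: borel_measurable_continuous_onI)
  show "bounded (range (ramp s c))" by (auto simp: bounded_iff ramp_def intro!: exI[of _ 1])
qed

abbreviation v :: "real \<Rightarrow> real \<Rightarrow> real \<Rightarrow> real" where
  "v s c \<equiv> delta P X q (ramp s c)"

lemma v_nonneg: "0 \<le> v s c y"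
  by (simp add: delta_def)

lemma v_eq: "y \<in> E \<Longrightarrow> ennreal (v s c y) = U (ramp s c) y"
  using U_finite[OF _ ramp_admissible] by (simp add: delta_def)

lemma v_tendsto: "y \<in> E \<Longrightarrow> (v s c \<longlongrightarrow> v s c y) (at y within E)"
  unfolding delta_def using U_continuous[OF ramp_admissible, of s c] U_finite[OF _ ramp_admissible, of y s c]
  by (intro tendsto_enn2real) (auto simp: continuous_on_def less_top[symmetric])

lemma E_beyond:
  assumes "c \<in> E" "s = 1 \<or> s = - 1"
  obtains z where "z \<in> E" "s * c < s * z"
proof -
  obtain e where e: "0 < e" "ball c e \<subseteq> E"
    using open_state_space[of l r] assms(1) by (metis openE)
  have "c + s * (e / 2) \<in> ball c e" using e assms(2) by (auto simp: dist_real_def)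
  then have "c + s * (e / 2) \<in> E" using e(2) by blast
  then show ?thesis by (rule that) (use e assms(2) in auto)
qed

lemma running_cost_zero_imp:
  assumes \<omega>: "\<omega> \<in> space M" and f: "admissible f" and zero: "running_cost X q f \<top> \<omega> = 0" and t: "0 < t"
  shows "f (X t \<omega>) = 0"
proof (rule ccontr)
  assume "f (X t \<omega>) \<noteq> 0"
  then have pos: "0 < f (X t \<omega>)" using f by (metis admissible_def less_eq_real_def)
  have fb: "f \<in> borel_measurable borel" using f by (simp add: admissible_def)
  have "(\<lambda>s. ennreal (f (X s \<omega>) * exp (- q * s)) * indicator {s. 0 \<le> s \<and> ennreal s \<le> \<top>} s) \<in> borel_measurable borel"
    by (rule path_measurable_at[OF fb \<omega>]) simp
  then have AE0: "AE s in lborel. ennreal (f (X s \<omega>) * exp (- q * s)) * indicator {s. 0 \<le> s \<and> ennreal s \<le> \<top>} s = 0"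
    using zero unfolding running_cost_def by (subst (asm) nn_integral_0_iff_AE) (simp_all only: measurable_lborel2)
  have "continuous_on {0..} (\<lambda>s. f (X s \<omega>))" using continuous_X[OF f \<omega>, of 0] by simp
  then have "((\<lambda>s. f (X s \<omega>)) \<longlongrightarrow> f (X t \<omega>)) (at t within {0..})"
    using t by (simp add: continuous_on_def)
  then have "\<forall>\<^sub>F s in at t within {0..}. 0 < f (X s \<omega>)"
    using pos by (rule order_tendstoD(1))
  then obtain e where e: "0 < e" "\<And>s. 0 \<le> s \<Longrightarrow> s \<noteq> t \<Longrightarrow> dist s t < e \<Longrightarrow> 0 < f (X s \<omega>)"
    unfolding eventually_at by auto
  obtain N where N: "N \<in> null_sets lborel"
    "{s. ennreal (f (X s \<omega>) * exp (- q * s)) * indicator {s. 0 \<le> s \<and> ennreal s \<le> \<top>} s \<noteq> 0} \<subseteq> N"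
    using AE0 by (auto elim!: AE_E simp: null_sets_def)
  have "{t<..<t + e} \<subseteq> N"
  proof
    fix s assume s: "s \<in> {t<..<t + e}"
    then have "0 < f (X s \<omega>)" using t by (intro e) (auto simp: dist_real_def)
    then show "s \<in> N" using s t by (intro subsetD[OF N(2)]) (auto simp: indicator_def)
  qed
  then have "emeasure lborel {t<..<t + e} \<le> emeasure lborel N"
    using N by (intro emeasure_mono) auto
  then show False using e N by (simp add: null_sets_def ennreal_eq_0_iff)
qed

lemma AE_hitting_imp_contradiction:
  assumes "y \<in> E" "z \<in> E" "AE \<omega> in P y. hitting_time X z \<omega> = \<top>"
  shows False
proof -
  let ?A = "{\<omega> \<in> space (P y). hitting_time X z \<omega> < \<top>}"
  have pos: "measure (P y) ?A > 0" using regular assms by blast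
  \<comment> \<open>A set outside the sigma-algebra has \<open>measure\<close> 0, so positive
    measure already implies measurability.\<close>
  then have A: "?A \<in> sets (P y)" using measure_notin_sets by force
  moreover have "AE \<omega> in P y. \<omega> \<notin> ?A"
    using assms(3) by eventually_elim simp
  ultimately have "emeasure (P y) ?A = 0" by (subst emeasure_eq_AE[of _ "{}"]) auto
  with pos show False by (simp add: measure_def)
qed

lemma hitting_time_eq_top:
  assumes "\<And>t. 0 < t \<Longrightarrow> X t \<omega> \<noteq> z"
  shows "hitting_time X z \<omega> = \<top>"
proof -
  have *: "{ennreal t |t. 0 < t \<and> X t \<omega> = z} = {}" using assms by auto
  show ?thesis unfolding hitting_time_def * by simp
qed

text \<open>By regularity a point z beyond c is reached with positive probability, and there the
  ramp is positive. A vanishing potential would mean that almost no path ever visits z.\<close>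

lemma v_pos:
  assumes y: "y \<in> E" and c: "c \<in> E" and s: "s = 1 \<or> s = - 1"
  shows "0 < v s c y"
proof (rule ccontr)
  assume "\<not> 0 < v s c y"
  then have "v s c y = 0" using v_nonneg[of s c y] by linarith
  then have "U (ramp s c) y = 0" using v_eq[OF y, of s c] by simp
  moreover have "(\<lambda>\<omega>. running_cost X q (ramp s c) \<top> \<omega>) \<in> borel_measurable M"
    using running_cost_measurable[of "ramp s c" "\<lambda>_. \<top>"] ramp_admissible(1)[of s c] by (simp add: admissible_def)
  ultimately have AE0: "AE \<omega> in P y. running_cost X q (ramp s c) \<top> \<omega> = 0"
    unfolding total_cost_def by (simp add: nn_integral_0_iff_AE measurable_P[OF y])
  obtain z where z: "z \<in> E" "s * c < s * z" by (rule E_beyond[OF c s])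
  then have rz: "ramp s c z \<noteq> 0" by (auto simp: ramp_def right_diff_distrib)
  have "AE \<omega> in P y. hitting_time X z \<omega> = \<top>"
    using AE0 AE_space[of "P y"]
  proof eventually_elim
    case (elim \<omega>)
    then show ?case
      using running_cost_zero_imp[OF _ ramp_admissible(1), of \<omega> s c] rz
      by (intro hitting_time_eq_top) (auto simp: space_P[OF y])
  qed
  with y z(1) show False by (rule AE_hitting_imp_contradiction)
qed

text \<open>The potential is harmonic in the half line, and the exit position is always z, so its
  value there comes out of the expectation.\<close>

lemma v_exit:
  assumes z: "z \<in> E" and s: "s = 1 \<or> s = - 1" and y: "y \<in> half_line s z" and c: "s * z \<le> s * c"
  shows "v s c y = phi P X q (half_line s z) y * v s c z"
proof -
  let ?B = "half_line s z"
  have B: "?B \<in> intervals l r y" by (rule half_line_interval[OF z s y])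
  have yE: "y \<in> E" using y by (simp add: half_line_def)
  have "ennreal (v s c y) = (\<integral>\<^sup>+ \<omega>. ennreal (discount q (exit_time X ?B \<omega>)) * U (ramp s c) (stopped X (exit_time X ?B) \<omega>) \<partial>P y)"
    unfolding v_eq[OF yE]
    by (intro exit_identity[OF B] ramp_admissible) (use c in \<open>auto simp: ramp_def half_line_def right_diff_distrib\<close>)
  also have "\<dots> = (\<integral>\<^sup>+ \<omega>. ennreal (discount q (exit_time X ?B \<omega>)) * ennreal (v s c z) \<partial>P y)"
    by (intro nn_integral_cong_AE, use AE_exit_half_line[OF z s y] in eventually_elim)
       (auto simp: v_eq[OF z] discount_def)
  also have "\<dots> = ennreal (phi P X q ?B y) * ennreal (v s c z)"
    using exit_measurable[OF B] by (simp add: nn_integral_multc measurable_P[OF yE] phi_eq_nn_integral[OF yE])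
  finally show ?thesis
    by (simp add: ennreal_mult[symmetric] phi_nonneg v_nonneg)
qed

text \<open>By \<open>v_exit\<close> the quotient of the values at y and z is a Laplace transform in
  which the start of the ramp does not occur.\<close>

lemma v_cross:
  assumes s: "s = 1 \<or> s = - 1" and E: "y \<in> E" "z \<in> E"
    and c: "s * y \<le> s * c" "s * z \<le> s * c" "s * y \<le> s * c'" "s * z \<le> s * c'"
  shows "v s c y * v s c' z = v s c z * v s c' y"
proof -
  have *: "v s c y * v s c' z = v s c z * v s c' y"
    if "y \<in> E" "z \<in> E" "s * z \<le> s * c" "s * z \<le> s * c'" "s * y < s * z" for y z
    using v_exit[of z s y c] v_exit[of z s y c'] that s by (simp add: half_line_def)
  show ?thesis
  proof (cases "s * y" "s * z" rule: linorder_cases)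
    case equal
    then have "y = z" using s by auto
    then show ?thesis by simp
  qed (use *[of y z] *[of z y] E c in \<open>simp_all add: mult.commute\<close>)
qed

text \<open>The functions \<open>\<psi>\<close> (\<open>s = 1\<close>) and \<open>\<phi>\<close> (\<open>s = -1\<close>), normalised at \<open>x\<close>. By \<open>v_cross\<close> any \<open>c\<close> beyond both
  points gives the same quotient.\<close>

definition harm :: "real \<Rightarrow> real \<Rightarrow> real \<Rightarrow> real" where
  "harm s x y = (let c = (if s * x \<le> s * y then y else x) in v s c y / v s c x)"

lemma harm_eq:
  assumes s: "s = 1 \<or> s = - 1" and E: "x \<in> E" "y \<in> E" "c \<in> E" and c: "s * x \<le> s * c" "s * y \<le> s * c"
  shows "harm s x y = v s c y / v s c x"
proof -
  let ?c = "if s * x \<le> s * y then y else x"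
  have "?c \<in> E" using E by simp
  then have pos: "v s ?c x > 0" "v s c x > 0" using v_pos s E by auto
  have "v s ?c y * v s c x = v s ?c x * v s c y"
    by (rule v_cross[OF s]) (use E c in auto)
  then show ?thesis using pos unfolding harm_def Let_def by (simp add: field_simps)
qed

lemma harm_pos: "s = 1 \<or> s = - 1 \<Longrightarrow> x \<in> E \<Longrightarrow> y \<in> E \<Longrightarrow> 0 < harm s x y"
  unfolding harm_def Let_def by (intro divide_pos_pos v_pos) auto

lemma harm_self: "s = 1 \<or> s = - 1 \<Longrightarrow> x \<in> E \<Longrightarrow> harm s x x = 1"
  using harm_pos[of s x x] by (auto simp: harm_def Let_def)

text \<open>With the ramp started at x the quotient is the Laplace transform of the passage from y
  to x.\<close>

lemma harm_less_1:
  assumes s: "s = 1 \<or> s = - 1" and E: "x \<in> E" "y \<in> E" and less: "s * y < s * x"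
  shows "harm s x y < 1"
proof -
  have y: "y \<in> half_line s x" using E less by (simp add: half_line_def)
  have "harm s x y = v s x y / v s x x" by (rule harm_eq) (use assms in auto)
  also have "\<dots> = phi P X q (half_line s x) y"
    using v_exit[OF E(1) s y, of x] v_pos[OF E(1) E(1) s] by simp
  finally show ?thesis using phi_less_1[OF half_line_interval[OF E(1) s y]] by simp
qed

text \<open>The classical formula E_x(exp(-q T_y)) = \<psi> x / \<psi> y (for s = -1 with \<phi>),
  where the numerator is normalised to 1.\<close>

lemma phi_half_line:
  assumes s: "s = 1 \<or> s = - 1" and E: "x \<in> E" "y \<in> E" and less: "s * x < s * y"
  shows "phi P X q (half_line s y) x * harm s x y = 1"
proof -
  have x: "x \<in> half_line s y" using E less by (simp add: half_line_def)
  have harm: "harm s x y = v s y y / v s y x" by (rule harm_eq) (use assms in auto)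
  show ?thesis
    unfolding harm times_divide_eq_right v_exit[OF E(2) s x order_refl, symmetric] using v_pos[OF E s] by simp
qed

lemma harm_greater_1:
  assumes s: "s = 1 \<or> s = - 1" and E: "x \<in> E" "y \<in> E" and less: "s * x < s * y"
  shows "1 < harm s x y"
proof -
  have x: "x \<in> half_line s y" using E less by (simp add: half_line_def)
  have "phi P X q (half_line s y) x * harm s x y < 1 * harm s x y"
    by (intro mult_strict_right_mono phi_less_1[OF half_line_interval[OF E(2) s x]] harm_pos s E)
  then show ?thesis using phi_half_line[OF assms] by simp
qed

text \<open>The ramp used in \<open>harm\<close> moves with y, but near x one fixed c beyond x
  represents all values, so continuity of its potential is enough.\<close>

lemma harm_tendsto:
  assumes s: "s = 1 \<or> s = - 1" and x: "x \<in> E"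
  shows "(harm s x \<longlongrightarrow> 1) (at x within E)"
proof -
  obtain c where c: "c \<in> E" "s * x < s * c" by (rule E_beyond[OF x s])
  have "((\<lambda>y. v s c y / v s c x) \<longlongrightarrow> v s c x / v s c x) (at x within E)"
    using v_pos[OF x c(1) s] by (intro tendsto_intros v_tendsto x) simp
  moreover have "\<forall>\<^sub>F y in at x within E. v s c y / v s c x = harm s x y"
  proof -
    have "((\<lambda>y. s * y) \<longlongrightarrow> s * x) (at x within E)" by (intro tendsto_intros)
    then have "\<forall>\<^sub>F y in at x within E. s * y < s * c" using c(2) by (rule order_tendstoD(2))
    moreover have "\<forall>\<^sub>F y in at x within E. y \<in> E" by (auto simp: eventually_at_filter)
    ultimately show ?thesis
      by eventually_elim (use harm_eq[OF s x _ c(1)] c(2) in simp)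
  qed
  ultimately show ?thesis
    using v_pos[OF x c(1) s] by (simp add: Lim_transform_eventually)
qed

text \<open>The sequence runs to the end of E in direction s, finite or not; a ramp started far
  enough out represents \<open>harm\<close> at any given point.\<close>

lemma E_exhaustion:
  assumes s: "s = 1 \<or> s = - 1"
  obtains c where "\<And>n. c n \<in> E" "\<And>y. y \<in> E \<Longrightarrow> \<forall>\<^sub>F n in sequentially. s * y \<le> s * c n"
proof -
  obtain u w where *: "einterval l r = (\<Union>i. {w i .. u i})" "incseq u" "decseq w"
    "\<And>i. w i < u i" "\<And>i. l < ereal (w i)" "\<And>i. ereal (u i) < r"
    by (rule einterval_Icc_approximation[OF endpoints], rule that)
  have E: "E = (\<Union>i. {w i .. u i})" unfolding *(1)[symmetric] by (auto simp: einterval_def state_space_def)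
  let ?c = "\<lambda>n. if s = 1 then u n else w n"
  show ?thesis
  proof (rule that[of ?c])
    show "?c n \<in> E" for n unfolding E using *(4)[of n] by (auto intro!: exI[of _ n] less_imp_le)
    fix y assume "y \<in> E"
    then obtain i where i: "w i \<le> y" "y \<le> u i" unfolding E by auto
    have "s * y \<le> s * ?c n" if "i \<le> n" for n
      using s i incseqD[OF *(2) that] decseqD[OF *(3) that] by auto
    then show "\<forall>\<^sub>F n in sequentially. s * y \<le> s * ?c n" by (rule eventually_sequentiallyI)
  qed
qed

text \<open>At each point \<open>harm\<close> is the eventual value of the normalised potentials of
  ramps started at c n. Each of these is excessive with value 1 at x, and Fatou gives the bound for
  the limit.\<close>

lemma harm_excessive:
  assumes s: "s = 1 \<or> s = - 1" and x: "x \<in> E" and T: "optional_time T"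
  shows "(\<integral>\<^sup>+ \<omega>. ennreal (discount q (T \<omega>) * harm s x (stopped X T \<omega>)) \<partial>P x) \<le> 1"
    "(\<lambda>\<omega>. harm s x (stopped X T \<omega>)) \<in> borel_measurable M"
proof -
  obtain c where c: "\<And>n. c n \<in> E" "\<And>y. y \<in> E \<Longrightarrow> \<forall>\<^sub>F n in sequentially. s * y \<le> s * c n"
    by (rule E_exhaustion[OF s], rule that)
  note [measurable] = optional_measurable[OF T]
  have vm[measurable]: "(\<lambda>\<omega>. v s (c n) (stopped X T \<omega>)) \<in> borel_measurable M" for n
  proof -
    have "(\<lambda>\<omega>. U (ramp s (c n)) (stopped X T \<omega>)) \<in> borel_measurable M"
      by (intro U_measurable ramp_admissible stopped_measurable T stopped_in_E)
    then show ?thesis unfolding delta_def by measurable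
  qed
  let ?h = "\<lambda>n \<omega>. v s (c n) (stopped X T \<omega>) / v s (c n) x"
  have lim: "\<forall>\<^sub>F n in sequentially. ?h n \<omega> = harm s x (stopped X T \<omega>)" if "\<omega> \<in> space M" for \<omega>
    using c(2)[OF x] c(2)[OF stopped_in_E[OF that, of T]]
    by eventually_elim (use harm_eq[OF s x stopped_in_E[OF that] c(1)] in simp)
  show "(\<lambda>\<omega>. harm s x (stopped X T \<omega>)) \<in> borel_measurable M"
    by (rule borel_measurable_LIMSEQ_real[of _ ?h]) (use lim in \<open>auto intro: tendsto_eventually\<close>)
  have le: "(\<integral>\<^sup>+ \<omega>. ennreal (discount q (T \<omega>) * ?h n \<omega>) \<partial>P x) \<le> 1" for n
  proof -
    have pos: "0 < v s (c n) x" by (rule v_pos[OF x c(1) s])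
    have "(\<integral>\<^sup>+ \<omega>. ennreal (discount q (T \<omega>) * ?h n \<omega>) \<partial>P x) =
        (\<integral>\<^sup>+ \<omega>. ennreal (discount q (T \<omega>)) * U (ramp s (c n)) (stopped X T \<omega>) * ennreal (1 / v s (c n) x) \<partial>P x)"
    proof (rule nn_integral_cong)
      fix \<omega> assume "\<omega> \<in> space (P x)"
      then have "stopped X T \<omega> \<in> E" using stopped_in_E by (simp add: space_P[OF x])
      then show "ennreal (discount q (T \<omega>) * ?h n \<omega>) =
        ennreal (discount q (T \<omega>)) * U (ramp s (c n)) (stopped X T \<omega>) * ennreal (1 / v s (c n) x)"
        by (simp add: v_eq[symmetric] ennreal_mult[symmetric] v_nonneg)
    qed
    also have "\<dots> = (\<integral>\<^sup>+ \<omega>. ennreal (discount q (T \<omega>)) * U (ramp s (c n)) (stopped X T \<omega>) \<partial>P x) * ennreal (1 / v s (c n) x)"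
      using U_measurable[OF ramp_admissible(1) stopped_measurable[OF T] stopped_in_E]
      by (intro nn_integral_multc) (simp add: measurable_P[OF x])
    also have "\<dots> \<le> U (ramp s (c n)) x * ennreal (1 / v s (c n) x)"
      by (intro mult_right_mono U_excessive x ramp_admissible T) simp
    also have "\<dots> = 1"
      using pos by (simp add: v_eq[OF x, symmetric] ennreal_mult[symmetric])
    finally show ?thesis .
  qed
  have "(\<integral>\<^sup>+ \<omega>. ennreal (discount q (T \<omega>) * harm s x (stopped X T \<omega>)) \<partial>P x) =
      (\<integral>\<^sup>+ \<omega>. liminf (\<lambda>n. ennreal (discount q (T \<omega>) * ?h n \<omega>)) \<partial>P x)"
  proof (rule nn_integral_cong)
    fix \<omega> assume "\<omega> \<in> space (P x)"
    then have "\<omega> \<in> space M" by (simp add: space_P[OF x])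
    from lim[OF this] have "(\<lambda>n. ennreal (discount q (T \<omega>) * ?h n \<omega>)) \<longlonglongrightarrow>
        ennreal (discount q (T \<omega>) * harm s x (stopped X T \<omega>))"
      by (intro tendsto_eventually, eventually_elim) (simp only:)
    then show "ennreal (discount q (T \<omega>) * harm s x (stopped X T \<omega>)) = liminf (\<lambda>n. ennreal (discount q (T \<omega>) * ?h n \<omega>))"
      by (intro lim_imp_Liminf[symmetric]) auto
  qed
  also have "\<dots> \<le> liminf (\<lambda>n. \<integral>\<^sup>+ \<omega>. ennreal (discount q (T \<omega>) * ?h n \<omega>) \<partial>P x)"
    by (intro nn_integral_liminf) (simp add: measurable_P[OF x])
  also have "\<dots> \<le> liminf (\<lambda>n. 1)"
    using le by (intro Liminf_mono) auto
  finally show "(\<integral>\<^sup>+ \<omega>. ennreal (discount q (T \<omega>) * harm s x (stopped X T \<omega>)) \<partial>P x) \<le> 1"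
    by (simp add: Liminf_const)
qed

text \<open>The weights are the discounted exit probabilities at y1 and y2. Their explicit form is
  avoided: the two equations, saying that \<psi> and \<phi> are harmonic in B, carry the information
  used later.\<close>

lemma two_sided_exit:
  assumes E: "x \<in> E" "y1 \<in> E" "y2 \<in> E" and less: "y1 < x" "x < y2"
  defines "B \<equiv> state_space (ereal y1) (ereal y2)"
  obtains w1 w2 :: real where "0 \<le> w1" "0 \<le> w2"
    "\<And>k. (\<integral>\<^sup>+ \<omega>. ennreal (discount q (exit_time X B \<omega>)) * k (stopped X (exit_time X B) \<omega>) \<partial>P x) = ennreal w1 * k y1 + ennreal w2 * k y2"
    "\<And>s. s = 1 \<or> s = - 1 \<Longrightarrow> w1 * harm s x y1 + w2 * harm s x y2 = 1"
proof -
  interpret prob_space "P x" by (rule prob_space_P[OF E(1)])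
  have B: "B \<in> intervals l r x" unfolding B_def by (rule AE_exit_bounded[OF E less])
  let ?T = "exit_time X B"
  have T: "optional_time ?T" by (rule optional_exit_interval[OF B])
  have AEy: "AE \<omega> in P x. ?T \<omega> \<noteq> \<top> \<longrightarrow> stopped X ?T \<omega> = y1 \<or> stopped X ?T \<omega> = y2"
    unfolding B_def by (rule AE_exit_bounded[OF E less])
  note [measurable] = optional_measurable[OF T] stopped_measurable[OF T]
  define I where "I y = (\<integral>\<^sup>+ \<omega>. ennreal (discount q (?T \<omega>)) * indicator {y} (stopped X ?T \<omega>) \<partial>P x)" for y
  have I: "I y = ennreal (enn2real (I y))" for y
  proof -
    have "I y \<le> (\<integral>\<^sup>+ \<omega>. 1 \<partial>P x)"
      unfolding I_def using q_pos by (intro nn_integral_mono) (auto simp: indicator_def discount_le_1)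
    also have "\<dots> < \<top>" by (simp add: emeasure_space_1)
    finally show ?thesis by simp
  qed
  have key: "(\<integral>\<^sup>+ \<omega>. ennreal (discount q (?T \<omega>)) * k (stopped X ?T \<omega>) \<partial>P x) =
      ennreal (enn2real (I y1)) * k y1 + ennreal (enn2real (I y2)) * k y2" for k
  proof -
    have "(\<integral>\<^sup>+ \<omega>. ennreal (discount q (?T \<omega>)) * k (stopped X ?T \<omega>) \<partial>P x) =
      (\<integral>\<^sup>+ \<omega>. ennreal (discount q (?T \<omega>)) * indicator {y1} (stopped X ?T \<omega>) * k y1 +
        ennreal (discount q (?T \<omega>)) * indicator {y2} (stopped X ?T \<omega>) * k y2 \<partial>P x)"
      by (intro nn_integral_cong_AE, use AEy in eventually_elim) (use less in \<open>auto simp: indicator_def discount_def\<close>)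
    also have "\<dots> = I y1 * k y1 + I y2 * k y2"
      unfolding I_def by (subst nn_integral_add) (simp_all add: measurable_P[OF E(1)] nn_integral_multc)
    finally show ?thesis using I by metis
  qed
  show ?thesis
  proof (rule that[of "enn2real (I y1)" "enn2real (I y2)"])
    fix s :: real assume s: "s = 1 \<or> s = - 1"
    \<comment> \<open>The ramp starts at the far endpoint in direction s, so it vanishes on B and
      represents \<open>harm\<close> at y1, x and y2 alike.\<close>
    let ?c = "if s = 1 then y2 else y1"
    have c: "?c \<in> E" using E by simp
    have "U (ramp s ?c) x = ennreal (enn2real (I y1)) * U (ramp s ?c) y1 + ennreal (enn2real (I y2)) * U (ramp s ?c) y2"
      unfolding key[symmetric]
      by (intro exit_identity[OF B] ramp_admissible) (use s in \<open>auto simp: B_def state_space_def ramp_def\<close>)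
    then have "ennreal (v s ?c x) = ennreal (enn2real (I y1) * v s ?c y1 + enn2real (I y2) * v s ?c y2)"
      unfolding v_eq[OF E(1), symmetric] v_eq[OF E(2), symmetric] v_eq[OF E(3), symmetric]
      by (simp add: ennreal_mult v_nonneg)
    then have "v s ?c x = enn2real (I y1) * v s ?c y1 + enn2real (I y2) * v s ?c y2"
      by (subst (asm) ennreal_inj) (intro add_nonneg_nonneg mult_nonneg_nonneg v_nonneg enn2real_nonneg)+
    moreover have "harm s x y1 = v s ?c y1 / v s ?c x" "harm s x y2 = v s ?c y2 / v s ?c x"
      by (rule harm_eq[OF s]; use E less s in auto)+
    ultimately show "enn2real (I y1) * harm s x y1 + enn2real (I y2) * harm s x y2 = 1"
      using v_pos[OF E(1) c s] by (simp add: add_divide_distrib[symmetric])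
  qed (auto simp: key)
qed

lemma phi_mono:
  assumes y: "y \<in> E" and m[measurable]: "exit_time X B \<in> borel_measurable M" "exit_time X B' \<in> borel_measurable M"
    and sub: "\<And>z. z \<in> E \<Longrightarrow> z \<in> B \<Longrightarrow> z \<in> B'"
  shows "phi P X q B' y \<le> phi P X q B y"
  unfolding phi_def
proof (rule integral_mono[OF integrable_discount[OF y m(2)] integrable_discount[OF y m(1)]])
  fix \<omega> assume "\<omega> \<in> space (P y)"
  then have \<omega>: "\<omega> \<in> space M" by (simp add: space_P[OF y])
  have "exit_time X B \<omega> \<le> exit_time X B' \<omega>"
    unfolding exit_time_def
    by (intro Inf_superset_mono) (use sub in_state_space[OF \<omega>] in \<open>auto intro: less_imp_le\<close>)
  then show "discount q (exit_time X B' \<omega>) \<le> discount q (exit_time X B \<omega>)"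
    using q_pos by (intro discount_antimono) auto
qed

text \<open>To escape to \<open>b\<close> beyond \<open>u\<close> costs the factor \<open>v u / v b\<close>, which tends to 1 as \<open>b\<close> approaches \<open>u\<close>.\<close>

lemma phi_outside:
  assumes B: "B \<in> intervals l r x" and u: "u \<in> E" "u \<notin> B"
  shows "phi P X q B u = 1"
proof (rule antisym[OF phi_le_1[OF u(1)]])
  obtain \<alpha> \<beta> where \<alpha>\<beta>: "B = state_space \<alpha> \<beta>" using intervalsE[OF B] by metis
  \<comment> \<open>The direction from the interval B towards u.\<close>
  define s :: real where "s = (if \<beta> \<le> ereal u then 1 else - 1)"
  have s: "s = 1 \<or> s = - 1" by (auto simp: s_def)
  have side: "s * z < s * u" if "z \<in> B" for z
  proof (cases "\<beta> \<le> ereal u")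
    case True
    then have "ereal z < ereal u" using that \<alpha>\<beta> less_le_trans[of "ereal z" \<beta> "ereal u"] by (auto simp: state_space_def)
    then show ?thesis using True by (simp add: s_def)
  next
    case False
    then have "ereal u \<le> \<alpha>" using u \<alpha>\<beta> by (auto simp: state_space_def not_less not_le)
    then have "ereal u < ereal z" using that \<alpha>\<beta> le_less_trans[of "ereal u" \<alpha> "ereal z"] by (auto simp: state_space_def)
    then show ?thesis using False by (simp add: s_def)
  qed
  obtain c where c: "c \<in> E" "s * u < s * c" by (rule E_beyond[OF u(1) s])
  \<comment> \<open>Points beyond u, tending to u from c. The half line ending at such a point
    contains B, so the exit from B happens no later than the passage to it.\<close>
  let ?z = "\<lambda>n. u + (c - u) / real (Suc n)"
  have step: "s * u < s * ?z n" "s * ?z n \<le> s * c" "?z n \<in> E" for n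
  proof -
    have *: "0 < s * ((c - u) / real (Suc n))" using c(2) by (simp add: right_diff_distrib)
    have "s * (c - u) * (1 / real (Suc n)) \<le> s * (c - u) * 1"
      using c(2) by (intro mult_left_mono) (simp_all add: right_diff_distrib)
    then have "s * ((c - u) / real (Suc n)) \<le> s * (c - u)" by simp
    with * show "s * u < s * ?z n" "s * ?z n \<le> s * c" by (simp_all only: distrib_left right_diff_distrib)
    then show "?z n \<in> E" using s E_between[OF u(1) c(1), of "?z n"] E_between[OF c(1) u(1), of "?z n"] by auto
  qed
  have "v s c u \<le> phi P X q B u * v s c (?z n)" for n
  proof -
    have h: "u \<in> half_line s (?z n)" using u step(1)[of n] by (simp add: half_line_def)
    note I = half_line_interval[OF step(3) s h]
    have "phi P X q (half_line s (?z n)) u \<le> phi P X q B u"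
    proof (rule phi_mono[OF u(1) exit_measurable[OF B] exit_measurable[OF I]])
      show "z \<in> half_line s (?z n)" if "z \<in> E" "z \<in> B" for z
        using less_trans[OF side[OF that(2)] step(1)] that by (simp add: half_line_def)
    qed
    then show ?thesis
      using v_exit[OF step(3) s h step(2)] by (simp add: mult_right_mono v_nonneg)
  qed
  moreover have "(\<lambda>n. v s c (?z n)) \<longlonglongrightarrow> v s c u"
  proof -
    have "(\<lambda>n. u + (c - u) * (1 / real (Suc n))) \<longlonglongrightarrow> u + (c - u) * 0"
      using LIMSEQ_inverse_real_of_nat by (intro tendsto_intros) (simp add: inverse_eq_divide)
    then have z: "?z \<longlonglongrightarrow> u" by simp
    have "continuous_on E (v s c)" using v_tendsto by (simp add: continuous_on_def)
    from continuous_on_tendsto_compose[OF this z u(1)] show ?thesis using step(3) by simp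
  qed
  ultimately have "v s c u \<le> phi P X q B u * v s c u"
    by (intro LIMSEQ_le_const[OF tendsto_mult_left]) auto
  then show "1 \<le> phi P X q B u"
    using v_pos[OF u(1) c(1) s] by simp
qed

end

section \<open>The stopping problem\<close>

locale stopping_problem = discounted_diffusion M F P X l r b \<sigma> q
  for M :: "'a measure" and F P X l r b \<sigma> q +
  fixes g c :: "real \<Rightarrow> real" and x :: real
  assumes g_cont: "continuous_on E g" and g_nonneg: "\<And>y. y \<in> E \<Longrightarrow> 0 \<le> g y"
    and c_cont: "continuous_on E c" and c_nonneg: "\<And>y. y \<in> E \<Longrightarrow> 0 \<le> c y"
    and xE: "x \<in> E"
    and U_c_finite: "\<And>y. y \<in> E \<Longrightarrow> U c y < \<top>"
begin

text \<open>\<open>c\<close> is controlled only on E; the extension by 0 is admissible and agrees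
  with \<open>c\<close> along all paths.\<close>

definition cost :: "real \<Rightarrow> real" where
  "cost y = (if y \<in> E then c y else 0)"

abbreviation \<delta> :: "real \<Rightarrow> real" where "\<delta> \<equiv> delta P X q c"

definition G :: "real \<Rightarrow> real" where
  "G y = g y + \<delta> y"

definition J :: "('a \<Rightarrow> ennreal) \<Rightarrow> ennreal" where
  "J T = (\<integral>\<^sup>+ \<omega>. ennreal (discount q (T \<omega>) * G (stopped X T \<omega>)) \<partial>P x)"

lemma cost_admissible: "admissible cost"
proof -
  have "continuous_on E cost"
    using c_cont by (rule continuous_on_cong[THEN iffD1, rotated -1]) (auto simp: cost_def)
  then show ?thesis
    using borel_measurable_on_open[OF c_cont open_state_space] c_nonneg
    by (auto simp: admissible_def cost_def[abs_def])
qed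

lemma running_cost_cost: "\<omega> \<in> space M \<Longrightarrow> running_cost X q cost t \<omega> = running_cost X q c t \<omega>"
  unfolding running_cost_def
  by (intro nn_integral_cong) (auto simp: cost_def in_state_space indicator_def)

lemma U_cost: "y \<in> E \<Longrightarrow> U cost y = U c y"
  unfolding total_cost_def by (intro nn_integral_cong running_cost_cost) (simp add: space_P)

lemma delta_nonneg: "0 \<le> \<delta> y"
  by (simp add: delta_def)

lemma ennreal_delta: "y \<in> E \<Longrightarrow> ennreal (\<delta> y) = U c y"
  using U_c_finite by (simp add: delta_def)

lemma G_nonneg: "y \<in> E \<Longrightarrow> 0 \<le> G y"
  using g_nonneg delta_nonneg by (simp add: G_def)

text \<open>\<delta> is handled as a supremum of continuous truncated potentials. \<open>N\<close>
  is general because \<open>F t\<close> is needed besides M.\<close>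

lemma delta_measurable:
  assumes Y: "Y \<in> borel_measurable N" "\<And>\<omega>. \<omega> \<in> space N \<Longrightarrow> Y \<omega> \<in> E"
  shows "(\<lambda>\<omega>. \<delta> (Y \<omega>)) \<in> borel_measurable N"
proof -
  have m: "(\<lambda>y. if y \<in> E then U (trunc cost n) y else 0) \<in> borel_measurable borel" for n
    using U_continuous[OF trunc_admissible[OF cost_admissible]]
    by (intro borel_measurable_continuous_on_if) auto
  have "(\<lambda>\<omega>. enn2real (SUP n. if Y \<omega> \<in> E then U (trunc cost n) (Y \<omega>) else 0)) \<in> borel_measurable N"
    using measurable_compose[OF Y(1) m] by measurable
  then show ?thesis
  proof (rule measurable_cong[THEN iffD1, rotated])
    fix \<omega> assume "\<omega> \<in> space N"
    then have YE: "Y \<omega> \<in> E" by (rule Y)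
    then have "(SUP n. U (trunc cost n) (Y \<omega>)) = U c (Y \<omega>)"
      using LIMSEQ_unique[OF LIMSEQ_SUP[OF U_trunc(2)] U_trunc(1)] cost_admissible U_cost by metis
    then show "enn2real (SUP n. if Y \<omega> \<in> E then U (trunc cost n) (Y \<omega>) else 0) = \<delta> (Y \<omega>)"
      using YE by (simp add: delta_def)
  qed
qed

lemma g_measurable:
  assumes Y: "Y \<in> borel_measurable N" "\<And>\<omega>. \<omega> \<in> space N \<Longrightarrow> Y \<omega> \<in> E"
  shows "(\<lambda>\<omega>. g (Y \<omega>)) \<in> borel_measurable N"
  using measurable_compose[OF Y(1) borel_measurable_on_open[OF g_cont open_state_space]]
  by (rule measurable_cong[THEN iffD1, rotated]) (simp add: Y(2))

lemma G_measurable: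
  assumes "Y \<in> borel_measurable N" "\<And>\<omega>. \<omega> \<in> space N \<Longrightarrow> Y \<omega> \<in> E"
  shows "(\<lambda>\<omega>. G (Y \<omega>)) \<in> borel_measurable N"
  unfolding G_def by (intro borel_measurable_add g_measurable delta_measurable assms)

text \<open>By \<open>dynkin\<close> the expected cost up to T is \<delta> x minus the discounted
  expectation of \<delta> at T; moving the latter to the reward turns g into G. Only the expectation
  of g may be infinite, so the bookkeeping is done with positive and negative parts.\<close>

lemma stopping_value_eq:
  assumes T: "optional_time T"
  shows "stopping_value (P x) X q g c T = enn2ereal (J T) - ereal (\<delta> x)"
proof -
  note [measurable] = optional_measurable[OF T]
  note sm = stopped_measurable[OF T] stopped_in_E
  note [measurable] = g_measurable[OF sm] delta_measurable[OF sm]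
  let ?g = "\<lambda>\<omega>. discount q (T \<omega>) * g (stopped X T \<omega>)"
  let ?C = "\<lambda>\<omega>. running_cost X q cost (T \<omega>) \<omega>"
  have [measurable]: "?C \<in> borel_measurable M"
    using cost_admissible by (intro running_cost_measurable) (simp_all add: admissible_def)
  have meas: "borel_measurable (P x) = (borel_measurable M :: ('a \<Rightarrow> ennreal) set)"
    by (rule measurable_P[OF xE])
  define p where "p = (\<integral>\<^sup>+ \<omega>. ennreal (?g \<omega> - enn2real (?C \<omega>)) \<partial>P x)"
  define n where "n = (\<integral>\<^sup>+ \<omega>. ennreal (enn2real (?C \<omega>) - ?g \<omega>) \<partial>P x)"
  define a where "a = (\<integral>\<^sup>+ \<omega>. ennreal (?g \<omega>) \<partial>P x)"
  define s where "s = (\<integral>\<^sup>+ \<omega>. ?C \<omega> \<partial>P x)"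
  define d where "d = (\<integral>\<^sup>+ \<omega>. ennreal (discount q (T \<omega>) * \<delta> (stopped X T \<omega>)) \<partial>P x)"
  have sd: "s + d = ennreal (\<delta> x)"
  proof -
    have "d = (\<integral>\<^sup>+ \<omega>. ennreal (discount q (T \<omega>)) * U cost (stopped X T \<omega>) \<partial>P x)"
      unfolding d_def
      by (intro nn_integral_cong) (simp add: space_P[OF xE] ennreal_mult delta_nonneg ennreal_delta U_cost stopped_in_E)
    then show ?thesis
      using dynkin[OF xE cost_admissible T] by (simp add: s_def ennreal_delta[OF xE] U_cost[OF xE])
  qed
  then have fin: "s < \<top>" "d < \<top>"
    using ennreal_add_eq_top[of s d] by (auto simp: less_top)
  have g0: "0 \<le> ?g \<omega>" if "\<omega> \<in> space M" for \<omega>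
    using that by (simp add: g_nonneg stopped_in_E)
  have "J T = a + d"
    unfolding J_def a_def d_def
    by (subst nn_integral_add[symmetric])
       (auto simp: meas space_P[OF xE] G_def distrib_left g0 delta_nonneg intro!: nn_integral_cong)
  have AEC: "AE \<omega> in P x. ?C \<omega> \<noteq> \<top>"
    using nn_integral_PInf_AE[of ?C "P x"] fin(1) by (simp add: meas s_def less_top)
  \<comment> \<open>Integrated form of (g - C)^+ + C = g + (g - C)^-, with g discounted; written
    without subtraction so that it holds in \<open>ennreal\<close>.\<close>
  have "p + s = a + n"
  proof -
    have "p + s = (\<integral>\<^sup>+ \<omega>. ennreal (?g \<omega> - enn2real (?C \<omega>)) + ?C \<omega> \<partial>P x)"
      unfolding p_def s_def by (subst nn_integral_add) (auto simp: meas)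
    also have "\<dots> = (\<integral>\<^sup>+ \<omega>. ennreal (?g \<omega>) + ennreal (enn2real (?C \<omega>) - ?g \<omega>) \<partial>P x)"
    proof (rule nn_integral_cong_AE, use AEC AE_space[of "P x"] in eventually_elim)
      case (elim \<omega>)
      then obtain k where k: "?C \<omega> = ennreal k" "0 \<le> k" by (cases "?C \<omega>") auto
      have "0 \<le> ?g \<omega>" using elim by (intro g0) (simp add: space_P[OF xE])
      then show ?case using k
        by (cases "?g \<omega> \<le> k") (simp_all add: ennreal_neg flip: ennreal_plus)
    qed
    also have "\<dots> = a + n"
      unfolding a_def n_def by (subst nn_integral_add) (auto simp: meas)
    finally show ?thesis .
  qed
  \<comment> \<open>Finiteness of n excludes \<infinity> - \<infinity> in
    \<open>ext_expectation\<close>.\<close>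
  have "n \<le> s"
    unfolding n_def s_def
  proof (rule nn_integral_mono_AE, use AEC AE_space[of "P x"] in eventually_elim)
    case (elim \<omega>)
    then have "0 \<le> ?g \<omega>" by (intro g0) (simp add: space_P[OF xE])
    then have "ennreal (enn2real (?C \<omega>) - ?g \<omega>) \<le> ennreal (enn2real (?C \<omega>))"
      by (intro ennreal_leI) simp
    also have "\<dots> = ?C \<omega>" using elim by (simp add: less_top)
    finally show ?case .
  qed
  then have nfin: "n < \<top>" using fin(1) by (rule le_less_trans)
  have "(\<integral>\<^sup>+ \<omega>. e2ennreal (ereal (?g \<omega>) - enn2ereal (running_cost X q c (T \<omega>) \<omega>)) \<partial>P x) = p"
    unfolding p_def
  proof (rule nn_integral_cong_AE, use AEC AE_space[of "P x"] in eventually_elim)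
    case (elim \<omega>)
    then obtain k where k: "?C \<omega> = ennreal k" "0 \<le> k" by (cases "?C \<omega>") auto
    moreover have "running_cost X q c (T \<omega>) \<omega> = ?C \<omega>"
      using elim by (simp add: running_cost_cost space_P[OF xE])
    ultimately show ?case by (simp add: e2ennreal_ereal)
  qed
  moreover have "(\<integral>\<^sup>+ \<omega>. e2ennreal (- (ereal (?g \<omega>) - enn2ereal (running_cost X q c (T \<omega>) \<omega>))) \<partial>P x) = n"
    unfolding n_def
  proof (rule nn_integral_cong_AE, use AEC AE_space[of "P x"] in eventually_elim)
    case (elim \<omega>)
    then obtain k where k: "?C \<omega> = ennreal k" "0 \<le> k" by (cases "?C \<omega>") auto
    moreover have "running_cost X q c (T \<omega>) \<omega> = ?C \<omega>"
      using elim by (simp add: running_cost_cost space_P[OF xE])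
    ultimately show ?case by (simp add: e2ennreal_ereal)
  qed
  ultimately have "stopping_value (P x) X q g c T = enn2ereal p - enn2ereal n"
    by (simp add: stopping_value_def ext_expectation_def)
  also have "\<dots> = enn2ereal (a + d) - ereal (\<delta> x)"
  proof -
    obtain n' s' d' where r: "n = ennreal n'" "0 \<le> n'" "s = ennreal s'" "0 \<le> s'" "d = ennreal d'" "0 \<le> d'"
      using nfin fin by (metis enn2real_nonneg ennreal_enn2real)
    have \<delta>: "\<delta> x = s' + d'"
      using sd r delta_nonneg[of x] by (simp flip: ennreal_plus)
    show ?thesis
    \<comment> \<open>Since n and s are finite, p and a are finite or infinite together.\<close>
    proof (cases p)
      case (real p')
      then have "a \<noteq> \<top>" using \<open>p + s = a + n\<close> r by auto
      then obtain a' where a: "a = ennreal a'" "0 \<le> a'" by (cases a) auto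
      have "p' + s' = a' + n'" using \<open>p + s = a + n\<close> r real a by (simp flip: ennreal_plus)
      then show ?thesis using r real a \<delta> by (simp flip: ennreal_plus)
    next
      case top
      then have "a + n = \<top>" using \<open>p + s = a + n\<close> by (metis ennreal_add_eq_top)
      then have "a = \<top>" using r by (simp add: ennreal_add_eq_top)
      then show ?thesis using top r by simp
    qed
  qed
  finally show ?thesis by (simp add: \<open>J T = a + d\<close>)
qed

text \<open>If the exit time were a.s. infinite, a point z of E outside B would a.s. never be hit,
  contrary to regularity.\<close>

lemma phi_pos:
  assumes B: "B \<in> intervals l r x"
  shows "0 < phi P X q B x"
proof (rule ccontr)
  assume "\<not> 0 < phi P X q B x"
  then have "ennreal (phi P X q B x) = 0" using phi_nonneg[of B x] by simp
  then have AE_top: "AE \<omega> in P x. exit_time X B \<omega> = \<top>"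
    unfolding phi_eq_nn_integral[OF xE exit_measurable[OF B]]
    using exit_measurable[OF B]
    by (subst (asm) nn_integral_0_iff_AE) (auto simp: measurable_P[OF xE] discount_def split: if_splits)
  obtain z where z: "z \<in> E" "z \<notin> B" using intervalsE[OF B] by metis
  have "AE \<omega> in P x. hitting_time X z \<omega> = \<top>"
    using AE_top
  proof eventually_elim
    case (elim \<omega>)
    then show ?case
      using inside_before_exit[of _ B \<omega>] z by (intro hitting_time_eq_top) auto
  qed
  with xE z(1) show False by (rule AE_hitting_imp_contradiction)
qed

section \<open>The h-transform and its value\<close>

lemma h_fun_outside:
  assumes B: "B \<in> intervals l r x" and u: "u \<in> E" "u \<notin> B"
  shows "h_fun P X q x B u = 1 / phi P X q B x"
  by (simp add: h_fun_def phi_outside[OF B u])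

text \<open>The factor h in the density cancels the denominator of the ratio, leaving the discounted
  G. The work lies in measurability: the h-transform lives on the sigma-algebra of T+, so density
  and integrand must be measurable there before passing back to \<open>P x\<close>.\<close>

lemma h_value_eq:
  assumes B: "B \<in> intervals l r x"
  shows "h_value P F X q g c x B = enn2ereal (J (exit_time X B))"
proof -
  let ?T = "exit_time X B"
  let ?\<phi> = "phi P X q B x"
  have T: "optional_time ?T" by (rule optional_exit_interval[OF B])
  note Tm[measurable] = optional_measurable[OF T]
  have Bo: "open B" using intervalsE[OF B] by metis
  have sp: "space (P x) = space M" "sets (P x) = sets M" by (auto simp: space_P[OF xE] sets_P[OF xE])
  define N where "N = pre_sigma_plus (P x) F ?T"
  define A where "A = {A \<in> sets M. \<forall>t<\<top>. A \<inter> {\<omega> \<in> space M. ?T \<omega> < t} \<in> sets (F t)}"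
  have N: "N = sigma (space M) A" by (simp add: N_def A_def pre_sigma_plus_def sp)
  have Asub: "A \<subseteq> Pow (space M)" using sets.sets_into_space by (auto simp: A_def)
  have spN: "space N = space M" by (simp add: N space_measure_of[OF Asub])
  have setsN: "sets N = sigma_sets (space M) A" by (simp add: N sets_measure_of[OF Asub])
  have sub: "subalgebra (P x) N"
    unfolding subalgebra_def setsN using sets.sigma_sets_subset[of A M]
    by (auto simp: spN sp A_def)
  have inN: "S \<in> sets N" if "S \<in> sets M" "\<And>t. t < \<top> \<Longrightarrow> S \<inter> {\<omega> \<in> space M. ?T \<omega> < t} \<in> sets (F t)" for S
    unfolding setsN using that by (auto simp: A_def)
  have TN[measurable]: "?T \<in> borel_measurable N"
  proof (rule measurable_if_less, unfold spN, rule inN)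
    fix s t :: ennreal assume st: "s < \<top>" "t < \<top>"
    have "{\<omega> \<in> space M. ?T \<omega> < s} \<inter> {\<omega> \<in> space M. ?T \<omega> < t} = {\<omega> \<in> space M. ?T \<omega> < min s t}"
      by auto
    then show "{\<omega> \<in> space M. ?T \<omega> < s} \<inter> {\<omega> \<in> space M. ?T \<omega> < t} \<in> sets (F t)"
      using optional_less_F[OF T, of "min s t" t] st by (auto simp: min_less_iff_disj)
  qed measurable
  \<comment> \<open>Cut off at T = \<infinity>, where the density vanishes.\<close>
  let ?Y = "\<lambda>\<omega>. if ?T \<omega> < \<top> then G (stopped X ?T \<omega>) else 0"
  have GM[measurable]: "(\<lambda>\<omega>. G (stopped X ?T \<omega>)) \<in> borel_measurable M"
    by (intro G_measurable stopped_measurable T stopped_in_E)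
  have YN[measurable]: "?Y \<in> borel_measurable N"
  proof (rule measurableI)
    fix S :: "real set" assume S: "S \<in> sets borel"
    show "?Y -` S \<inter> space N \<in> sets N"
      unfolding spN
    proof (rule inN)
      have "?Y \<in> borel_measurable M" by measurable
      then show "?Y -` S \<inter> space M \<in> sets M" using S by (rule measurable_sets)
      fix t :: ennreal assume t: "t < \<top>"
      \<comment> \<open>On {T < t} stopping at min(T, t) is stopping at T, and this version depends
        on the path up to t only.\<close>
      let ?Z = "\<lambda>\<omega>. G (X (enn2real (min (?T \<omega>) t)) \<omega>)"
      have "?Z \<in> borel_measurable (F t)"
        by (intro G_measurable stopped_min_measurable T t) (auto simp: space_F intro: in_state_space)
      then have "?Z -` S \<inter> space (F t) \<inter> {\<omega> \<in> space M. ?T \<omega> < t} \<in> sets (F t)"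
        using S optional_less_F[OF T t, of t] by (intro sets.Int measurable_sets) auto
      moreover have "?Y -` S \<inter> space M \<inter> {\<omega> \<in> space M. ?T \<omega> < t} = ?Z -` S \<inter> space (F t) \<inter> {\<omega> \<in> space M. ?T \<omega> < t}"
      proof -
        have "?Y \<omega> = ?Z \<omega>" if "?T \<omega> < t" for \<omega>
          using less_trans[OF that t] that by (simp add: stopped_def min_absorb1)
        then show ?thesis by (auto simp only: vimage_eq Int_iff mem_Collect_eq space_F)
      qed
      ultimately show "?Y -` S \<inter> space M \<inter> {\<omega> \<in> space M. ?T \<omega> < t} \<in> sets (F t)" by simp
    qed
  qed simp
  define R where "R = restr_to_subalg (P x) N"
  have spR: "space R = space M" by (simp add: R_def space_restr_to_subalg sp)
  have mR: "f \<in> borel_measurable R" if "f \<in> borel_measurable N" for f :: "'a \<Rightarrow> ennreal"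
    unfolding R_def by (rule measurable_in_subalg[OF sub that])
  \<comment> \<open>At every exit position h equals 1 / phi, so the density is a function of T
    alone.\<close>
  define D where "D \<omega> = ennreal (discount q (?T \<omega>) * (1 / ?\<phi>))" for \<omega>
  have DN[measurable]: "D \<in> borel_measurable N" unfolding D_def by measurable
  have out: "stopped X ?T \<omega> \<in> E" "stopped X ?T \<omega> \<notin> B" if "\<omega> \<in> space M" "?T \<omega> \<noteq> \<top>" for \<omega>
    using that stopped_in_E stopped_exit_outside[OF _ Bo] by auto
  have D: "ennreal (discount q (?T \<omega>) * h_fun P X q x B (stopped X ?T \<omega>)) = D \<omega>" if "\<omega> \<in> space R" for \<omega>
    using that h_fun_outside[OF B out] by (cases "?T \<omega> = \<top>") (auto simp: D_def spR)
  have "(\<lambda>\<omega>. ennreal (discount q (?T \<omega>) * h_fun P X q x B (stopped X ?T \<omega>))) \<in> borel_measurable R"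
    by (rule measurable_cong[THEN iffD2, OF D mR[OF DN]])
  then have H: "h_transform P F X q x B = density R D"
    unfolding h_transform_def N_def[symmetric] R_def[symmetric]
    by (intro density_cong mR[OF DN] AE_I2 D)
  let ?f = "\<lambda>\<omega>. ereal (ratio P X q g c x B (stopped X ?T \<omega>))"
  have nonneg: "0 \<le> ratio P X q g c x B (stopped X ?T \<omega>)" if "\<omega> \<in> space M" for \<omega>
    using G_nonneg[OF stopped_in_E[OF that, of ?T]] phi_nonneg by (auto simp: ratio_def G_def h_fun_def)
  have "(\<integral>\<^sup>+ \<omega>. e2ennreal (- ?f \<omega>) \<partial>density R D) = (\<integral>\<^sup>+ \<omega>. 0 \<partial>density R D)"
    using nonneg by (intro nn_integral_cong) (simp add: spR e2ennreal_neg ennreal_neg)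
  moreover have "(\<integral>\<^sup>+ \<omega>. e2ennreal (?f \<omega>) \<partial>density R D) = (\<integral>\<^sup>+ \<omega>. ennreal (?Y \<omega> * ?\<phi>) \<partial>density R D)"
  proof (rule nn_integral_cong_AE, subst AE_density[OF mR[OF DN]], rule AE_I2, rule impI)
    fix \<omega> assume \<omega>: "\<omega> \<in> space R" "0 < D \<omega>"
    then have T: "\<omega> \<in> space M" "?T \<omega> \<noteq> \<top>" by (auto simp: spR D_def)
    then show "e2ennreal (?f \<omega>) = ennreal (?Y \<omega> * ?\<phi>)"
      using h_fun_outside[OF B out[OF T]] by (simp add: ratio_def G_def e2ennreal_ereal less_top)
  qed
  moreover have "\<dots> = (\<integral>\<^sup>+ \<omega>. D \<omega> * ennreal (?Y \<omega> * ?\<phi>) \<partial>R)"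
    by (intro nn_integral_density mR DN) measurable
  moreover have "\<dots> = (\<integral>\<^sup>+ \<omega>. D \<omega> * ennreal (?Y \<omega> * ?\<phi>) \<partial>P x)"
    unfolding R_def by (intro nn_integral_subalgebra2[OF sub]) measurable
  moreover have "\<dots> = J ?T"
    unfolding J_def
  proof (rule nn_integral_cong)
    fix \<omega> assume "\<omega> \<in> space (P x)"
    then have "0 \<le> G (stopped X ?T \<omega>)" by (intro G_nonneg stopped_in_E) (simp add: sp)
    then show "D \<omega> * ennreal (?Y \<omega> * ?\<phi>) = ennreal (discount q (?T \<omega>) * G (stopped X ?T \<omega>))"
      using phi_pos[OF B] by (cases "?T \<omega> = \<top>") (auto simp: D_def less_top ennreal_mult[symmetric])
  qed
  ultimately show ?thesis
    by (simp add: h_value_def ext_expectation_def H zero_ennreal.rep_eq)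
qed

text \<open>This sign decides whether the constraint at y bounds a from below or from above.\<close>

lemma harm_order:
  assumes y: "y \<in> E"
  shows "x < y \<Longrightarrow> harm (- 1) x y < harm 1 x y" "y < x \<Longrightarrow> harm 1 x y < harm (- 1) x y"
proof -
  have s: "(1::real) = 1 \<or> (1::real) = - 1" "(- 1::real) = 1 \<or> (- 1::real) = - 1" by auto
  show "harm (- 1) x y < harm 1 x y" if "x < y"
    using harm_less_1[OF s(2) xE y] harm_greater_1[OF s(1) xE y] that by linarith
  show "harm 1 x y < harm (- 1) x y" if "y < x"
    using harm_less_1[OF s(1) xE y] harm_greater_1[OF s(2) xE y] that by linarith
qed

lemma J_cong: "AE \<omega> in P x. S \<omega> = T \<omega> \<Longrightarrow> J S = J T"
  unfolding J_def by (intro nn_integral_cong_AE, elim eventually_mono) (simp add: stopped_def)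

lemma AE_entrance_eq_exit:
  assumes B: "B \<in> intervals l r x"
  shows "AE \<omega> in P x. entrance_time B \<omega> = exit_time X B \<omega>"
  using AE_start[OF xE]
  by eventually_elim (intro entrance_time_eq_exit_time, use intervalsE[OF B] in metis)

lemma stopping_time_entrance_interval:
  "B \<in> intervals l r x \<Longrightarrow> stopping_time F (entrance_time B)"
  using intervalsE[of B x] stopping_time_entrance[of B] by metis

lemma J_half_line:
  assumes s: "s = 1 \<or> s = - 1" and y: "y \<in> E" "s * x < s * y"
  shows "J (exit_time X (half_line s y)) = ennreal (phi P X q (half_line s y) x * G y)"
proof -
  have x: "x \<in> half_line s y" using xE y(2) by (simp add: half_line_def)
  have B: "half_line s y \<in> intervals l r x" by (rule half_line_interval[OF y(1) s x])
  have "J (exit_time X (half_line s y)) =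
      (\<integral>\<^sup>+ \<omega>. ennreal (discount q (exit_time X (half_line s y) \<omega>)) * ennreal (G y) \<partial>P x)"
    unfolding J_def
    by (intro nn_integral_cong_AE, use AE_exit_half_line[OF y(1) s x] in eventually_elim)
       (auto simp: discount_def ennreal_mult' G_nonneg y)
  also have "\<dots> = ennreal (phi P X q (half_line s y) x) * ennreal (G y)"
    using exit_measurable[OF B] by (simp add: nn_integral_multc measurable_P[OF xE] phi_eq_nn_integral[OF xE])
  finally show ?thesis by (simp add: ennreal_mult phi_nonneg G_nonneg y)
qed

section \<open>The excessive majorant of G with value V at x\<close>

context
  fixes V :: real
  assumes V_nonneg: "0 \<le> V" and V: "\<And>B. B \<in> intervals l r x \<Longrightarrow> J (exit_time X B) \<le> ennreal V"
begin

text \<open>The passage time to y has value phi times G y, and phi is the reciprocal of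
  \<open>harm\<close>. For s = 1 the lower bounds on a are thus at most V; for s = -1 the upper
  bounds are nonnegative.\<close>

lemma G_le_harm:
  assumes s: "s = 1 \<or> s = - 1" and y: "y \<in> E" "s * x < s * y"
  shows "G y \<le> V * harm s x y"
proof -
  let ?\<phi> = "phi P X q (half_line s y) x"
  have x: "x \<in> half_line s y" using xE y(2) by (simp add: half_line_def)
  have "?\<phi> * G y \<le> V"
    using V[OF half_line_interval[OF y(1) s x]] V_nonneg by (simp add: J_half_line[OF assms])
  then have "?\<phi> * G y * harm s x y \<le> V * harm s x y"
    using harm_pos[OF s xE y(1)] by (intro mult_right_mono) auto
  moreover have "?\<phi> * G y * harm s x y = G y"
    using phi_half_line[OF s xE y] by (simp add: mult.commute mult.left_commute)
  ultimately show ?thesis by simp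
qed

text \<open>The value of the exit time from (y1, y2) is at most V. Expressed through the harmonicity
  equations, this says that the lower bound on a from y2 does not exceed the upper bound from
  y1.\<close>

lemma G_two_sided:
  assumes y: "y1 \<in> E" "y2 \<in> E" "y1 < x" "x < y2"
  defines "d1 \<equiv> harm (- 1) x y1 - harm 1 x y1" and "d2 \<equiv> harm 1 x y2 - harm (- 1) x y2"
  shows "(G y2 - V * harm (- 1) x y2) / d2 \<le> (V * harm (- 1) x y1 - G y1) / d1" "0 < d1" "0 < d2"
proof -
  let ?B = "state_space (ereal y1) (ereal y2)"
  show d: "0 < d1" "0 < d2"
    unfolding d1_def d2_def using harm_order[OF y(1)] harm_order[OF y(2)] y(3,4) by simp_all
  obtain w1 w2 :: real where w: "0 \<le> w1" "0 \<le> w2"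
    and k: "\<And>k. (\<integral>\<^sup>+ \<omega>. ennreal (discount q (exit_time X ?B \<omega>)) * k (stopped X (exit_time X ?B) \<omega>) \<partial>P x) = ennreal w1 * k y1 + ennreal w2 * k y2"
    and h: "\<And>s. s = 1 \<or> s = - 1 \<Longrightarrow> w1 * harm s x y1 + w2 * harm s x y2 = 1"
    by (rule two_sided_exit[OF xE y], rule that)
  have "J (exit_time X ?B) = ennreal w1 * ennreal (G y1) + ennreal w2 * ennreal (G y2)"
    unfolding J_def k[of "\<lambda>y. ennreal (G y)", symmetric]
    by (intro nn_integral_cong) (simp add: ennreal_mult G_nonneg stopped_in_E space_P[OF xE])
  also have "\<dots> = ennreal (w1 * G y1 + w2 * G y2)"
    using w G_nonneg y by (simp add: ennreal_mult)
  finally have le: "w1 * G y1 + w2 * G y2 \<le> V"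
    using V[OF AE_exit_bounded(1)[OF xE y]] V_nonneg by simp
  have h1: "w1 * harm 1 x y1 + w2 * harm 1 x y2 = 1" and h2: "w1 * harm (- 1) x y1 + w2 * harm (- 1) x y2 = 1"
    using h[of 1] h[of "- 1"] by auto
  \<comment> \<open>The difference of the two harmonicity equations; it is the ratio of the weights
    that matters.\<close>
  have bal: "w1 * d1 = w2 * d2"
    using h1 h2 by (simp add: d1_def d2_def algebra_simps)
  have "w2 \<noteq> 0"
  proof
    assume "w2 = 0"
    then show False using bal d(1) h1 by simp
  qed
  then have "0 < w2" using w by simp
  have "w2 * (G y2 - V * harm (- 1) x y2) \<le> w1 * (V * harm (- 1) x y1 - G y1)"
  proof -
    \<comment> \<open>V is spread over the two endpoints by the equation for \<phi>, so that it
      combines with G at each of them.\<close>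
    have "V = V * (w1 * harm (- 1) x y1 + w2 * harm (- 1) x y2)" using h2 by simp
    with le show ?thesis by (simp add: algebra_simps)
  qed
  also have "\<dots> = w2 * ((V * harm (- 1) x y1 - G y1) * (d2 / d1))"
  proof -
    have "w1 = w2 * (d2 / d1)" using bal d by (simp add: eq_divide_eq)
    then show ?thesis by (simp only: ac_simps)
  qed
  finally have "G y2 - V * harm (- 1) x y2 \<le> (V * harm (- 1) x y1 - G y1) * (d2 / d1)"
    by (rule mult_left_le_imp_le) fact
  then show "(G y2 - V * harm (- 1) x y2) / d2 \<le> (V * harm (- 1) x y1 - G y1) / d1"
    using d by (simp add: pos_divide_le_eq)
qed

text \<open>Take for a the supremum of all lower bounds. It respects every upper bound because lower
  and upper bounds are compatible in pairs.\<close>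

lemma majorant_off_start:
  obtains a where "0 \<le> a" "a \<le> V"
    "\<And>y. y \<in> E \<Longrightarrow> y \<noteq> x \<Longrightarrow> G y \<le> a * harm 1 x y + (V - a) * harm (- 1) x y"
proof -
  let ?L = "\<lambda>y. (G y - V * harm (- 1) x y) / (harm 1 x y - harm (- 1) x y)"
  \<comment> \<open>The element 0 enforces a \<ge> 0, needed for the combination to be
    excessive.\<close>
  let ?S = "insert 0 (?L ` {y \<in> E. x < y})"
  have d: "0 < harm 1 x y - harm (- 1) x y" if "y \<in> E" "x < y" for y
    using harm_order(1)[OF that] by simp
  have d': "0 < harm (- 1) x y - harm 1 x y" if "y \<in> E" "y < x" for y
    using harm_order(2)[OF that] by simp
  have leV: "z \<le> V" if "z \<in> ?S" for z
  proof -
    have "?L y \<le> V" if "y \<in> E" "x < y" for y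
      using d[OF that] G_le_harm[of 1 y] that by (simp add: pos_divide_le_eq right_diff_distrib)
    then show ?thesis using that V_nonneg by auto
  qed
  have bdd: "bdd_above ?S" using leV by (intro bdd_aboveI)
  show ?thesis
  proof (rule that[of "Sup ?S"])
    show "0 \<le> Sup ?S" using bdd by (intro cSup_upper) auto
    show "Sup ?S \<le> V" using leV by (intro cSup_least) auto
    fix y assume y: "y \<in> E" "y \<noteq> x"
    show "G y \<le> Sup ?S * harm 1 x y + (V - Sup ?S) * harm (- 1) x y"
    proof (cases "x < y")
      case True
      then have "?L y \<le> Sup ?S" using y bdd by (intro cSup_upper) auto
      then have "G y - V * harm (- 1) x y \<le> Sup ?S * (harm 1 x y - harm (- 1) x y)"
        using d[OF y(1) True] by (simp add: pos_divide_le_eq)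
      then show ?thesis by (simp add: left_diff_distrib right_diff_distrib)
    next
      case False
      then have yx: "y < x" using y by simp
      have "Sup ?S \<le> (V * harm (- 1) x y - G y) / (harm (- 1) x y - harm 1 x y)"
      proof (rule cSup_least)
        fix z assume "z \<in> ?S"
        moreover have "0 \<le> (V * harm (- 1) x y - G y) / (harm (- 1) x y - harm 1 x y)"
          using G_le_harm[of "- 1" y] y yx d'[OF y(1) yx] by simp
        ultimately show "z \<le> (V * harm (- 1) x y - G y) / (harm (- 1) x y - harm 1 x y)"
          using G_two_sided(1)[OF y(1) _ yx] by auto
      qed simp
      then have "Sup ?S * (harm (- 1) x y - harm 1 x y) \<le> V * harm (- 1) x y - G y"
        using d'[OF y(1) yx] by (simp add: pos_le_divide_eq)
      then show ?thesis by (simp add: left_diff_distrib right_diff_distrib)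
    qed
  qed
qed

text \<open>Only lower semicontinuity of \<open>\<delta>\<close>, as a supremum of continuous potentials, is available here; it
  suffices to pass to the limit \<open>y \<longrightarrow> x\<close>.\<close>

lemma G_start_le:
  assumes maj: "\<And>y. y \<in> E \<Longrightarrow> y \<noteq> x \<Longrightarrow> G y \<le> a * harm 1 x y + (V - a) * harm (- 1) x y"
  shows "G x \<le> V"
proof -
  let ?u = "\<lambda>n y. enn2real (U (trunc cost n) y)"
  have fin: "U (trunc cost n) y < \<top>" if "y \<in> E" for n y
    by (rule U_finite[OF that trunc_admissible[OF cost_admissible]])
  have le: "g x + ?u n x \<le> V" for n
  proof (rule tendsto_le)
    show "\<not> trivial_limit (at x within E)"
      using at_within_open[OF xE open_state_space] by simp
    \<comment> \<open>Both harmonic functions tend to 1 at x, so a cancels in the limit.\<close>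
    have "((\<lambda>y. a * harm 1 x y + (V - a) * harm (- 1) x y) \<longlongrightarrow> a * 1 + (V - a) * 1) (at x within E)"
      by (intro tendsto_intros harm_tendsto xE) auto
    then show "((\<lambda>y. a * harm 1 x y + (V - a) * harm (- 1) x y) \<longlongrightarrow> V) (at x within E)" by simp
    have "(?u n \<longlongrightarrow> ?u n x) (at x within E)"
      using U_continuous[OF trunc_admissible[OF cost_admissible], of n] fin[OF xE, of n] xE
      by (intro tendsto_enn2real) (auto simp: continuous_on_def less_top[symmetric])
    then show "((\<lambda>y. g y + ?u n y) \<longlongrightarrow> g x + ?u n x) (at x within E)"
      using g_cont xE by (intro tendsto_add) (auto simp: continuous_on_def)
    have "g y + ?u n y \<le> G y" if "y \<in> E" for y
    proof -
      have "U (trunc cost n) y \<le> U cost y"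
        using incseq_le[OF U_trunc(2)[OF cost_admissible that] U_trunc(1)[OF cost_admissible that]] .
      then have "?u n y \<le> \<delta> y"
        unfolding delta_def using U_c_finite[OF that] by (intro enn2real_mono) (simp_all add: U_cost[OF that])
      then show ?thesis by (simp add: G_def)
    qed
    with maj have "g y + ?u n y \<le> a * harm 1 x y + (V - a) * harm (- 1) x y" if "y \<in> E" "y \<noteq> x" for y
      using that order_trans by blast
    then show "\<forall>\<^sub>F y in at x within E. g y + ?u n y \<le> a * harm 1 x y + (V - a) * harm (- 1) x y"
      by (auto simp: eventually_at_filter)
  qed
  have "(\<lambda>n. ?u n x) \<longlonglongrightarrow> \<delta> x"
  proof (rule tendsto_enn2real)
    show "(\<lambda>n. U (trunc cost n) x) \<longlonglongrightarrow> ennreal (\<delta> x)"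
      using U_trunc(1)[OF cost_admissible xE] by (simp add: ennreal_delta[OF xE] U_cost[OF xE])
  qed (rule delta_nonneg)
  then have "(\<lambda>n. g x + ?u n x) \<longlonglongrightarrow> g x + \<delta> x"
    by (rule tendsto_add[OF tendsto_const])
  then show ?thesis
    unfolding G_def by (rule LIMSEQ_le_const2) (use le in blast)
qed

lemma J_le:
  assumes T: "optional_time T"
  shows "J T \<le> ennreal V"
proof -
  obtain a where a: "0 \<le> a" "a \<le> V"
    "\<And>y. y \<in> E \<Longrightarrow> y \<noteq> x \<Longrightarrow> G y \<le> a * harm 1 x y + (V - a) * harm (- 1) x y"
    by (rule majorant_off_start, rule that)
  \<comment> \<open>At y = x both harmonic functions equal 1 and the majorant is V.\<close>
  have maj: "G y \<le> a * harm 1 x y + (V - a) * harm (- 1) x y" if "y \<in> E" for y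
    using a(3) G_start_le[OF a(3)] that harm_self[OF _ xE] by (cases "y = x") auto
  let ?h = "\<lambda>s \<omega>. ennreal (discount q (T \<omega>) * harm s x (stopped X T \<omega>))"
  have m: "?h s \<in> borel_measurable (P x)" if "s = 1 \<or> s = - 1" for s
    using harm_excessive(2)[OF that xE T] optional_measurable[OF T] by (simp add: measurable_P[OF xE])
  have "J T \<le> (\<integral>\<^sup>+ \<omega>. ennreal a * ?h 1 \<omega> + ennreal (V - a) * ?h (- 1) \<omega> \<partial>P x)"
    unfolding J_def
  proof (rule nn_integral_mono)
    fix \<omega> assume "\<omega> \<in> space (P x)"
    then have Y: "stopped X T \<omega> \<in> E" by (intro stopped_in_E) (simp add: space_P[OF xE])
    have "discount q (T \<omega>) * G (stopped X T \<omega>) \<le>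
        discount q (T \<omega>) * (a * harm 1 x (stopped X T \<omega>) + (V - a) * harm (- 1) x (stopped X T \<omega>))"
      by (intro mult_left_mono maj Y) simp
    also have "\<dots> = a * (discount q (T \<omega>) * harm 1 x (stopped X T \<omega>)) + (V - a) * (discount q (T \<omega>) * harm (- 1) x (stopped X T \<omega>))"
      by (simp add: algebra_simps)
    finally have "ennreal (discount q (T \<omega>) * G (stopped X T \<omega>)) \<le> ennreal \<dots>" by (rule ennreal_leI)
    also have "\<dots> = ennreal a * ?h 1 \<omega> + ennreal (V - a) * ?h (- 1) \<omega>"
      using a harm_pos[OF _ xE Y, of 1] harm_pos[OF _ xE Y, of "- 1"]
      by (subst ennreal_plus) (auto simp: ennreal_mult)
    finally show "ennreal (discount q (T \<omega>) * G (stopped X T \<omega>)) \<le> ennreal a * ?h 1 \<omega> + ennreal (V - a) * ?h (- 1) \<omega>" .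
  qed
  also have "\<dots> = ennreal a * (\<integral>\<^sup>+ \<omega>. ?h 1 \<omega> \<partial>P x) + ennreal (V - a) * (\<integral>\<^sup>+ \<omega>. ?h (- 1) \<omega> \<partial>P x)"
    using m[of 1] m[of "- 1"] by (subst nn_integral_add) (simp_all add: nn_integral_cmult)
  also have "\<dots> \<le> ennreal a * 1 + ennreal (V - a) * 1"
    by (intro add_mono mult_left_mono harm_excessive(1) xE T) auto
  also have "\<dots> = ennreal V" using a by (simp flip: ennreal_plus)
  finally show ?thesis .
qed

end

section \<open>Equality of the two values and optimality of exit times\<close>

lemma J_le_SUP:
  assumes T: "optional_time T"
  shows "J T \<le> (SUP B\<in>intervals l r x. J (exit_time X B))"
proof (cases "SUP B\<in>intervals l r x. J (exit_time X B)")
  case (real V)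
  show ?thesis
    unfolding real(2)
  proof (rule J_le[OF real(1) _ T])
    fix B assume "B \<in> intervals l r x"
    then show "J (exit_time X B) \<le> ennreal V"
      unfolding real(2)[symmetric] by (rule SUP_upper)
  qed
qed (simp only: top_greatest)

lemma intervals_nonempty: "intervals l r x \<noteq> {}"
proof -
  obtain z where "z \<in> E" "1 * x < 1 * z" using E_beyond[OF xE, of 1] by auto
  then show ?thesis
    using half_line_interval[of z 1 x] xE by (auto simp: half_line_def)
qed

text \<open>Stopping times are optional, so \<open>J_le_SUP\<close> bounds them. Conversely the exit
  time from B is replaced by \<open>entrance_time\<close>, a genuine stopping time that agrees with
  it a.s. under \<open>P x\<close>.\<close>

lemma value_identity:
  "(SUP T\<in>{T. stopping_time F T}. stopping_value (P x) X q g c T)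
    = (SUP B\<in>intervals l r x. h_value P F X q g c x B) - ereal (\<delta> x)"
proof (rule antisym)
  have hv: "(SUP B\<in>intervals l r x. h_value P F X q g c x B) = (SUP B\<in>intervals l r x. enn2ereal (J (exit_time X B)))"
    by (intro SUP_cong h_value_eq refl)
  show "(SUP T\<in>{T. stopping_time F T}. stopping_value (P x) X q g c T)
    \<le> (SUP B\<in>intervals l r x. h_value P F X q g c x B) - ereal (\<delta> x)"
  proof (rule SUP_least)
    fix T assume "T \<in> {T. stopping_time F T}"
    then have T: "optional_time T" by (simp add: stopping_time_imp_optional)
    have "enn2ereal (J T) \<le> enn2ereal (SUP B\<in>intervals l r x. J (exit_time X B))"
      using J_le_SUP[OF T] by (simp only: less_eq_ennreal.rep_eq)
    \<comment> \<open>Nonemptiness matters: an empty supremum is 0 in \<open>ennreal\<close> but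
      -\<infinity> in \<open>ereal\<close>.\<close>
    also have "\<dots> = (SUP B\<in>intervals l r x. enn2ereal (J (exit_time X B)))"
    proof -
      obtain B where "B \<in> intervals l r x" using intervals_nonempty by blast
      then have "0 \<le> (SUP B\<in>intervals l r x. enn2ereal (J (exit_time X B)))"
        by (rule SUP_upper2) simp
      then show ?thesis by (simp add: Sup_ennreal.rep_eq image_image max_absorb2)
    qed
    finally show "stopping_value (P x) X q g c T \<le> (SUP B\<in>intervals l r x. h_value P F X q g c x B) - ereal (\<delta> x)"
      unfolding stopping_value_eq[OF T] hv by (rule ereal_minus_mono) simp
  qed
  \<comment> \<open>Since \<delta> x is finite it can change sides, and the bound is then checked
    for each B.\<close>
  have "(SUP B\<in>intervals l r x. h_value P F X q g c x B)
    \<le> (SUP T\<in>{T. stopping_time F T}. stopping_value (P x) X q g c T) + ereal (\<delta> x)"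
  proof (rule SUP_least)
    fix B assume B: "B \<in> intervals l r x"
    have S: "stopping_time F (entrance_time B)" by (rule stopping_time_entrance_interval[OF B])
    have "h_value P F X q g c x B = stopping_value (P x) X q g c (entrance_time B) + ereal (\<delta> x)"
      unfolding stopping_value_eq[OF stopping_time_imp_optional[OF S]] h_value_eq[OF B]
        J_cong[OF AE_entrance_eq_exit[OF B]]
      by (cases "J (exit_time X B)") auto
    also have "\<dots> \<le> (SUP T\<in>{T. stopping_time F T}. stopping_value (P x) X q g c T) + ereal (\<delta> x)"
      using S by (intro add_right_mono SUP_upper) simp
    finally show "h_value P F X q g c x B \<le> (SUP T\<in>{T. stopping_time F T}. stopping_value (P x) X q g c T) + ereal (\<delta> x)" .
  qed
  then show "(SUP B\<in>intervals l r x. h_value P F X q g c x B) - ereal (\<delta> x)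
    \<le> (SUP T\<in>{T. stopping_time F T}. stopping_value (P x) X q g c T)"
    by (simp add: ereal_minus_le)
qed

lemma optimal_exit_time:
  assumes B: "B \<in> intervals l r x"
    and max: "h_value P F X q g c x B = (SUP B\<in>intervals l r x. h_value P F X q g c x B)"
  shows "optimal_stopping_time (P x) F (stopping_value (P x) X q g c) (exit_time X B)"
  unfolding optimal_stopping_time_def
proof (intro conjI exI)
  show "stopping_time F (entrance_time B)" by (rule stopping_time_entrance_interval[OF B])
  show "AE \<omega> in P x. entrance_time B \<omega> = exit_time X B \<omega>" by (rule AE_entrance_eq_exit[OF B])
  show "stopping_value (P x) X q g c (exit_time X B) = (SUP S\<in>{S. stopping_time F S}. stopping_value (P x) X q g c S)"
    unfolding value_identity max[symmetric] h_value_eq[OF B] by (rule stopping_value_eq[OF optional_exit_interval[OF B]])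
qed

section \<open>Maximal ratios at boundary points\<close>

lemma bdry_outside:
  assumes B: "B \<in> intervals l r x" and u: "u \<in> bdry l r B"
  shows "u \<in> E" "u \<notin> B"
proof -
  have "open B" using intervalsE[OF B] by metis
  then show "u \<in> E" "u \<notin> B" using u by (auto simp: bdry_def frontier_def interior_open)
qed

lemma ratio_bdry:
  assumes B: "B \<in> intervals l r x" and u: "u \<in> bdry l r B"
  shows "ratio P X q g c x B u = G u * phi P X q B x"
  using h_fun_outside[OF B bdry_outside[OF B u]] by (simp add: ratio_def G_def)

lemma AE_exit_bdry:
  assumes B: "B \<in> intervals l r x"
  shows "AE \<omega> in P x. exit_time X B \<omega> \<noteq> \<top> \<longrightarrow> stopped X (exit_time X B) \<omega> \<in> bdry l r B"
  using AE_exit_frontier[OF B] by eventually_elim (auto simp: bdry_def)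

text \<open>Without boundary points in E there would be no exit in finite time, contrary to
  \<open>phi_pos\<close>. This keeps the condition on the boundary of B' from being vacuous.\<close>

lemma bdry_nonempty:
  assumes B: "B \<in> intervals l r x"
  shows "bdry l r B \<noteq> {}"
proof
  assume "bdry l r B = {}"
  then have "AE \<omega> in P x. discount q (exit_time X B \<omega>) = 0"
    using AE_exit_bdry[OF B] by (auto elim!: eventually_mono)
  then have "phi P X q B x = 0"
    unfolding phi_def by (simp add: integral_eq_zero_AE)
  with phi_pos[OF B] show False by simp
qed

text \<open>The h-transform has total mass 1, expressed under \<open>P x\<close>: the factor 1 / phi
  cancels the Laplace transform of the exit time.\<close>

lemma J_exit_const:
  assumes B: "B \<in> intervals l r x" and k: "0 \<le> k"
  shows "(\<integral>\<^sup>+ \<omega>. ennreal (discount q (exit_time X B \<omega>) * (k / phi P X q B x)) \<partial>P x) = ennreal k"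
proof -
  have "(\<integral>\<^sup>+ \<omega>. ennreal (discount q (exit_time X B \<omega>) * (k / phi P X q B x)) \<partial>P x) =
      ennreal (phi P X q B x) * ennreal (k / phi P X q B x)"
    using exit_measurable[OF B] k phi_nonneg[of B x]
    by (subst ennreal_mult) (simp_all add: nn_integral_multc measurable_P[OF xE] phi_eq_nn_integral[OF xE])
  then show ?thesis using phi_pos[OF B] k by (simp add: ennreal_mult[symmetric])
qed

text \<open>The value of B is the mean of its boundary ratios under a probability measure, hence at
  most the supremum \<rho> of all ratios; for B' every boundary ratio equals \<rho>, so the mean
  does too.\<close>

lemma optimal_ratio:
  assumes B': "B' \<in> intervals l r x"
    and max: "\<And>u'. u' \<in> bdry l r B' \<Longrightarrow> ereal (ratio P X q g c x B' u')
      = Sup {ereal (ratio P X q g c x B u) | B u. B \<in> intervals l r x \<and> u \<in> bdry l r B}"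
  shows "u' \<in> bdry l r B' \<Longrightarrow> (SUP B\<in>intervals l r x. h_value P F X q g c x B) = ereal (ratio P X q g c x B' u')"
    and "h_value P F X q g c x B' = (SUP B\<in>intervals l r x. h_value P F X q g c x B)"
proof -
  obtain u0 where u0: "u0 \<in> bdry l r B'" using bdry_nonempty[OF B'] by blast
  define \<rho> where "\<rho> = ratio P X q g c x B' u0"
  have \<rho>: "0 \<le> \<rho>"
    unfolding \<rho>_def ratio_bdry[OF B' u0] by (intro mult_nonneg_nonneg G_nonneg phi_nonneg bdry_outside[OF B' u0])
  \<comment> \<open>All boundary ratios of B' equal the same supremum, hence each other.\<close>
  have eq: "ratio P X q g c x B' u = \<rho>" if "u \<in> bdry l r B'" for u
    unfolding \<rho>_def using trans[OF max[OF that] max[OF u0, symmetric]] by simp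
  have le: "ratio P X q g c x B u \<le> \<rho>" if "B \<in> intervals l r x" "u \<in> bdry l r B" for B u
  proof -
    have "ereal (ratio P X q g c x B u) \<le> Sup {ereal (ratio P X q g c x B u) | B u. B \<in> intervals l r x \<and> u \<in> bdry l r B}"
      using that by (intro Sup_upper) blast
    then show ?thesis unfolding max[OF u0, symmetric] by (simp add: \<rho>_def)
  qed
  have upper: "h_value P F X q g c x B \<le> ereal \<rho>" if B: "B \<in> intervals l r x" for B
  proof -
    have "J (exit_time X B) \<le> (\<integral>\<^sup>+ \<omega>. ennreal (discount q (exit_time X B \<omega>) * (\<rho> / phi P X q B x)) \<partial>P x)"
      unfolding J_def
    proof (rule nn_integral_mono_AE, use AE_exit_bdry[OF B] in eventually_elim)
      case (elim \<omega>)
      show ?case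
      proof (cases "exit_time X B \<omega> = \<top>")
        case False
        with elim have "stopped X (exit_time X B) \<omega> \<in> bdry l r B" by simp
        then have "G (stopped X (exit_time X B) \<omega>) \<le> \<rho> / phi P X q B x"
          using le[OF B] ratio_bdry[OF B] phi_pos[OF B] by (simp add: pos_le_divide_eq)
        then show ?thesis by (intro ennreal_leI mult_left_mono) simp_all
      qed simp
    qed
    also have "\<dots> = ennreal \<rho>" by (rule J_exit_const[OF B \<rho>])
    finally have "enn2ereal (J (exit_time X B)) \<le> enn2ereal (ennreal \<rho>)"
      by (simp only: less_eq_ennreal.rep_eq)
    then show ?thesis using \<rho> by (simp add: h_value_eq[OF B])
  qed
  have "J (exit_time X B') = (\<integral>\<^sup>+ \<omega>. ennreal (discount q (exit_time X B' \<omega>) * (\<rho> / phi P X q B' x)) \<partial>P x)"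
    unfolding J_def
  proof (rule nn_integral_cong_AE, use AE_exit_bdry[OF B'] in eventually_elim)
    case (elim \<omega>)
    show ?case
    proof (cases "exit_time X B' \<omega> = \<top>")
      case False
      with elim have "stopped X (exit_time X B') \<omega> \<in> bdry l r B'" by simp
      then have "G (stopped X (exit_time X B') \<omega>) = \<rho> / phi P X q B' x"
        using eq ratio_bdry[OF B'] phi_pos[OF B'] by (simp add: eq_divide_eq)
      then show ?thesis by simp
    qed simp
  qed
  also have "\<dots> = ennreal \<rho>" by (rule J_exit_const[OF B' \<rho>])
  finally have attained: "h_value P F X q g c x B' = ereal \<rho>"
    using \<rho> by (simp add: h_value_eq[OF B'])
  have sup: "(SUP B\<in>intervals l r x. h_value P F X q g c x B) = ereal \<rho>"
  proof (rule antisym)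
    show "(SUP B\<in>intervals l r x. h_value P F X q g c x B) \<le> ereal \<rho>"
      by (rule SUP_least) (rule upper)
    show "ereal \<rho> \<le> (SUP B\<in>intervals l r x. h_value P F X q g c x B)"
      unfolding attained[symmetric] by (rule SUP_upper[OF B'])
  qed
  show "h_value P F X q g c x B' = (SUP B\<in>intervals l r x. h_value P F X q g c x B)"
    by (simp only: sup attained)
  show "(SUP B\<in>intervals l r x. h_value P F X q g c x B) = ereal (ratio P X q g c x B' u')" if "u' \<in> bdry l r B'"
    using eq[OF that] by (simp only: sup)
qed

end

theorem theorem3p9:
  fixes M :: "'a measure"
    and F :: "ennreal \<Rightarrow> 'a measure"
    and P :: "real \<Rightarrow> 'a measure"
    and X :: "real \<Rightarrow> 'a \<Rightarrow> real"
    and l r :: ereal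
    and b \<sigma> g c :: "real \<Rightarrow> real"
    and q x :: real
  assumes "regular_linear_diffusion M F P X l r b \<sigma>"
    and "q > 0"
    and "continuous_on (state_space l r) g" and "\<And>y. y \<in> state_space l r \<Longrightarrow> g y \<ge> 0"
    and "continuous_on (state_space l r) c" and "\<And>y. y \<in> state_space l r \<Longrightarrow> c y \<ge> 0"
    and "x \<in> state_space l r"
    and "\<And>y. y \<in> state_space l r \<Longrightarrow> total_cost P X q c y < \<top>"
  shows
    "(SUP T\<in>{T. stopping_time F T}. stopping_value (P x) X q g c T)
       = (SUP B\<in>intervals l r x. h_value P F X q g c x B) - ereal (delta P X q c x)
     \<and> (\<forall>B'\<in>intervals l r x.
          h_value P F X q g c x B' = (SUP B\<in>intervals l r x. h_value P F X q g c x B) \<longrightarrow>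
          optimal_stopping_time (P x) F (stopping_value (P x) X q g c) (exit_time X B'))
     \<and> (\<forall>B'\<in>intervals l r x.
          (\<forall>u'\<in>bdry l r B'. ereal (ratio P X q g c x B' u')
             = Sup {ereal (ratio P X q g c x B u) | B u. B \<in> intervals l r x \<and> u \<in> bdry l r B}) \<longrightarrow>
          (\<forall>u'\<in>bdry l r B'. (SUP B\<in>intervals l r x. h_value P F X q g c x B)
             = ereal (ratio P X q g c x B' u'))
          \<and> h_value P F X q g c x B' = (SUP B\<in>intervals l r x. h_value P F X q g c x B)
          \<and> optimal_stopping_time (P x) F (stopping_value (P x) X q g c) (exit_time X B'))"
proof -
  interpret stopping_problem M F P X l r b \<sigma> q g c x
    using assms
    by (simp add: stopping_problem_def discounted_diffusion_def discounted_diffusion_axioms_def stopping_problem_axioms_def)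
  show ?thesis
    using value_identity optimal_exit_time optimal_ratio by blast
qed

end
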